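(* Let $\tilde N$ be a cylindrical network with shift vector $\tilde g$ and projection $N$, let $r\ge1$, and let $\tilde{\mathbf u}=(\tilde u_1,\dots,\tilde u_r)$ and $\tilde{\mathbf v}=(\tilde v_1,\dots,\tilde v_r)$ be two $r$-vertices of $\tilde N$. For $\ell\ge0$ let $\tilde{\mathbf v}_\ell=(\tilde v_1+\ell\tilde g,\dots,\tilde v_r+\ell\tilde g)$ and define $f:\mathbb N\to K$ by $f(\ell)=\sum_{\sigma\in\mathfrak S_r}\mathrm{sgn}(\sigma)\,\tilde N(\tilde{\mathbf u},\sigma\tilde{\mathbf v}_\ell)$. Then: (1) for any cylindrical network $\tilde N$, $f$ satisfies a linear recurrence with characteristic polynomial $Q_N^{(h_r)}(t)$; (2) if $\tilde N$ is a planar cylindrical network, $f$ satisfies a linear recurrence with characteristic polynomial $Q_N^{(e_r)}(t)$. In both cases the recurrence holds for all but finitely many $\ell$.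
   Context: Let $K$ be a field of characteristic zero. Fix reals $A<B$, the strip $\mathcal S=\{(x,y)\in\mathbb R^2: A\le y\le B\}$ and a vector $\tilde g=(m,0)$, $m>0$. A cylindrical network is a triple $\tilde N=(\tilde V,\tilde E,\mathrm{wt})$ such that: (1) $\tilde V$ is a discrete subset of $\mathcal S$ with $\tilde V+\tilde g=\tilde V$; (2) $\tilde E\subset\tilde V\times\tilde V$ is a set of directed edges with $(\tilde u,\tilde v)\in\tilde E\Rightarrow(\tilde u+\tilde g,\tilde v+\tilde g)\in\tilde E$; (3) $\mathrm{wt}:\tilde E\to K$ is invariant under the shift by $\tilde g$; (4) every vertex has finitely many incoming and outgoing edges; (5) if there is a directed path from $\tilde v$ to $\tilde v+\ell\tilde g$ ($\ell\in\mathbb Z$) then $\ell>0$. The projection $N$ is the finite weighted directed graph $(\tilde V/\mathbb Z\tilde g,\tilde E/\mathbb Z\tilde g)$ with inherited weights. A simple cycle $C$ of $N$ is a directed cycle visiting each vertex at most once; $\mathrm{wt}(C)$ is the product of its edge weights; $\mathrm{wind}(C)$ is the integer $\ell$ such that any lift of $C$ to $\tilde N$ is a path from some $\tilde w$ to $\tilde w+\ell\tilde g$. An $r$-cycle is a collection of $r$ pairwise vertex-disjoint simple cycles of $N$ (each collection counted once), with weight the product and winding number the sum of those of its cycles; $\mathcal C^r(N)$ denotes the set of $r$-cycles ($\mathcal C^0(N)$ contains only the empty collection, weight $1$, winding $0$). Let $d$ be the maximal winding number of an $r$-cycle, $r\ge0$, and $Q_N(t)=\sum_{r\ge0}(-1)^{d-r}\sum_{\mathbf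 C\in\mathcal C^r(N)}t^{d-\mathrm{wind}(\mathbf C)}\mathrm{wt}(\mathbf C)$. Write $Q_N(t)=\prod_{i=1}^d(t-\gamma_i)$ with $\gamma_i$ in the algebraic closure of $K$, and set $Q_N^{(h_r)}(t)=\prod_{1\le i_1\le\dots\le i_r\le d}(t-\gamma_{i_1}\cdots\gamma_{i_r})$ and $Q_N^{(e_r)}(t)=\prod_{1\le i_1<\dots<i_r\le d}(t-\gamma_{i_1}\cdots\gamma_{i_r})$ (these lie in $K[t]$). An $r$-vertex is an $r$-tuple of distinct vertices of $\tilde N$; for $\sigma\in\mathfrak S_r$, $\sigma\tilde{\mathbf v}=(\tilde v_{\sigma(1)},\dots,\tilde v_{\sigma(r)})$. An $r$-path from $\tilde{\mathbf u}$ to $\tilde{\mathbf v}$ is an $r$-tuple $(\tilde P_1,\dots,\tilde P_r)$ of pairwise vertex-disjoint directed paths, $\tilde P_i$ from $\tilde u_i$ to $\tilde v_i$; its weight is the product of all its edge weights; $\tilde N(\tilde{\mathbf u},\tilde{\mathbf v})$ is the sum of weights of all $r$-paths from $\tilde{\mathbf u}$ to $\tilde{\mathbf v}$. $\tilde N$ is planar if each edge $\tilde e=(\tilde u,\tilde v)$ has an embedding $h_{\tilde e}:[0,1]\to\mathcal S$ with $h_{\tilde e}(0)=\tilde u$, $h_{\tilde e}(1)=\tilde v$, such that $h_{\tilde e}((0,1))$ meets no other $h_{\tilde e'}([0,1])$ and contains no vertex, and $h_{\tilde e+\tilde g}(t)=h_{\tilde e}(t)+\tilde g$. A sequence $f:\mathbb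 N\to K$ satisfies a linear recurrence with characteristic polynomial $Q(t)=t^D-\alpha_1t^{D-1}+\dots+(-1)^D\alpha_D$ if $f(n+D)-\alpha_1f(n+D-1)+\dots+(-1)^D\alpha_Df(n)=0$ for all but finitely many $n$.
   Formalization: The factorization of Q_N is read as Q_N(t) = (-1)^d ∏(t-γ_i), since its leading coefficient is (-1)^d; the edge set is invariant under shifts by both g and -g; the vertex set is discrete and closed; condition (5) concerns paths with at least one edge. *)

theory Defs
  imports
    "HOL-Analysis.Analysis"
    "HOL-Combinatorics.Permutations"
    "HOL-Algebra.Algebraic_Closure_Type"
    "Graph_Theory.Arc_Walk"
begin

type_synonym point = "real \<times> real"
type_synonym edge = "point \<times> point"

record 'k network =
  vertices :: "point set"
  edges :: "edge set"
  wt :: "edge \<Rightarrow> 'k"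

definition strip :: "real \<Rightarrow> real \<Rightarrow> point set" where
  "strip A B = {(x, y). A \<le> y \<and> y \<le> B}"

definition cover :: "'k network \<Rightarrow> (point, edge) pre_digraph" where
  "cover N = \<lparr>verts = vertices N, arcs = edges N, tail = fst, head = snd\<rparr>"

text \<open>
  An edge \<open>(u, v)\<close> is shifted by adding \<open>(g, g)\<close>. \<open>Discrete\<close> means without accumulation
  points in the plane, i.e. discrete and closed; otherwise the quotient need not be finite.
  The group generated by \<open>g\<close> has to act on the edges for the quotient to make sense, so the
  shift condition on edges is an equivalence. The condition on paths concerns paths with
  at least one edge, since the empty path leads from \<open>v\<close> to \<open>v + 0 g\<close>.
\<close>

definition cylindrical_network :: "real \<Rightarrow> real \<Rightarrow> point \<Rightarrow> 'k network \<Rightarrow> bool" where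
  "cylindrical_network A B g N \<longleftrightarrow>
     vertices N \<subseteq> strip A B \<and> discrete (vertices N) \<and> closed (vertices N) \<and>
     (\<lambda>v. v + g) ` vertices N = vertices N \<and>
     edges N \<subseteq> vertices N \<times> vertices N \<and>
     (\<forall>e. e \<in> edges N \<longleftrightarrow> e + (g, g) \<in> edges N) \<and>
     (\<forall>e\<in>edges N. wt N (e + (g, g)) = wt N e) \<and>
     (\<forall>v\<in>vertices N. finite (in_arcs (cover N) v) \<and> finite (out_arcs (cover N) v)) \<and>
     (\<forall>v p l. pre_digraph.awalk (cover N) v p (v + of_int l *\<^sub>R g) \<and> p \<noteq> [] \<longrightarrow> l > 0)"

definition shift_orbit :: "'a::real_vector \<Rightarrow> 'a \<Rightarrow> 'a set" where
  "shift_orbit w x = range (\<lambda>l::int. x + of_int l *\<^sub>R w)"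

text \<open>
  The projection may have parallel arcs and loops. An arc is an orbit of edges,
  and its pointwise images under \<open>fst\<close> and \<open>snd\<close> are the orbits of its end points.
\<close>

definition projection :: "point \<Rightarrow> 'k network \<Rightarrow> (point set, edge set) pre_digraph" where
  "projection g N =
     \<lparr>verts = shift_orbit g ` vertices N, arcs = shift_orbit (g, g) ` edges N,
      tail = (\<lambda>e. fst ` e), head = (\<lambda>e. snd ` e)\<rparr>"

definition proj_wt :: "'k network \<Rightarrow> edge set \<Rightarrow> 'k" where
  "proj_wt N e = the_elem (wt N ` e)"

text \<open>
  A simple cycle is represented by its set of arcs, which identifies
  the cyclic rotations of a closed walk.
\<close>

definition simple_cycles :: "point \<Rightarrow> 'k network \<Rightarrow> edge set set set" where
  "simple_cycles g N = {set c |c. pre_digraph.cycle (projection g N) c}"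

definition cycle_verts :: "point \<Rightarrow> 'k network \<Rightarrow> edge set set \<Rightarrow> point set set" where
  "cycle_verts g N C = tail (projection g N) ` C"

definition cycle_wt :: "'k::comm_monoid_mult network \<Rightarrow> edge set set \<Rightarrow> 'k" where
  "cycle_wt N C = (\<Prod>e\<in>C. proj_wt N e)"

definition is_lift ::
    "point \<Rightarrow> 'k network \<Rightarrow> edge set set \<Rightarrow> point \<Rightarrow> edge list \<Rightarrow> point \<Rightarrow> bool" where
  "is_lift g N C w p w' \<longleftrightarrow>
     pre_digraph.awalk (cover N) w p w' \<and>
     pre_digraph.cycle (projection g N) (map (shift_orbit (g, g)) p) \<and>
     set (map (shift_orbit (g, g)) p) = C"

definition wind :: "point \<Rightarrow> 'k network \<Rightarrow> edge set set \<Rightarrow> int" where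
  "wind g N C = (THE l. \<forall>w p w'. is_lift g N C w p w' \<longrightarrow> w' = w + of_int l *\<^sub>R g)"

definition multicycles :: "point \<Rightarrow> 'k network \<Rightarrow> nat \<Rightarrow> edge set set set set" where
  "multicycles g N r =
     {Cs. Cs \<subseteq> simple_cycles g N \<and> finite Cs \<and> card Cs = r \<and>
          pairwise (\<lambda>C D. disjnt (cycle_verts g N C) (cycle_verts g N D)) Cs}"

definition multicycle_wt :: "'k::comm_monoid_mult network \<Rightarrow> edge set set set \<Rightarrow> 'k" where
  "multicycle_wt N Cs = (\<Prod>C\<in>Cs. cycle_wt N C)"

definition multicycle_wind :: "point \<Rightarrow> 'k network \<Rightarrow> edge set set set \<Rightarrow> int" where
  "multicycle_wind g N Cs = (\<Sum>C\<in>Cs. wind g N C)"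

definition max_wind :: "point \<Rightarrow> 'k network \<Rightarrow> nat" where
  "max_wind g N = nat (Max (multicycle_wind g N ` (\<Union>r. multicycles g N r)))"

text \<open>
  In a cylindrical network every simple cycle has positive winding number, so there are no
  \<open>r\<close>-cycles with \<open>r > max_wind g N\<close>, and the truncated subtraction and \<open>nat\<close> are harmless.
\<close>

definition Q_poly :: "point \<Rightarrow> 'k::comm_ring_1 network \<Rightarrow> 'k poly" where
  "Q_poly g N = (let d = max_wind g N in
     \<Sum>r\<le>d. Polynomial.smult ((-1) ^ (d - r))
       (\<Sum>Cs\<in>multicycles g N r.
          Polynomial.monom (multicycle_wt N Cs) (nat (int d - multicycle_wind g N Cs))))"

text \<open>
  The coefficient of \<open>Q_poly g N\<close> at \<open>t ^ d\<close> is \<open>(-1) ^ d\<close>, from the empty collection of cycles,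
  hence this factor in the factorization over the algebraic closure.
\<close>

definition Q_roots ::
    "point \<Rightarrow> 'k::field network \<Rightarrow> (nat \<Rightarrow> 'k alg_closure) \<Rightarrow> bool" where
  "Q_roots g N \<gamma> \<longleftrightarrow>
     map_poly to_ac (Q_poly g N) =
       Polynomial.smult ((-1) ^ max_wind g N) (\<Prod>i = 1..max_wind g N. [:- \<gamma> i, 1:])"

definition Q_h :: "nat \<Rightarrow> (nat \<Rightarrow> 'a::comm_ring_1) \<Rightarrow> nat \<Rightarrow> 'a poly" where
  "Q_h d \<gamma> r =
     (\<Prod>js\<in>{js. length js = r \<and> set js \<subseteq> {1..d} \<and> sorted_wrt (\<le>) js}.
        [:- prod_list (map \<gamma> js), 1:])"

definition Q_e :: "nat \<Rightarrow> (nat \<Rightarrow> 'a::comm_ring_1) \<Rightarrow> nat \<Rightarrow> 'a poly" where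
  "Q_e d \<gamma> r =
     (\<Prod>js\<in>{js. length js = r \<and> set js \<subseteq> {1..d} \<and> sorted_wrt (<) js}.
        [:- prod_list (map \<gamma> js), 1:])"

definition r_vertex :: "'k network \<Rightarrow> nat \<Rightarrow> point list \<Rightarrow> bool" where
  "r_vertex N r u \<longleftrightarrow> length u = r \<and> distinct u \<and> set u \<subseteq> vertices N"

definition r_paths :: "'k network \<Rightarrow> point list \<Rightarrow> point list \<Rightarrow> edge list list set" where
  "r_paths N u v =
     {ps. length ps = length u \<and>
          (\<forall>i<length u. pre_digraph.awalk (cover N) (u ! i) (ps ! i) (v ! i)) \<and>
          (\<forall>i<length u. \<forall>j<length u. i \<noteq> j \<longrightarrow>
             disjnt (set (pre_digraph.awalk_verts (cover N) (u ! i) (ps ! i)))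
                    (set (pre_digraph.awalk_verts (cover N) (u ! j) (ps ! j))))}"

definition path_sum :: "'k::comm_semiring_1 network \<Rightarrow> point list \<Rightarrow> point list \<Rightarrow> 'k" where
  "path_sum N u v = (\<Sum>ps\<in>r_paths N u v. prod_list (map (wt N) (concat ps)))"

definition signed_path_sum ::
    "point \<Rightarrow> 'k::comm_ring_1 network \<Rightarrow> nat \<Rightarrow> point list \<Rightarrow> point list \<Rightarrow> nat \<Rightarrow> 'k" where
  "signed_path_sum g N r u v l =
     (\<Sum>\<sigma> | \<sigma> permutes {..<r}.
        of_int (sign \<sigma>) * path_sum N u (permute_list \<sigma> (map (\<lambda>x. x + of_nat l *\<^sub>R g) v)))"

definition planar_network :: "real \<Rightarrow> real \<Rightarrow> point \<Rightarrow> 'k network \<Rightarrow> bool" where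
  "planar_network A B g N \<longleftrightarrow>
     (\<exists>h :: edge \<Rightarrow> real \<Rightarrow> point. \<forall>e\<in>edges N.
        arc (h e) \<and> path_image (h e) \<subseteq> strip A B \<and>
        pathstart (h e) = fst e \<and> pathfinish (h e) = snd e \<and>
        (\<forall>e'\<in>edges N. e' \<noteq> e \<longrightarrow> disjnt (h e ` {0<..<1}) (path_image (h e'))) \<and>
        disjnt (h e ` {0<..<1}) (vertices N) \<and>
        (\<forall>t\<in>{0..1}. h (e + (g, g)) t = h e t + g))"

definition linear_recurrence :: "(nat \<Rightarrow> 'k::comm_ring_1) \<Rightarrow> 'k poly \<Rightarrow> bool" where
  "linear_recurrence f Q \<longleftrightarrow>
     Polynomial.lead_coeff Q = 1 \<and>
     finite {n. (\<Sum>i\<le>Polynomial.degree Q. Polynomial.coeff Q i * f (n + i)) \<noteq> 0}"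

end

theory Submission
  imports Defs "HOL-Combinatorics.Cycles" "Jordan_Normal_Form.Determinant"
begin

text \<open>
  The covering network is acyclic and has finitely many paths between two vertices, so by the
  Lindstroem--Gessel--Viennot involution \<open>f l\<close> is the determinant of the path generating functions
  from \<open>u i\<close> to \<open>v j + l g\<close>. Read along the shift direction, the functions that belong to a fixed end
  point are vector-valued sequences, eventually annihilated by a polynomial matrix in the shift
  operator. Expanding its determinant over permutations gives signed collections of disjoint cycles,
  that is, \<open>Q_poly\<close> up to sign and a power of \<open>t\<close>. Hence the solutions of this matrix
  recurrence have a triangular basis for the shift whose diagonal consists of the \<open>\<gamma> i\<close> and
  zeros, each occurring as often as it is a root. As \<open>f\<close> is alternating in \<open>r\<close> solutions, only
  products of \<open>\<gamma> i\<close> with distinct indices can occur, which gives the recurrence with \<open>Q_e\<close>;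
  and \<open>Q_e\<close> divides \<open>Q_h\<close>.
\<close>

section \<open>The Lindstroem--Gessel--Viennot lemma\<close>

text \<open>The obstacle is that scalar recurrences are too weak. By the adjugate, every entry of
  the determinant separately satisfies a recurrence given by the determinant of the polynomial
  matrix, but for a product of r such entries this allows products of roots with repeated indices.
  So all start vertices in one period are kept together as coordinates: each end point then gives
  one element of a single space, of dimension at most the degree of that determinant, and the path
  determinant is an alternating multilinear function on this space. Conceptually it factors through
  the r-th exterior power, where the shift has the products over distinct indices as eigenvalues,
  and the Cayley-Hamilton theorem finishes. Roots may coincide, so an eigenbasis need not exist and
  a triangular one takes its place. Start vertices in different periods become different time
  offsets of the rows. The zero eigenvalues only cost finitely many initial terms. All this happens
  over the algebraic closure; the polynomials still have to be shown to have coefficients in the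
  ground field.\<close>

definition (in pre_digraph) path_gf :: "('b \<Rightarrow> 'k::comm_ring_1) \<Rightarrow> 'a \<Rightarrow> 'a \<Rightarrow> 'k" where
  "path_gf w x y = (\<Sum>p | awalk x p y. prod_list (map w p))"

text \<open>Reindexing by \<open>\<tau>\<close> shows that twice the sum vanishes. Characteristic
  zero thus makes fixed points of \<open>\<tau>\<close> harmless.\<close>

lemma sum_sign_reversing_involution:
  fixes f :: "'a \<Rightarrow> 'k::field_char_0"
  assumes "\<And>z. z \<in> S \<Longrightarrow> \<tau> z \<in> S" "\<And>z. z \<in> S \<Longrightarrow> \<tau> (\<tau> z) = z" "\<And>z. z \<in> S \<Longrightarrow> f (\<tau> z) = - f z"
  shows "sum f S = 0"
proof -
  have "sum f S = (\<Sum>z\<in>S. - f z)"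
    by (rule sum.reindex_bij_witness[where i = \<tau> and j = \<tau>])
      (auto simp: assms(1,2) assms(3)[THEN arg_cong[where f = uminus]])
  then have "sum f S + sum f S = 0" unfolding sum_negf eq_neg_iff_add_eq_0 .
  then have "2 * sum f S = 0" by (simp only: mult_2)
  then show ?thesis by simp
qed

section \<open>Splitting walks in acyclic digraphs\<close>

locale acyclic_digraph = wf_digraph +
  assumes closed_walk_Nil: "awalk x p x \<Longrightarrow> p = []"
begin

lemma awalk_antisym: "awalk x p y \<Longrightarrow> awalk y q x \<Longrightarrow> x = y"
  using closed_walk_Nil[of x "p @ q"] awalk_appendI[of x p y q x] awalk_Nil_iff by auto

text \<open>One prefix extends the other by a closed walk at \<open>y\<close>, which is empty. Hence
  a vertex determines its position on a walk, and \<open>before\<close> and \<open>after\<close> are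
  well defined.\<close>

lemma awalk_split_unique:
  assumes "q @ s = q' @ s'" "awalk x q y" "awalk x q' y"
  shows "q = q'"
proof -
  from assms(1) obtain t where "q = q' @ t \<or> q' = q @ t"
    by (metis append_eq_append_conv2)
  then show ?thesis
  proof
    assume q: "q = q' @ t"
    then have "awalk y t y" using assms(2,3) by (metis awalk_append_iff awalkE')
    then show ?thesis using q closed_walk_Nil by simp
  next
    assume q: "q' = q @ t"
    then have "awalk y t y" using assms(2,3) by (metis awalk_append_iff awalkE')
    then show ?thesis using q closed_walk_Nil by simp
  qed
qed

definition before :: "'a \<Rightarrow> 'a \<Rightarrow> 'b list \<Rightarrow> 'b list" where
  "before y x p = (THE q. awalk x q y \<and> (\<exists>s. p = q @ s))"

definition after :: "'a \<Rightarrow> 'a \<Rightarrow> 'b list \<Rightarrow> 'b list" where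
  "after y x p = drop (length (before y x p)) p"

lemma before_after_append:
  assumes "awalk x q y"
  shows "before y x (q @ s) = q" "after y x (q @ s) = s"
proof -
  show "before y x (q @ s) = q"
    unfolding before_def using assms awalk_split_unique by (intro the_equality) blast+
  then show "after y x (q @ s) = s" by (simp add: after_def)
qed

lemma before_after:
  assumes "awalk x p z" "y \<in> set (awalk_verts x p)"
  shows "awalk x (before y x p) y" "awalk y (after y x p) z" "before y x p @ after y x p = p"
  using awalk_decomp[OF assms] before_after_append by auto

end

text \<open>
  The sign-reversing involution exchanges the tails of two intersecting paths after a common
  vertex. \<open>first_crossing\<close> pins down the pair of paths and the vertex by a condition that is
  symmetric enough to survive the exchange; the order of the vertices along a path is expressed by
  reachability, which makes sense because the digraph is acyclic.
\<close>

locale path_tuples = acyclic_digraph G for G :: "('a, 'b) pre_digraph" (structure) +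
  fixes r :: nat and u v :: "nat \<Rightarrow> 'a"
begin

definition vs :: "(nat \<Rightarrow> 'b list) \<Rightarrow> nat \<Rightarrow> 'a set" where
  "vs P i = set (awalk_verts (u i) (P i))"

definition first_crossing :: "(nat \<Rightarrow> 'b list) \<Rightarrow> nat \<times> 'a \<times> nat \<Rightarrow> bool" where
  "first_crossing P = (\<lambda>(i, x, j). i < r \<and> j < r \<and> i \<noteq> j \<and>
     (\<forall>k<i. \<forall>l<r. l \<noteq> k \<longrightarrow> vs P k \<inter> vs P l = {}) \<and> x \<in> vs P i \<and> x \<in> vs P j \<and>
     (\<forall>y\<in>vs P i. y \<noteq> x \<and> (\<exists>s. awalk y s x) \<longrightarrow> (\<forall>l<r. l \<noteq> i \<longrightarrow> y \<notin> vs P l)) \<and>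
     (\<forall>l<j. l \<noteq> i \<longrightarrow> x \<notin> vs P l))"

definition tuples :: "(nat \<Rightarrow> nat) \<Rightarrow> (nat \<Rightarrow> 'b list) set" where
  "tuples \<sigma> = (\<Pi>\<^sub>E i\<in>{..<r}. {p. awalk (u i) p (v (\<sigma> i))})"

definition disjoint_tuple :: "(nat \<Rightarrow> 'b list) \<Rightarrow> bool" where
  "disjoint_tuple P \<longleftrightarrow> (\<forall>i<r. \<forall>j<r. i \<noteq> j \<longrightarrow> vs P i \<inter> vs P j = {})"

definition exchange :: "nat \<times> 'a \<times> nat \<Rightarrow> (nat \<Rightarrow> 'b list) \<Rightarrow> nat \<Rightarrow> 'b list" where
  "exchange = (\<lambda>(i, x, j) P.
     P(i := before x (u i) (P i) @ after x (u j) (P j),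
       j := before x (u j) (P j) @ after x (u i) (P i)))"

lemma first_crossingD:
  assumes "first_crossing P (i, x, j)"
  shows "i < r" "j < r" "i \<noteq> j" "x \<in> vs P i" "x \<in> vs P j"
    and "\<And>k l. k < i \<Longrightarrow> l < r \<Longrightarrow> l \<noteq> k \<Longrightarrow> vs P k \<inter> vs P l = {}"
    and "\<And>y s l. y \<in> vs P i \<Longrightarrow> y \<noteq> x \<Longrightarrow> awalk y s x \<Longrightarrow> l < r \<Longrightarrow> l \<noteq> i \<Longrightarrow> y \<notin> vs P l"
    and "\<And>l. l < j \<Longrightarrow> l \<noteq> i \<Longrightarrow> x \<notin> vs P l"
  using assms unfolding first_crossing_def split by meson+

lemma first_crossing_exists:
  assumes "P \<in> tuples \<sigma>" "\<not> disjoint_tuple P"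
  shows "\<exists>c. first_crossing P c"
proof -
  define M where "M i \<longleftrightarrow> i < r \<and> (\<exists>j<r. j \<noteq> i \<and> vs P i \<inter> vs P j \<noteq> {})" for i
  have "\<exists>i. M i" using assms(2) unfolding disjoint_tuple_def M_def by blast
  then obtain i where i: "M i" "\<And>k. k < i \<Longrightarrow> \<not> M k"
    using exists_least_iff[of M] by blast
  define shared where "shared x \<longleftrightarrow> (\<exists>j<r. j \<noteq> i \<and> x \<in> vs P j)" for x
  have "\<exists>x\<in>set (awalk_verts (u i) (P i)). shared x"
    using i(1) unfolding M_def shared_def vs_def by blast
  then obtain ys x zs where x: "awalk_verts (u i) (P i) = ys @ x # zs" "shared x" "\<forall>y\<in>set ys. \<not> shared y"
    by (metis split_list_first_prop)
  have walk: "awalk (u i) (P i) (v (\<sigma> i))"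
    using assms(1) i(1) unfolding tuples_def M_def by (auto simp: PiE_def Pi_def)
  obtain j where j: "j < r" "j \<noteq> i" "x \<in> vs P j" "\<And>l. l < j \<Longrightarrow> \<not> (l < r \<and> l \<noteq> i \<and> x \<in> vs P l)"
    using x(2) exists_least_iff[of "\<lambda>j. j < r \<and> j \<noteq> i \<and> x \<in> vs P j"] unfolding shared_def by blast
  \<comment> \<open>Here the order of the list is turned into reachability: a vertex that reaches
    \<open>x\<close> cannot be \<open>x\<close> or a later vertex, by antisymmetry, so it lies in
    \<open>ys\<close>, where nothing is shared.\<close>
  have "\<not> shared y" if y: "y \<in> vs P i" "y \<noteq> x" "awalk y s x" for y s
  proof -
    obtain q t where qt: "cas x t (v (\<sigma> i))" "P i = q @ t" "awalk_verts x t = x # zs"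
      using awalk_decomp_verts[of "u i" "P i" "v (\<sigma> i)" ys x zs] walk x(1) by (metis awalkE')
    have "x \<in> verts G" using walk x(1) by (metis awalkE' in_set_conv_decomp subsetD)
    then have t: "awalk x t (v (\<sigma> i))" using walk qt by (auto simp: awalk_def)
    have "y \<notin> set (x # zs)"
    proof
      assume "y \<in> set (x # zs)"
      then obtain q' where "awalk x q' y" using awalk_decomp[OF t] qt(3) by auto
      then show False using awalk_antisym y by blast
    qed
    then show ?thesis using y(1) x unfolding vs_def by auto
  qed
  moreover have "vs P k \<inter> vs P l = {}" if "k < i" "l < r" "l \<noteq> k" for k l
    using i that unfolding M_def by (meson less_trans)
  moreover have "x \<notin> vs P l" if "l < j" "l \<noteq> i" for l
    using j that by (meson less_trans)
  moreover have "x \<in> vs P i" unfolding vs_def x(1) by simp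
  ultimately have "first_crossing P (i, x, j)"
    using i(1) j unfolding first_crossing_def M_def shared_def by blast
  then show ?thesis by blast
qed

text \<open>Each component is minimal given the previous ones. Two candidate vertices lie on one
  walk, so one reaches the other, and minimality identifies them. Uniqueness forces the choice made
  in \<open>crossing_sum_zero\<close> to return the same triple after the exchange.\<close>

lemma first_crossing_unique:
  assumes "P \<in> tuples \<sigma>" "first_crossing P c" "first_crossing P c'"
  shows "c = c'"
proof -
  obtain i x j i' x' j' where c: "c = (i, x, j)" "c' = (i', x', j')" by (metis prod_cases3)
  note F = first_crossingD[OF assms(2)[unfolded c(1)]]
  note F' = first_crossingD[OF assms(3)[unfolded c(2)]]
  have "\<not> i < i'" using F'(6)[of i j] F(1-5) by blast
  moreover have "\<not> i' < i" using F(6)[of i' j'] F'(1-5) by blast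
  ultimately have ii: "i = i'" by simp
  have walk: "awalk (u i) (P i) (v (\<sigma> i))"
    using assms(1) F(1) unfolding tuples_def by (auto simp: PiE_def Pi_def)
  have "(\<exists>s. awalk x s x') \<or> (\<exists>s. awalk x' s x)"
  proof -
    obtain q s where q: "P i = q @ s" "awalk (u i) q x" "awalk x s (v (\<sigma> i))"
      using awalk_decomp[OF walk, of x] F(4) unfolding vs_def by blast
    then have "x' \<in> set (awalk_verts (u i) q) \<union> set (awalk_verts x s)"
      using F'(4) ii set_awalk_verts_append[OF q(2,3)] q(1) unfolding vs_def by auto
    then show ?thesis using awalk_decomp[OF q(2)] awalk_decomp[OF q(3)] by blast
  qed
  moreover have "x' = x" if "awalk x s x'" for s
    using F'(7)[of x s j] that F(2-5) ii by blast
  moreover have "x = x'" if "awalk x' s x" for s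
    using F(7)[of x' s j'] that F'(2-5) ii by blast
  ultimately have xx: "x = x'" by blast
  have "\<not> j < j'" "\<not> j' < j" using F(2,3,5,8) F'(2,3,5,8) ii xx by blast+
  then show ?thesis using c ii xx by auto
qed

context
  fixes \<sigma> P i x j
  assumes P: "P \<in> tuples \<sigma>" and fc: "first_crossing P (i, x, j)"
begin

private lemma ij: "i < r" "j < r" "i \<noteq> j" "x \<in> vs P i" "x \<in> vs P j"
  using first_crossingD[OF fc] by auto

private lemma walks: "awalk (u i) (P i) (v (\<sigma> i))" "awalk (u j) (P j) (v (\<sigma> j))"
  using P ij unfolding tuples_def by (auto simp: PiE_def Pi_def)

private lemmas bi = before_after[OF walks(1) ij(4)[unfolded vs_def]]
private lemmas bj = before_after[OF walks(2) ij(5)[unfolded vs_def]]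

private lemma exchange_apply:
  "exchange (i, x, j) P i = before x (u i) (P i) @ after x (u j) (P j)"
  "exchange (i, x, j) P j = before x (u j) (P j) @ after x (u i) (P i)"
  "k \<noteq> i \<Longrightarrow> k \<noteq> j \<Longrightarrow> exchange (i, x, j) P k = P k"
  using ij by (auto simp: exchange_def)

lemma exchange_in_tuples: "exchange (i, x, j) P \<in> tuples (\<sigma> \<circ> Transposition.transpose i j)"
proof -
  have "awalk (u k) (exchange (i, x, j) P k) (v ((\<sigma> \<circ> Transposition.transpose i j) k))" if "k < r" for k
  proof -
    consider "k = i" | "k = j" | "k \<noteq> i" "k \<noteq> j" by blast
    then show ?thesis
    proof cases
      case 3
      then show ?thesis using P that unfolding tuples_def
        by (auto simp: exchange_apply(3) PiE_def Pi_def)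
    qed (use bi bj ij in \<open>auto simp: exchange_apply\<close>)
  qed
  moreover have "exchange (i, x, j) P k = undefined" if "\<not> k < r" for k
    using that ij P exchange_apply(3)[of k] unfolding tuples_def
    by (auto simp: PiE_def extensional_def)
  ultimately show ?thesis unfolding tuples_def by (auto simp: PiE_def extensional_def)
qed

private lemma vs_P:
  "vs P i = set (awalk_verts (u i) (before x (u i) (P i))) \<union> set (awalk_verts x (after x (u i) (P i)))"
  "vs P j = set (awalk_verts (u j) (before x (u j) (P j))) \<union> set (awalk_verts x (after x (u j) (P j)))"
  using set_awalk_verts_append[OF bi(1,2)] set_awalk_verts_append[OF bj(1,2)] bi(3) bj(3)
  unfolding vs_def by auto

private lemma vs_exchange:
  "vs (exchange (i, x, j) P) i =
     set (awalk_verts (u i) (before x (u i) (P i))) \<union> set (awalk_verts x (after x (u j) (P j)))"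
  "vs (exchange (i, x, j) P) j =
     set (awalk_verts (u j) (before x (u j) (P j))) \<union> set (awalk_verts x (after x (u i) (P i)))"
  "k \<noteq> i \<Longrightarrow> k \<noteq> j \<Longrightarrow> vs (exchange (i, x, j) P) k = vs P k"
  using set_awalk_verts_append[OF bi(1) bj(2)] set_awalk_verts_append[OF bj(1) bi(2)]
  unfolding vs_def by (auto simp: exchange_apply)

text \<open>Only vertices behind \<open>x\<close> change their path, and they move within the union
  of the paths \<open>i\<close> and \<open>j\<close>. By acyclicity none of them except
  \<open>x\<close> reaches \<open>x\<close>, so the minimality condition sees only the parts before
  \<open>x\<close>, which stay in place.\<close>

lemma first_crossing_exchange: "first_crossing (exchange (i, x, j) P) (i, x, j)"
proof -
  let ?Q = "exchange (i, x, j) P"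
  note F = first_crossingD[OF fc]
  have "j > i" using F(6)[of j i] ij by (metis disjoint_iff linorder_neqE_nat)
  have 1: "vs ?Q k \<inter> vs ?Q l = {}" if "k < i" "l < r" "l \<noteq> k" for k l
  proof -
    have k: "vs ?Q k = vs P k" using that \<open>j > i\<close> by (intro vs_exchange(3)) auto
    have "vs ?Q l \<subseteq> vs P l \<union> vs P i \<union> vs P j"
      using vs_exchange(1,2) vs_exchange(3)[of l] vs_P by (cases "l = i"; cases "l = j") auto
    moreover have "vs P k \<inter> vs P l = {}" "vs P k \<inter> vs P i = {}" "vs P k \<inter> vs P j = {}"
      using F(6)[of k] that \<open>j > i\<close> ij(1,2) by auto
    ultimately show ?thesis using k by blast
  qed
  have x: "x \<in> vs ?Q i" "x \<in> vs ?Q j"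
    unfolding vs_exchange using bi(2) bj(2) hd_in_awalk_verts by blast+
  have later: "\<not> (\<exists>s. awalk y s x)"
    if "y \<noteq> x" "y \<in> set (awalk_verts x (after x (u i) (P i))) \<union> set (awalk_verts x (after x (u j) (P j)))" for y
    using that awalk_decomp[OF bi(2)] awalk_decomp[OF bj(2)] awalk_antisym by (metis Un_iff)
  have 2: "y \<notin> vs ?Q l" if "y \<in> vs ?Q i" "y \<noteq> x" "awalk y s x" "l < r" "l \<noteq> i" for y s l
  proof -
    have y: "y \<in> vs P i" using later that vs_exchange(1) vs_P by blast
    then have "y \<notin> vs P l" "y \<notin> vs P j" using F(7)[of y s] that ij(2,3) by blast+
    then show ?thesis
      using that later vs_exchange vs_P by (cases "l = j") blast+
  qed
  have 3: "x \<notin> vs ?Q l" if "l < j" "l \<noteq> i" for l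
    using F(8)[OF that] that vs_exchange(3)[of l] by auto
  show ?thesis unfolding first_crossing_def using ij x 1 2 3 by auto
qed

lemma exchange_exchange: "exchange (i, x, j) (exchange (i, x, j) P) = P"
proof
  fix k
  show "exchange (i, x, j) (exchange (i, x, j) P) k = P k"
    using ij bi bj before_after_append
    by (cases "k = i"; cases "k = j") (simp_all add: exchange_def)
qed

lemma exchange_weight:
  fixes w :: "'b \<Rightarrow> 'k::comm_ring_1"
  shows "(\<Prod>k<r. prod_list (map w (exchange (i, x, j) P k))) = (\<Prod>k<r. prod_list (map w (P k)))"
proof -
  have split: "(\<Prod>k<r. f k) = f i * f j * (\<Prod>k\<in>{..<r} - {i, j}. f k)" for f :: "nat \<Rightarrow> 'k"
  proof -
    have "{..<r} = insert i (insert j ({..<r} - {i, j}))" using ij by auto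
    then have "(\<Prod>k<r. f k) = prod f (insert i (insert j ({..<r} - {i, j})))" by simp
    also have "\<dots> = f i * (f j * prod f ({..<r} - {i, j}))"
      using ij by (subst prod.insert, simp, simp)+ simp
    finally show ?thesis by (simp add: mult.assoc)
  qed
  have "prod_list (map w (P i)) = prod_list (map w (before x (u i) (P i))) * prod_list (map w (after x (u i) (P i)))"
    "prod_list (map w (P j)) = prod_list (map w (before x (u j) (P j))) * prod_list (map w (after x (u j) (P j)))"
    using bi(3) bj(3) by (metis map_append prod_list.append)+
  then show ?thesis unfolding split[of "\<lambda>k. prod_list (map w (P k))"]
     split[of "\<lambda>k. prod_list (map w (exchange (i, x, j) P k))"]
    by (simp add: exchange_apply)
qed

end

text \<open>The exchange preserves the weight and composes the permutation with a transposition, so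
  it reverses the sign. Summing over pairs is essential because the exchange moves a tuple to a
  different permutation.\<close>

lemma crossing_sum_zero:
  fixes w :: "'b \<Rightarrow> 'k::field_char_0"
  assumes "\<And>i j. i < r \<Longrightarrow> j < r \<Longrightarrow> finite {p. awalk (u i) p (v j)}"
  shows "(\<Sum>(\<sigma>, P)\<in>(SIGMA \<sigma>:{\<sigma>. \<sigma> permutes {..<r}}. {P \<in> tuples \<sigma>. \<not> disjoint_tuple P}).
           of_int (sign \<sigma>) * (\<Prod>i<r. prod_list (map w (P i)))) = 0"
proof -
  let ?X = "SIGMA \<sigma>:{\<sigma>. \<sigma> permutes {..<r}}. {P \<in> tuples \<sigma>. \<not> disjoint_tuple P}"
  let ?f = "\<lambda>(\<sigma>, P). of_int (sign \<sigma>) * (\<Prod>i<r. prod_list (map w (P i))) :: 'k"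
  define c where "c P = (SOME c. first_crossing P c)" for P
  define \<tau> where "\<tau> = (\<lambda>(\<sigma> :: nat \<Rightarrow> nat, P). (\<sigma> \<circ> Transposition.transpose (fst (c P)) (snd (snd (c P))), exchange (c P) P))"
  have main: "\<tau> z \<in> ?X \<and> \<tau> (\<tau> z) = z \<and> ?f (\<tau> z) = - ?f z" if z: "z \<in> ?X" for z
  proof -
    obtain \<sigma> P where zP: "z = (\<sigma>, P)" by (cases z)
    with z have P: "P \<in> tuples \<sigma>" and nd: "\<not> disjoint_tuple P" and s: "\<sigma> permutes {..<r}" by auto
    obtain i x j where cP: "c P = (i, x, j)" by (metis prod_cases3)
    have fc: "first_crossing P (i, x, j)"
      using first_crossing_exists[OF P nd] cP unfolding c_def by (metis someI_ex)
    let ?Q = "exchange (i, x, j) P"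
    have Q: "?Q \<in> tuples (\<sigma> \<circ> Transposition.transpose i j)" by (rule exchange_in_tuples[OF P fc])
    have fQ: "first_crossing ?Q (i, x, j)" by (rule first_crossing_exchange[OF P fc])
    have cQ: "c ?Q = (i, x, j)"
      unfolding c_def using fQ first_crossing_unique[OF Q] by (intro some_equality) auto
    have ij: "i < r" "j < r" "i \<noteq> j" using fc by (auto simp: first_crossing_def)
    have ndQ: "\<not> disjoint_tuple ?Q"
      using fQ ij unfolding first_crossing_def disjoint_tuple_def by blast
    have s': "\<sigma> \<circ> Transposition.transpose i j permutes {..<r}"
      using ij s by (intro permutes_compose permutes_swap_id) auto
    have sg: "sign (\<sigma> \<circ> Transposition.transpose i j) = - sign \<sigma>"
      using ij(3) sign_compose[OF permutes_imp_permutation[OF finite_lessThan s] permutation_swap_id]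
      by (simp add: sign_swap_id)
    show ?thesis
      using Q ndQ s' exchange_exchange[OF P fc] exchange_weight[OF P fc, of w]
      by (simp add: \<tau>_def zP cP cQ sg o_assoc[symmetric])
  qed
  show ?thesis by (rule sum_sign_reversing_involution[where \<tau> = \<tau>]) (use main in blast)+
qed

text \<open>The product of path sums expands into a sum over all tuples of walks. Those with a
  crossing cancel, over all permutations together.\<close>

theorem lindstroem_gessel_viennot:
  fixes w :: "'b \<Rightarrow> 'k::field_char_0"
  assumes fin: "\<And>i j. i < r \<Longrightarrow> j < r \<Longrightarrow> finite {p. awalk (u i) p (v j)}"
  shows "(\<Sum>\<sigma> | \<sigma> permutes {..<r}. of_int (sign \<sigma>) *
            (\<Sum>P | P \<in> tuples \<sigma> \<and> disjoint_tuple P. \<Prod>i<r. prod_list (map w (P i)))) =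
         (\<Sum>\<sigma> | \<sigma> permutes {..<r}. of_int (sign \<sigma>) * (\<Prod>i<r. path_gf w (u i) (v (\<sigma> i))))"
proof -
  have finT: "finite (tuples \<sigma>)" if "\<sigma> permutes {..<r}" for \<sigma>
    unfolding tuples_def using fin that by (intro finite_PiE) (auto dest: permutes_in_image[THEN iffD2])
  have "(\<Prod>i<r. path_gf w (u i) (v (\<sigma> i))) = (\<Sum>P\<in>tuples \<sigma>. \<Prod>i<r. prod_list (map w (P i)))"
    if "\<sigma> permutes {..<r}" for \<sigma>
    unfolding path_gf_def tuples_def using fin that
    by (intro prod_sum_PiE) (auto dest: permutes_in_image[THEN iffD2])
  moreover have "(\<Sum>P\<in>tuples \<sigma>. \<Prod>i<r. prod_list (map w (P i))) =
     (\<Sum>P | P \<in> tuples \<sigma> \<and> disjoint_tuple P. \<Prod>i<r. prod_list (map w (P i))) +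
     (\<Sum>P | P \<in> tuples \<sigma> \<and> \<not> disjoint_tuple P. \<Prod>i<r. prod_list (map w (P i)))"
    if "\<sigma> permutes {..<r}" for \<sigma>
    using finT[OF that] by (subst sum.union_disjoint[symmetric]) (auto intro!: sum.cong)
  moreover have "(\<Sum>\<sigma> | \<sigma> permutes {..<r}. of_int (sign \<sigma>) *
     (\<Sum>P | P \<in> tuples \<sigma> \<and> \<not> disjoint_tuple P. \<Prod>i<r. prod_list (map w (P i)))) = 0"
    unfolding crossing_sum_zero[OF fin, of w, simplified, symmetric]
    by (subst sum.Sigma[symmetric]) (auto simp: sum_distrib_left finT finite_permutations)
  ultimately show ?thesis by (simp add: distrib_left sum.distrib)
qed

end

section \<open>Alternating functions of solutions of matrix recurrences\<close>

text \<open>The action of the polynomial ring on sequences in which t is the shift operator; the sum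
  in \<open>linear_recurrence\<close> is of this form.\<close>

definition act :: "'a::comm_ring_1 poly \<Rightarrow> (nat \<Rightarrow> 'a) \<Rightarrow> nat \<Rightarrow> 'a" where
  "act P f n = (\<Sum>i\<le>Polynomial.degree P. Polynomial.coeff P i * f (n + i))"

lemma act_eq:
  assumes "Polynomial.degree P \<le> m"
  shows "act P f n = (\<Sum>i\<le>m. Polynomial.coeff P i * f (n + i))"
  unfolding act_def using assms
  by (intro sum.mono_neutral_left) (auto simp: not_le coeff_eq_0)

lemma act_0 [simp]: "act 0 f = (\<lambda>n. 0)"
  by (simp add: act_def fun_eq_iff)

lemma act_zero [simp]: "act P (\<lambda>n. 0) = (\<lambda>n. 0)"
  by (simp add: act_def fun_eq_iff)

lemma act_pCons: "act (pCons a P) f n = a * f n + act P f (Suc n)"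
proof -
  have "act (pCons a P) f n = (\<Sum>i\<le>Suc (Polynomial.degree P). Polynomial.coeff (pCons a P) i * f (n + i))"
    by (rule act_eq) (simp add: degree_pCons_le)
  also have "\<dots> = a * f n + act P f (Suc n)"
    by (subst sum.atMost_Suc_shift) (simp add: act_def)
  finally show ?thesis .
qed

lemma act_1 [simp]: "act 1 f = f"
  by (simp add: act_pCons fun_eq_iff one_pCons)

lemma act_add: "act (P + Q) f n = act P f n + act Q f n"
proof -
  let ?m = "max (Polynomial.degree P) (Polynomial.degree Q)"
  have "Polynomial.degree (P + Q) \<le> ?m" by (rule Polynomial.degree_add_le) auto
  then show ?thesis
    by (simp add: act_eq[of _ ?m] distrib_right sum.distrib)
qed

lemma act_sum: "act (\<Sum>i\<in>A. P i) f n = (\<Sum>i\<in>A. act (P i) f n)"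
  by (induction A rule: infinite_finite_induct) (auto simp: act_add)

lemma act_smult: "act (Polynomial.smult c P) f n = c * act P f n"
proof -
  have "act (Polynomial.smult c P) f n = (\<Sum>i\<le>Polynomial.degree P. Polynomial.coeff (Polynomial.smult c P) i * f (n + i))"
    by (rule act_eq) (rule degree_smult_le)
  then show ?thesis by (simp add: act_def sum_distrib_left mult.assoc)
qed

lemma act_lin: "act P (\<lambda>n. c * f n + g n) n = c * act P f n + act P g n"
  by (simp add: act_def sum.distrib sum_distrib_left algebra_simps)

lemma act_sum_right: "act P (\<lambda>n. \<Sum>i\<in>A. f i n) n = (\<Sum>i\<in>A. act P (f i) n)"
  by (simp add: act_def sum_distrib_left sum.swap[of _ A])

lemma act_Suc: "act P (\<lambda>n. f (Suc n)) n = act P f (Suc n)"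
  by (simp add: act_def)

lemma act_mult: "act (P * Q) f = act P (act Q f)"
proof (induction P)
  case (pCons a P)
  show ?case
    by (rule ext) (simp add: act_add act_smult act_pCons pCons.IH)
qed simp

lemma act_monom: "act (Polynomial.monom 1 k) f n = f (n + k)"
  by (induction k arbitrary: n) (simp_all add: act_pCons Polynomial.monom_Suc monom_0 flip: one_pCons)

lemma act_mult_zero: "act P f = (\<lambda>n. 0) \<Longrightarrow> act (P * Q) f = (\<lambda>n. 0)"
  by (subst mult.commute) (simp add: act_mult)

section \<open>Vector-valued sequences with a triangular shift\<close>

type_synonym 'a vseq = "nat \<Rightarrow> nat \<Rightarrow> 'a"

text \<open>Addition and scaling in one operation, so that closure and multilinearity each take a
  single clause. The first argument of a \<open>vseq\<close> is the coordinate, the second the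
  time.\<close>

definition vlin :: "'a::comm_ring_1 \<Rightarrow> 'a vseq \<Rightarrow> 'a vseq \<Rightarrow> 'a vseq" where
  "vlin c y z = (\<lambda>b t. c * y b t + z b t)"

definition vshift :: "'a vseq \<Rightarrow> 'a vseq" where
  "vshift y = (\<lambda>b t. y b (Suc t))"

abbreviation vzero :: "'a::comm_ring_1 vseq" where
  "vzero \<equiv> \<lambda>b t. 0"

definition shift_subspace :: "'a::comm_ring_1 vseq set \<Rightarrow> bool" where
  "shift_subspace V \<longleftrightarrow> vzero \<in> V \<and> (\<forall>c. \<forall>y\<in>V. \<forall>z\<in>V. vlin c y z \<in> V) \<and> (\<forall>y\<in>V. vshift y \<in> V)"

text \<open>A triangular basis of \<open>V\<close> for the shift, with \<open>ls\<close> on the diagonal; basis vectors may be zero.\<close>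

fun shift_flag :: "'a::comm_ring_1 vseq set \<Rightarrow> 'a list \<Rightarrow> bool" where
  "shift_flag V [] \<longleftrightarrow> V = {vzero}" |
  "shift_flag V (l # ls) \<longleftrightarrow> shift_subspace V \<and> (\<exists>V' e w. shift_flag V' ls \<and> shift_subspace V' \<and> V' \<subseteq> V \<and>
     e \<in> V \<and> w \<in> V' \<and> vshift e = vlin l e w \<and> (\<forall>y\<in>V. \<exists>c. \<exists>y'\<in>V'. y = vlin c e y'))"

text \<open>The case \<open>\<mu> \<noteq> 1\<close> arises from \<open>\<mu> = 1\<close> by fixing some of the arguments to eigenvectors of the shift.\<close>

definition alternating_family ::
    "'a::comm_ring_1 vseq set \<Rightarrow> nat \<Rightarrow> 'a \<Rightarrow> ('a vseq list \<Rightarrow> nat \<Rightarrow> 'a) \<Rightarrow> bool" where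
  "alternating_family V r \<mu> F \<longleftrightarrow>
     (\<forall>xs ys y z c t. set xs \<subseteq> V \<and> set ys \<subseteq> V \<and> y \<in> V \<and> z \<in> V \<and> Suc (length xs + length ys) = r \<longrightarrow>
        F (xs @ vlin c y z # ys) t = c * F (xs @ y # ys) t + F (xs @ z # ys) t) \<and>
     (\<forall>xs t. set xs \<subseteq> V \<and> length xs = r \<and> \<not> distinct xs \<longrightarrow> F xs t = 0) \<and>
     (\<forall>xs t. set xs \<subseteq> V \<and> length xs = r \<longrightarrow> F xs (Suc t) = \<mu> * F (map vshift xs) t)"

lemma alternating_familyD:
  assumes "alternating_family V r \<mu> F"
  shows "\<And>xs ys y z c t. set xs \<subseteq> V \<Longrightarrow> set ys \<subseteq> V \<Longrightarrow> y \<in> V \<Longrightarrow> z \<in> V \<Longrightarrow> Suc (length xs + length ys) = r \<Longrightarrow>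
      F (xs @ vlin c y z # ys) t = c * F (xs @ y # ys) t + F (xs @ z # ys) t"
    and "\<And>xs t. set xs \<subseteq> V \<Longrightarrow> length xs = r \<Longrightarrow> \<not> distinct xs \<Longrightarrow> F xs t = 0"
    and "\<And>xs t. set xs \<subseteq> V \<Longrightarrow> length xs = r \<Longrightarrow> F xs (Suc t) = \<mu> * F (map vshift xs) t"
  using assms unfolding alternating_family_def by blast+

lemma alternating_family_mono:
  assumes "alternating_family V r \<mu> F" "V' \<subseteq> V"
  shows "alternating_family V' r \<mu> F"
proof -
  note F = alternating_familyD[OF assms(1)]
  have "set xs \<subseteq> V" if "set xs \<subseteq> V'" for xs using that assms(2) by blast
  then show ?thesis
    unfolding alternating_family_def using F assms(2) by (intro conjI allI impI) (simp_all add: subsetD)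
qed

text \<open>For \<open>\<mu> = 1\<close> this is the characteristic polynomial of the r-th exterior
  power of a triangular map with diagonal \<open>ls\<close>. The recursion splits the r-subsets by
  whether they contain the first index; \<open>\<mu>\<close> collects the eigenvalues already
  chosen.\<close>

fun exterior_poly :: "'a::comm_ring_1 \<Rightarrow> 'a list \<Rightarrow> nat \<Rightarrow> 'a poly" where
  "exterior_poly \<mu> ls 0 = [:- \<mu>, 1:]" |
  "exterior_poly \<mu> [] (Suc r) = 1" |
  "exterior_poly \<mu> (l # ls) (Suc r) = exterior_poly \<mu> ls (Suc r) * exterior_poly (\<mu> * l) ls r"

text \<open>Shifting the fixed argument \<open>e\<close> gives \<open>l\<close> times
  \<open>e\<close> plus \<open>w\<close>. The term with \<open>w\<close> has all its arguments in
  \<open>V'\<close> and is killed by \<open>A\<close>, so after applying \<open>A\<close> the vector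
  \<open>e\<close> behaves like an eigenvector and the factor \<open>l\<close> moves into
  \<open>\<mu>\<close>.\<close>

lemma alternating_family_insert:
  assumes "alternating_family V (Suc r) \<mu> F" and V': "shift_subspace V'" "V' \<subseteq> V" and e: "e \<in> V"
    and w: "w \<in> V'" "vshift e = vlin l e w" and k: "k \<le> r"
    and A: "\<And>xs. set xs \<subseteq> V' \<Longrightarrow> length xs = Suc r \<Longrightarrow> act A (F xs) = (\<lambda>t. 0)"
  shows "alternating_family V' r (\<mu> * l) (\<lambda>xs. act A (F (take k xs @ e # drop k xs)))"
proof -
  note F = alternating_familyD[OF assms(1)]
  have sub: "set (take k xs) \<subseteq> V'" "set (drop k xs) \<subseteq> V'" if "set xs \<subseteq> V'" for xs
    using that by (meson set_take_subset set_drop_subset subset_trans)+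
  have 1: "act A (F (take k (xs @ vlin c y z # ys) @ e # drop k (xs @ vlin c y z # ys))) t =
      c * act A (F (take k (xs @ y # ys) @ e # drop k (xs @ y # ys))) t +
      act A (F (take k (xs @ z # ys) @ e # drop k (xs @ z # ys))) t"
    if h: "set xs \<subseteq> V'" "set ys \<subseteq> V'" "y \<in> V'" "z \<in> V'" "Suc (length xs + length ys) = r" for xs ys y z c t
  proof -
    have "F (take k (xs @ vlin c y z # ys) @ e # drop k (xs @ vlin c y z # ys)) =
       (\<lambda>t. c * F (take k (xs @ y # ys) @ e # drop k (xs @ y # ys)) t + F (take k (xs @ z # ys) @ e # drop k (xs @ z # ys)) t)"
    \<comment> \<open>The slot of \<open>e\<close> lies either in front of the varied argument or,
      behind it, after the first \<open>j\<close> entries of \<open>ys\<close>.\<close>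
    proof (cases "k \<le> length xs")
      case True
      have s: "set (take k xs @ e # drop k xs) \<subseteq> V" "set ys \<subseteq> V"
        using sub[OF h(1)] V'(2) e h by auto
      show ?thesis
        using F(1)[OF s(1) s(2), of y z c] h True V'(2) by (auto simp: fun_eq_iff)
    next
      case False
      then obtain j where j: "k = Suc (length xs + j)" by (metis add_Suc_right less_imp_Suc_add not_le)
      have s: "set (take j ys @ e # drop j ys) \<subseteq> V" "set xs \<subseteq> V"
        using V'(2) e h set_take_subset[of j ys] set_drop_subset[of j ys] by auto
      show ?thesis
        using F(1)[OF s(2) s(1), of y z c] h j k V'(2) by (auto simp: fun_eq_iff)
    qed
    then show ?thesis by (simp add: act_lin)
  qed
  have 2: "act A (F (take k xs @ e # drop k xs)) t = 0" if h: "set xs \<subseteq> V'" "length xs = r" "\<not> distinct xs" for xs t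
  proof -
    have "\<not> distinct (take k xs @ e # drop k xs)"
    proof
      assume "distinct (take k xs @ e # drop k xs)"
      then have "distinct (take k xs @ drop k xs)" unfolding distinct_append by simp
      then show False using h(3) by (simp only: append_take_drop_id)
    qed
    moreover have "set (take k xs @ e # drop k xs) \<subseteq> V" "length (take k xs @ e # drop k xs) = Suc r"
      using sub[OF h(1)] V'(2) e h k by auto
    ultimately have "F (take k xs @ e # drop k xs) = (\<lambda>t. 0)" using F(2) by blast
    then show ?thesis by simp
  qed
  have 3: "act A (F (take k xs @ e # drop k xs)) (Suc t) =
      \<mu> * l * act A (F (take k (map vshift xs) @ e # drop k (map vshift xs))) t"
    if h: "set xs \<subseteq> V'" "length xs = r" for xs t
  proof -
    let ?a = "take k (map vshift xs)" and ?b = "drop k (map vshift xs)"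
    have m: "set (map vshift xs) \<subseteq> V'" using h V'(1) unfolding shift_subspace_def by auto
    have "F (take k xs @ e # drop k xs) (Suc t) = \<mu> * F (?a @ vlin l e w # ?b) t" for t
      using F(3)[of "take k xs @ e # drop k xs" t] sub[OF h(1)] V'(2) e h k w(2) by (auto simp: take_map drop_map)
    moreover have "F (?a @ vlin l e w # ?b) t = l * F (?a @ e # ?b) t + F (?a @ w # ?b) t" for t
      using sub[OF m] V'(2) e w(1) h k by (intro F(1)) auto
    ultimately have eq: "(\<lambda>t. F (take k xs @ e # drop k xs) (Suc t)) = (\<lambda>t. (\<mu> * l) * F (?a @ e # ?b) t + (\<mu> * F (?a @ w # ?b) t + 0))"
      by (simp add: algebra_simps)
    have "act A (F (take k xs @ e # drop k xs)) (Suc t) = act A (\<lambda>t. (\<mu> * l) * F (?a @ e # ?b) t + (\<mu> * F (?a @ w # ?b) t + 0)) t"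
      unfolding eq[symmetric] by (simp only: act_Suc)
    also have "\<dots> = (\<mu> * l) * act A (F (?a @ e # ?b)) t + \<mu> * act A (F (?a @ w # ?b)) t"
      using act_lin[of A "\<mu>" "F (?a @ w # ?b)" "\<lambda>t. 0" t] by (subst act_lin) simp
    also have "act A (F (?a @ w # ?b)) = (\<lambda>t. 0)"
      using sub[OF m] w h k by (intro A) auto
    finally show ?thesis by simp
  qed
  show ?thesis unfolding alternating_family_def using 1 2 3 by blast
qed

text \<open>By multilinearity each argument may be taken to be \<open>e\<close> or an element of
  \<open>V'\<close>. With \<open>e\<close> twice the value is zero; without \<open>e\<close> the
  factor \<open>?A\<close> annihilates; with \<open>e\<close> exactly once, applying
  \<open>?A\<close> leaves an alternating family in one argument fewer, which \<open>?B\<close>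
  annihilates.\<close>

theorem exterior_poly_annihilates:
  assumes "shift_flag V ls" "alternating_family V r \<mu> F" "set xs \<subseteq> V" "length xs = r"
  shows "act (exterior_poly \<mu> ls r) (F xs) = (\<lambda>t. 0)"
  using assms
proof (induction ls arbitrary: V r \<mu> F xs)
  case Nil
  note F = alternating_familyD[OF Nil(2)]
  show ?case
  proof (cases r)
    case 0
    then show ?thesis using Nil F(3)[of "[]"] by (auto simp: act_pCons)
  next
    case (Suc r')
    then obtain x ys where xs: "xs = x # ys" using Nil by (cases xs) auto
    \<comment> \<open>The vector \<open>vlin (-1) vzero vzero\<close> is again zero, so linearity
      makes the value at a zero argument cancel itself.\<close>
    have "F ([] @ vlin (-1) vzero vzero # ys) t = -1 * F ([] @ vzero # ys) t + F ([] @ vzero # ys) t" for t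
      using Nil Suc xs by (intro F(1)) auto
    then have "F xs t = 0" for t using xs Nil by (simp add: vlin_def)
    then have "F xs = (\<lambda>t. 0)" by blast
    then show ?thesis by simp
  qed
next
  case (Cons l ls)
  note F = alternating_familyD[OF Cons(3)]
  from Cons(2) obtain V' e w where V: "shift_subspace V" and fl: "shift_flag V' ls"
    and V': "shift_subspace V'" "V' \<subseteq> V" and e: "e \<in> V" and w: "w \<in> V'" "vshift e = vlin l e w"
    and dec: "\<And>y. y \<in> V \<Longrightarrow> \<exists>c. \<exists>y'\<in>V'. y = vlin c e y'" by auto
  show ?case
  proof (cases r)
    case 0
    then show ?thesis using Cons F(3)[of "[]"] by (auto simp: act_pCons)
  next
    case (Suc s)
    let ?A = "exterior_poly \<mu> ls (Suc s)" and ?B = "exterior_poly (\<mu> * l) ls s"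
    have A: "act ?A (F zs) = (\<lambda>t. 0)" if "set zs \<subseteq> V'" "length zs = Suc s" for zs
      using Cons.IH[OF fl alternating_family_mono[OF Cons(3) V'(2)] that(1)] that Suc by simp
    have base: "act (?A * ?B) (F ps) = (\<lambda>t. 0)" if ps: "set ps \<subseteq> insert e V'" "length ps = Suc s" for ps
    proof (cases "distinct ps")
      case False
      have "set ps \<subseteq> V" using ps V'(2) e by auto
      then have "F ps = (\<lambda>t. 0)" using F(2) ps False Suc by blast
      then show ?thesis by simp
    next
      case dist: True
      show ?thesis
      proof (cases "e \<in> set ps")
        case False
        then have "act ?A (F ps) = (\<lambda>t. 0)" using A ps by blast
        then show ?thesis by (rule act_mult_zero)
      next
        case True
        then obtain as bs where ab: "ps = as @ e # bs" by (meson split_list)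
        have sub: "set (as @ bs) \<subseteq> V'" "length (as @ bs) = s" using ps ab dist by auto
        let ?G = "\<lambda>xs. act ?A (F (take (length as) xs @ e # drop (length as) xs))"
        have G: "alternating_family V' s (\<mu> * l) ?G"
          using Cons(3) Suc sub(2) by (intro alternating_family_insert[OF _ V' e w] A) auto
        have "act ?B (?G (as @ bs)) = (\<lambda>t. 0)" by (rule Cons.IH[OF fl G sub])
        then show ?thesis by (simp add: ab act_mult mult.commute[of ?A])
      qed
    qed
    \<comment> \<open>The arguments are expanded from left to right: \<open>ps\<close> is already
      reduced to \<open>e\<close> and elements of \<open>V'\<close>, \<open>qs\<close> is still
      arbitrary.\<close>
    have "act (?A * ?B) (F (ps @ qs)) = (\<lambda>t. 0)"
      if "set ps \<subseteq> insert e V'" "set qs \<subseteq> V" "length (ps @ qs) = Suc s" for ps qs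
      using that
    proof (induction qs arbitrary: ps)
      case Nil
      then show ?case using base by simp
    next
      case (Cons q qs)
      obtain c y where y: "y \<in> V'" "q = vlin c e y" using dec[of q] Cons.prems by auto
      have "F (ps @ q # qs) = (\<lambda>t. c * F ((ps @ [e]) @ qs) t + F ((ps @ [y]) @ qs) t)"
        unfolding y(2) using Cons.prems e y V'(2) Suc by (intro ext) (simp, intro F(1), auto)
      then have "act (?A * ?B) (F (ps @ q # qs)) =
          (\<lambda>t. c * act (?A * ?B) (F ((ps @ [e]) @ qs)) t + act (?A * ?B) (F ((ps @ [y]) @ qs)) t)"
        by (simp only: act_lin[abs_def])
      also have "\<dots> = (\<lambda>t. 0)"
        using Cons.IH[of "ps @ [e]"] Cons.IH[of "ps @ [y]"] Cons.prems y by simp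
      finally show ?case .
    qed
    from this[of "[]" xs] show ?thesis using Cons.prems Suc by simp
  qed
qed

section \<open>Solution spaces of polynomial matrix recurrences\<close>

definition solutions :: "nat \<Rightarrow> 'a::comm_ring_1 poly mat \<Rightarrow> 'a vseq set" where
  "solutions n R = {y. (\<forall>a<n. \<forall>t. (\<Sum>b<n. act (R $$ (a, b)) (y b) t) = 0) \<and> (\<forall>b\<ge>n. y b = (\<lambda>t. 0))}"

lemma act_vlin: "(\<Sum>b\<in>A. act (p b) (vlin c y z b) t) = c * (\<Sum>b\<in>A. act (p b) (y b) t) + (\<Sum>b\<in>A. act (p b) (z b) t)"
  unfolding vlin_def by (simp add: act_lin sum.distrib sum_distrib_left)

lemma act_vshift: "act p (vshift y b) t = act p (y b) (Suc t)"
  unfolding vshift_def by (rule act_Suc)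

lemma shift_subspace_solutions: "shift_subspace (solutions n R)"
  unfolding shift_subspace_def solutions_def
  by (auto simp: act_vlin act_vshift) (auto simp: vlin_def vshift_def)

text \<open>The adjugate turns the system into \<open>c * y a t = 0\<close>. Coordinates from
  \<open>n\<close> on vanish by the convention in \<open>solutions\<close>, which makes the trivial
  space literally \<open>{vzero}\<close>, as the base case of \<open>shift_flag\<close>
  demands.\<close>

lemma solutions_unimodular:
  fixes R :: "'a::field poly mat"
  assumes R: "R \<in> carrier_mat n n" and d: "Determinant.det R = [:c:]" "c \<noteq> 0"
  shows "solutions n R = {vzero}"
proof -
  have "y = vzero" if y: "y \<in> solutions n R" for y
  proof (intro ext)
    fix a t
    show "y a t = 0"
    proof (cases "a < n")
      case True
      let ?J = "adj_mat R"
      note J = adj_mat(1,3)[OF R]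
      have "(\<Sum>b<n. act ((?J * R) $$ (a, b)) (y b) t) =
          (\<Sum>b<n. \<Sum>k<n. act (?J $$ (a, k)) (act (R $$ (k, b)) (y b)) t)"
        using J(1) R True by (intro sum.cong) (auto simp: scalar_prod_def act_sum act_mult atLeast0LessThan)
      also have "\<dots> = (\<Sum>k<n. act (?J $$ (a, k)) (\<lambda>t. \<Sum>b<n. act (R $$ (k, b)) (y b) t) t)"
        by (subst sum.swap) (simp add: act_sum_right)
      also have "\<dots> = 0" using y by (intro sum.neutral) (auto simp: solutions_def)
      finally have "(\<Sum>b<n. act ((?J * R) $$ (a, b)) (y b) t) = 0" .
      moreover have "(\<Sum>b<n. act ((?J * R) $$ (a, b)) (y b) t) = (\<Sum>b<n. if b = a then c * y a t else 0)"
        unfolding J(2) d(1) using True by (intro sum.cong) (auto simp: act_pCons)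
      ultimately show ?thesis using d(2) True by simp
    next
      case False
      then show ?thesis using y by (simp add: solutions_def)
    qed
  qed
  moreover have "vzero \<in> solutions n R" by (simp add: solutions_def)
  ultimately show ?thesis by blast
qed

text \<open>The new matrix is \<open>M * R\<close>, where \<open>M\<close> is the identity with row
  \<open>k\<close> replaced by \<open>v\<close>. Column \<open>k\<close> of \<open>M\<close> has the
  single nonzero candidate \<open>v k\<close>, with identity minor.\<close>

lemma det_row_combination:
  fixes R :: "'a::idom mat"
  assumes R: "R \<in> carrier_mat n n" and k: "k < n"
  shows "Determinant.det (mat n n (\<lambda>(i, j). if i = k then \<Sum>h<n. v h * R $$ (h, j) else R $$ (i, j))) =
    v k * Determinant.det R"
proof -
  define M where "M = mat n n (\<lambda>(i, j). if i = k then v j else if i = j then 1 else 0)"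
  have M: "M \<in> carrier_mat n n" by (simp add: M_def)
  have "mat n n (\<lambda>(i, j). if i = k then \<Sum>h<n. v h * R $$ (h, j) else R $$ (i, j)) = M * R"
  proof (rule eq_matI)
    fix i j assume "i < dim_row (M * R)" "j < dim_col (M * R)"
    then have ij: "i < n" "j < n" using M R by auto
    have "(M * R) $$ (i, j) = (\<Sum>h<n. M $$ (i, h) * R $$ (h, j))"
      using M R ij by (auto simp: scalar_prod_def atLeast0LessThan)
    also have "\<dots> = (if i = k then \<Sum>h<n. v h * R $$ (h, j) else \<Sum>h<n. if h = i then R $$ (i, j) else 0)"
      using ij by (auto simp: M_def if_distrib[of "\<lambda>x. x * _"] intro!: sum.cong cong: if_cong)
    finally show "mat n n (\<lambda>(i, j). if i = k then \<Sum>h<n. v h * R $$ (h, j) else R $$ (i, j)) $$ (i, j) = (M * R) $$ (i, j)"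
      using ij by (auto simp: )
  qed (use M R in auto)
  moreover have "Determinant.det M = v k"
  proof -
    have del: "mat_delete M k k = 1\<^sub>m (n - 1)"
      by (rule eq_matI) (auto simp: mat_delete_def M_def)
    have "Determinant.det M = (\<Sum>i<n. M $$ (i, k) * cofactor M i k)"
      by (rule laplace_expansion_column[OF M k])
    also have "\<dots> = (\<Sum>i<n. if i = k then v k else 0)"
      using k by (intro sum.cong) (auto simp: M_def[symmetric] cofactor_def del, auto simp: M_def)
    finally show ?thesis using k by simp
  qed
  ultimately show ?thesis using det_mult[OF M R] by simp
qed

lemma left_kernel_vector:
  fixes A :: "'a::field mat"
  assumes A: "A \<in> carrier_mat n n" and "Determinant.det A = 0"
  obtains v k where "k < n" "v k \<noteq> 0" "\<And>j. j < n \<Longrightarrow> (\<Sum>h<n. v h * A $$ (h, j)) = 0"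
proof -
  have T: "transpose_mat A \<in> carrier_mat n n" using A by simp
  have "Determinant.det (transpose_mat A) = 0" using assms det_transpose[OF A] by simp
  then obtain w where w: "w \<in> carrier_vec n" "w \<noteq> 0\<^sub>v n" "transpose_mat A *\<^sub>v w = 0\<^sub>v n"
    using det_0_iff_vec_prod_zero_field[OF T] by blast
  then obtain k where k: "k < n" "vec_index w k \<noteq> 0"
    by (metis carrier_vecD eq_vecI index_zero_vec)
  have "(\<Sum>h<n. vec_index w h * A $$ (h, j)) = 0" if "j < n" for j
  proof -
    have "vec_index (transpose_mat A *\<^sub>v w) j = 0" using w(3) that by simp
    then show ?thesis using w(1) A that
      by (auto simp: scalar_prod_def atLeast0LessThan mult.commute)
  qed
  with that k show thesis by blast
qed

text \<open>
  A left null vector of \<open>R\<close> at a root \<open>l\<close> of the determinant yields a row combination divisible by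
  \<open>t - l\<close>. Replacing a row by the quotient divides the determinant by \<open>t - l\<close> and cuts out a
  subspace of codimension at most one.
\<close>

theorem shift_flag_solutions:
  fixes R :: "'a::field poly mat"
  assumes "R \<in> carrier_mat n n" "Determinant.det R = Polynomial.smult c (\<Prod>l\<leftarrow>ls. [:- l, 1:])" "c \<noteq> 0"
  shows "shift_flag (solutions n R) ls"
  using assms
proof (induction ls arbitrary: R c)
  case Nil
  then show ?case using solutions_unimodular[of R n c] by simp
next
  case (Cons l ls)
  note R = Cons.prems(1)
  interpret ev: comm_ring_hom "\<lambda>p. poly p l" by unfold_locales auto
  let ?Rl = "map_mat (\<lambda>p. poly p l) R"
  have "?Rl \<in> carrier_mat n n" using R by simp
  moreover have "Determinant.det ?Rl = 0" using Cons.prems(2) by simp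
  ultimately obtain v k where k: "k < n" "v k \<noteq> 0" and "\<And>j. j < n \<Longrightarrow> (\<Sum>h<n. v h * ?Rl $$ (h, j)) = 0"
    using left_kernel_vector[of ?Rl n thesis] by blast
  then have v: "(\<Sum>h<n. v h * poly (R $$ (h, j)) l) = 0" if "j < n" for j
    using that R by simp
  define q where "q j = (\<Sum>h<n. [:v h:] * R $$ (h, j))" for j
  have "[:- l, 1:] dvd q j" if "j < n" for j
    using v[OF that] by (simp add: q_def poly_eq_0_iff_dvd[symmetric] poly_sum)
  then obtain p where p: "\<And>j. j < n \<Longrightarrow> q j = [:- l, 1:] * p j" unfolding dvd_def by metis
  define R' where "R' = mat n n (\<lambda>(i, j). if i = k then p j else R $$ (i, j))"
  have R': "R' \<in> carrier_mat n n" by (simp add: R'_def)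
  have "[:v k:] * Determinant.det R = [:- l, 1:] * Determinant.det R'"
  proof -
    have "[:v k:] * Determinant.det R = Determinant.det (mat n n (\<lambda>(i, j). if i = k then \<Sum>h<n. [:v h:] * R $$ (h, j) else R $$ (i, j)))"
      by (rule det_row_combination[OF R k(1), symmetric])
    also have "mat n n (\<lambda>(i, j). if i = k then \<Sum>h<n. [:v h:] * R $$ (h, j) else R $$ (i, j)) = multrow k [:- l, 1:] R'"
      using p by (intro eq_matI) (auto simp: R'_def q_def[symmetric] simp del: mult_pCons_left)
    also have "Determinant.det \<dots> = [:- l, 1:] * Determinant.det R'" by (rule det_multrow[OF k(1) R'])
    finally show ?thesis .
  qed
  then have "[:- l, 1:] * Determinant.det R' = [:- l, 1:] * Polynomial.smult (v k * c) (\<Prod>l\<leftarrow>ls. [:- l, 1:])"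
    by (simp add: Cons.prems(2) mult.commute)
  then have "Determinant.det R' = Polynomial.smult (v k * c) (\<Prod>l\<leftarrow>ls. [:- l, 1:])"
    by (metis mult_cancel_left pCons_eq_0_iff zero_neq_one)
  then have fl: "shift_flag (solutions n R') ls"
    using Cons.IH[OF R', of "v k * c"] k(2) Cons.prems(3) by simp
  \<comment> \<open>\<open>\<phi> y\<close> is the defect of \<open>y\<close> in the new row
    \<open>p\<close>. For a solution of \<open>R\<close>, \<open>comb\<close> makes it geometric
    with ratio \<open>l\<close>, so the single number \<open>\<phi> y 0\<close> decides whether
    \<open>y\<close> solves \<open>R'\<close>.\<close>
  define \<phi> where "\<phi> y t = (\<Sum>j<n. act (p j) (y j) t)" for y t
  have comb: "(\<Sum>h<n. v h * (\<Sum>j<n. act (R $$ (h, j)) (y j) t)) = act [:- l, 1:] (\<phi> y) t" for y t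
  proof -
    have "(\<Sum>h<n. v h * (\<Sum>j<n. act (R $$ (h, j)) (y j) t)) = (\<Sum>j<n. act (q j) (y j) t)"
      unfolding q_def act_sum
      by (simp add: sum_distrib_left act_smult) (rule sum.swap)
    also have "\<dots> = (\<Sum>j<n. act [:- l, 1:] (act (p j) (y j)) t)"
      using p by (intro sum.cong) (auto simp: act_mult simp del: mult_pCons_left)
    finally show ?thesis unfolding \<phi>_def[abs_def] act_sum_right .
  qed
  have sol': "y \<in> solutions n R' \<longleftrightarrow> y \<in> solutions n R \<and> (\<forall>t. \<phi> y t = 0)" for y
  proof
    assume y: "y \<in> solutions n R'"
    have row: "(\<Sum>b<n. act (R $$ (a, b)) (y b) t) = 0" if "a < n" "a \<noteq> k" for a t
    proof -
      have "(\<Sum>b<n. act (R' $$ (a, b)) (y b) t) = 0" using y that by (simp add: solutions_def)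
      then show ?thesis using that by (simp add: R'_def)
    qed
    have phi: "\<phi> y t = 0" for t
    proof -
      have "(\<Sum>b<n. act (R' $$ (k, b)) (y b) t) = 0" using y k by (simp add: solutions_def)
      then show ?thesis using k by (simp add: R'_def \<phi>_def)
    qed
    then have "act [:- l, 1:] (\<phi> y) t = 0" for t by (simp add: act_pCons)
    then have "(\<Sum>h<n. v h * (\<Sum>j<n. act (R $$ (h, j)) (y j) t)) = 0" for t using comb by metis
    moreover have "(\<Sum>h<n. v h * (\<Sum>j<n. act (R $$ (h, j)) (y j) t)) = v k * (\<Sum>j<n. act (R $$ (k, j)) (y j) t)" for t
      using k(1) row by (subst sum.remove[of _ k]) auto
    ultimately have "(\<Sum>j<n. act (R $$ (k, j)) (y j) t) = 0" for t using k(2) by simp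
    then show "y \<in> solutions n R \<and> (\<forall>t. \<phi> y t = 0)"
      using y row phi unfolding solutions_def by blast
  next
    assume y: "y \<in> solutions n R \<and> (\<forall>t. \<phi> y t = 0)"
    have "(\<Sum>b<n. act (R' $$ (a, b)) (y b) t) = 0" if "a < n" for a t
      using y that by (cases "a = k") (auto simp: R'_def \<phi>_def solutions_def)
    then show "y \<in> solutions n R'" using y by (simp add: solutions_def)
  qed
  have phi_Suc: "\<phi> y (Suc t) = l * \<phi> y t" if "y \<in> solutions n R" for y t
    using comb[of y t] that by (simp add: solutions_def act_pCons eq_neg_iff_add_eq_0 algebra_simps)
  then have phi_pow: "\<phi> y t = l ^ t * \<phi> y 0" if "y \<in> solutions n R" for y t
    using that by (induction t) auto
  have phi_lin: "\<phi> (vlin c y z) t = c * \<phi> y t + \<phi> z t" for c y z t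
    unfolding \<phi>_def by (rule act_vlin)
  have sub: "solutions n R' \<subseteq> solutions n R" using sol' by blast
  note V = shift_subspace_solutions[of n R, unfolded shift_subspace_def]
  note V' = shift_subspace_solutions[of n R', unfolded shift_subspace_def]
  have "\<exists>e w. e \<in> solutions n R \<and> w \<in> solutions n R' \<and> vshift e = vlin l e w \<and>
     (\<forall>y\<in>solutions n R. \<exists>c. \<exists>y'\<in>solutions n R'. y = vlin c e y')"
  proof (cases "\<forall>y\<in>solutions n R. \<phi> y 0 = 0")
    \<comment> \<open>Here the space does not shrink, and the zero vector serves as a dummy basis
      vector.\<close>
    case True
    have "y \<in> solutions n R'" if "y \<in> solutions n R" for y
      using that True sol' phi_pow[OF that] by (metis mult_zero_right)
    then have "\<exists>c. \<exists>y'\<in>solutions n R'. y = vlin c vzero y'" if "y \<in> solutions n R" for y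
      using that by (intro exI[of _ 0] bexI[of _ y]) (auto simp: vlin_def)
    moreover have "vshift vzero = vlin l vzero vzero" by (simp add: vshift_def vlin_def)
    ultimately show ?thesis using V V' by blast
  next
    case False
    then obtain e where e: "e \<in> solutions n R" "\<phi> e 0 \<noteq> 0" by blast
    \<comment> \<open>The remainder of the shift of \<open>e\<close> after removing \<open>l\<close>
      times \<open>e\<close> has defect zero because the defect of \<open>e\<close> is
      geometric.\<close>
    have "vlin (- l) e (vshift e) \<in> solutions n R'"
      using e V phi_Suc by (auto simp: sol' phi_lin) (simp add: \<phi>_def act_vshift)
    moreover have "vshift e = vlin l e (vlin (- l) e (vshift e))" by (simp add: vlin_def)
    moreover have "\<exists>c. \<exists>y'\<in>solutions n R'. y = vlin c e y'" if y: "y \<in> solutions n R" for y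
    proof -
      let ?c = "\<phi> y 0 / \<phi> e 0"
      have z: "vlin (- ?c) e y \<in> solutions n R" using V e y by blast
      have "\<phi> (vlin (- ?c) e y) 0 = 0" using e by (simp add: phi_lin)
      then have "\<phi> (vlin (- ?c) e y) t = 0" for t using phi_pow[OF z, of t] by simp
      then have "vlin (- ?c) e y \<in> solutions n R'" using sol' z by blast
      moreover have "y = vlin ?c e (vlin (- ?c) e y)" by (simp add: vlin_def)
      ultimately show ?thesis by blast
    qed
    ultimately show ?thesis using e(1) by blast
  qed
  then show ?case
    unfolding shift_flag.simps(2) using fl sub shift_subspace_solutions by metis
qed

text \<open>The arguments are the columns; row \<open>i\<close> reads coordinate \<open>a i\<close>
  with time offset \<open>s i\<close>. Advancing the time shifts every column at once, whence
  \<open>\<mu> = 1\<close>.\<close>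

lemma alternating_family_det:
  fixes a s :: "nat \<Rightarrow> nat" and V :: "'a::field_char_0 vseq set"
  shows "alternating_family V r 1
    (\<lambda>xs t. \<Sum>\<sigma> | \<sigma> permutes {..<r}. of_int (sign \<sigma>) * (\<Prod>i<r. (xs ! \<sigma> i) (a i) (s i + t)))"
proof -
  let ?D = "\<lambda>xs t. \<Sum>\<sigma> | \<sigma> permutes {..<r}. of_int (sign \<sigma>) * (\<Prod>i<r. (xs ! \<sigma> i) (a i) (s i + t)) :: 'a"
  have 1: "?D (xs @ vlin c y z # ys) t = c * ?D (xs @ y # ys) t + ?D (xs @ z # ys) t"
    if l: "Suc (length xs + length ys) = r" for xs ys :: "'a vseq list" and y z c t
  proof -
    have "(\<Prod>i<r. ((xs @ vlin c y z # ys) ! \<sigma> i) (a i) (s i + t)) =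
        c * (\<Prod>i<r. ((xs @ y # ys) ! \<sigma> i) (a i) (s i + t)) + (\<Prod>i<r. ((xs @ z # ys) ! \<sigma> i) (a i) (s i + t))"
      if p: "\<sigma> permutes {..<r}" for \<sigma>
    proof -
      \<comment> \<open>The only row that meets the varied column under \<open>\<sigma>\<close>;
        exactly one factor of the product depends on that column.\<close>
      define k where "k = inv_into UNIV \<sigma> (length xs)"
      have k: "k < r" "\<sigma> k = length xs"
        using l permutes_in_image[OF permutes_inv[OF p], of "length xs"] permutes_inverses(1)[OF p]
        unfolding k_def by auto
      have "\<sigma> i \<noteq> length xs" if "i \<noteq> k" for i
        using that k permutes_inj[OF p] by (metis injD)
      then have o: "(xs @ x # ys) ! \<sigma> i = (xs @ y # ys) ! \<sigma> i" if "i \<noteq> k" for i x y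
        using that by (simp add: nth_append nth_Cons')
      have "(\<Prod>i<r. ((xs @ x # ys) ! \<sigma> i) (a i) (s i + t)) =
          x (a k) (s k + t) * (\<Prod>i\<in>{..<r} - {k}. ((xs @ y # ys) ! \<sigma> i) (a i) (s i + t))" for x
        using k o[of _ x y] by (subst prod.remove[of _ k]) auto
      then show ?thesis by (simp add: vlin_def algebra_simps)
    qed
    then show ?thesis by (simp add: sum.distrib sum_distrib_left algebra_simps)
  qed
  have 2: "?D xs t = 0" if l: "length xs = r" "\<not> distinct xs" for xs :: "'a vseq list" and t
  proof -
    obtain p q where pq: "p < r" "q < r" "p \<noteq> q" "xs ! p = xs ! q"
      using l by (auto simp: distinct_conv_nth)
    let ?\<tau> = "Transposition.transpose p q"
    have \<tau>: "?\<tau> permutes {..<r}" using pq by (intro permutes_swap_id) auto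
    have x: "xs ! ?\<tau> j = xs ! j" for j using pq by (auto simp: Transposition.transpose_def)
    show ?thesis
    proof (rule sum_sign_reversing_involution[where \<tau> = "(\<circ>) ?\<tau>"])
      fix \<sigma> assume "\<sigma> \<in> {\<sigma>. \<sigma> permutes {..<r}}"
      then have \<sigma>: "\<sigma> permutes {..<r}" by simp
      show "?\<tau> \<circ> \<sigma> \<in> {\<sigma>. \<sigma> permutes {..<r}}" using permutes_compose[OF \<sigma> \<tau>] by simp
      show "?\<tau> \<circ> (?\<tau> \<circ> \<sigma>) = \<sigma>" by (simp add: fun_eq_iff)
      show "of_int (sign (?\<tau> \<circ> \<sigma>)) * (\<Prod>i<r. (xs ! (?\<tau> \<circ> \<sigma>) i) (a i) (s i + t)) =
          - (of_int (sign \<sigma>) * (\<Prod>i<r. (xs ! \<sigma> i) (a i) (s i + t)))"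
        using pq by (simp add: x sign_swap_id
            sign_compose[OF permutation_swap_id permutes_imp_permutation[OF finite_lessThan \<sigma>]])
    qed
  qed
  have 3: "?D xs (Suc t) = 1 * ?D (map vshift xs) t" if l: "length xs = r" for xs :: "'a vseq list" and t
  proof -
    have "(\<Prod>i<r. (xs ! \<sigma> i) (a i) (s i + Suc t)) = (\<Prod>i<r. (map vshift xs ! \<sigma> i) (a i) (s i + t))"
      if "\<sigma> permutes {..<r}" for \<sigma>
    proof (rule prod.cong)
      fix i assume "i \<in> {..<r}"
      then have "\<sigma> i < length xs" using permutes_in_image[OF that, of i] l by simp
      then show "(xs ! \<sigma> i) (a i) (s i + Suc t) = (map vshift xs ! \<sigma> i) (a i) (s i + t)"
        by (simp add: vshift_def)
    qed simp
    then show ?thesis by simp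
  qed
  show ?thesis unfolding alternating_family_def using 1 2 3 by blast
qed

text \<open>Once a zero eigenvalue has been chosen every factor is t, and the recursion for the
  exponent is Pascal's rule.\<close>

lemma exterior_poly_zero_head: "exterior_poly (0::'a::comm_ring_1) ls r = Polynomial.monom 1 (length ls choose r)"
proof (induction ls arbitrary: r)
  case Nil
  then show ?case by (cases r) (simp_all add: Polynomial.monom_Suc monom_0 flip: one_pCons)
next
  case (Cons l ls)
  then show ?case
    by (cases r) (simp_all add: Polynomial.monom_Suc monom_0 mult_monom add.commute flip: one_pCons)
qed

text \<open>Subsets that use one of the added zeros contribute only powers of t, and acting by a
  power of t merely delays the start of the recurrence.\<close>

lemma exterior_poly_zeros:
  "\<exists>k. exterior_poly \<mu> (replicate m (0::'a::comm_ring_1) @ ls) r = Polynomial.monom 1 k * exterior_poly \<mu> ls r"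
proof (induction m)
  case 0
  then show ?case by (intro exI[of _ 0]) (simp flip: one_pCons add: monom_0)
next
  case (Suc m)
  then obtain k where k: "exterior_poly \<mu> (replicate m 0 @ ls) r = Polynomial.monom 1 k * exterior_poly \<mu> ls r" by blast
  show ?case
  proof (cases r)
    case 0
    then show ?thesis by (intro exI[of _ 0]) (simp flip: one_pCons add: monom_0)
  next
    case (Suc r')
    let ?j = "length (replicate m 0 @ ls) choose r'"
    have "exterior_poly \<mu> (replicate (Suc m) 0 @ ls) r = exterior_poly \<mu> (replicate m 0 @ ls) r * Polynomial.monom 1 ?j"
      using Suc by (simp add: exterior_poly_zero_head)
    also have "\<dots> = (Polynomial.monom 1 k * Polynomial.monom 1 ?j) * exterior_poly \<mu> ls r"
      unfolding k by (simp only: ac_simps)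
    also have "Polynomial.monom 1 k * Polynomial.monom (1::'a) ?j = Polynomial.monom 1 (k + ?j)"
      by (simp add: mult_monom)
    finally show ?thesis by blast
  qed
qed

section \<open>The exterior polynomial as a product over increasing lists\<close>

definition increasing_lists :: "nat \<Rightarrow> nat \<Rightarrow> nat \<Rightarrow> nat list set" where
  "increasing_lists a d r = {js. length js = r \<and> set js \<subseteq> {a..d} \<and> sorted_wrt (<) js}"

lemma finite_increasing_lists: "finite (increasing_lists a d r)"
  unfolding increasing_lists_def
  by (rule finite_subset[OF _ finite_lists_length_eq[of "{a..d}" r]]) auto

lemma increasing_lists_empty: "increasing_lists (Suc d) d r = (if r = 0 then {[]} else {})"
  unfolding increasing_lists_def by auto

lemma increasing_lists_0: "increasing_lists a d 0 = {[]}"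
  unfolding increasing_lists_def by auto

lemma increasing_lists_Suc:
  assumes "a \<le> d"
  shows "increasing_lists a d (Suc s) =
    increasing_lists (Suc a) d (Suc s) \<union> (#) a ` increasing_lists (Suc a) d s"
proof (intro equalityI subsetI)
  fix js assume js: "js \<in> increasing_lists a d (Suc s)"
  then obtain x xs where x: "js = x # xs" by (cases js) (auto simp: increasing_lists_def)
  show "js \<in> increasing_lists (Suc a) d (Suc s) \<union> (#) a ` increasing_lists (Suc a) d s"
    using js x by (cases "x = a") (fastforce simp: increasing_lists_def Suc_le_eq)+
next
  fix js assume "js \<in> increasing_lists (Suc a) d (Suc s) \<union> (#) a ` increasing_lists (Suc a) d s"
  then show "js \<in> increasing_lists a d (Suc s)"
    using assms by (fastforce simp: increasing_lists_def Suc_le_eq)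
qed

text \<open>The lower end \<open>a\<close> is variable so that the induction can peel off the
  smallest index: lists that begin with \<open>a\<close> form the second factor of the
  recursion.\<close>

lemma exterior_poly_prod:
  assumes "a \<le> Suc d"
  shows "exterior_poly \<mu> (map \<gamma> [a..<Suc d]) r =
    (\<Prod>js\<in>increasing_lists a d r. [:- (\<mu> * prod_list (map \<gamma> js)), 1:])"
  using assms
proof (induction a arbitrary: \<mu> r rule: inc_induct)
  case base
  then show ?case by (cases r) (simp_all add: increasing_lists_empty)
next
  case (step a)
  let ?S = "\<lambda>a r. increasing_lists a d r"
  show ?case
  proof (cases r)
    case 0
    then show ?thesis by (simp add: increasing_lists_0)
  next
    case (Suc s)
    have S: "?S a (Suc s) = ?S (Suc a) (Suc s) \<union> (#) a ` ?S (Suc a) s"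
      using step.hyps by (intro increasing_lists_Suc) auto
    have "(\<Prod>js\<in>?S a (Suc s). [:- (\<mu> * prod_list (map \<gamma> js)), 1:]) =
        (\<Prod>js\<in>?S (Suc a) (Suc s). [:- (\<mu> * prod_list (map \<gamma> js)), 1:]) *
        (\<Prod>js\<in>(#) a ` ?S (Suc a) s. [:- (\<mu> * prod_list (map \<gamma> js)), 1:])"
      unfolding S by (intro prod.union_disjoint finite_imageI finite_increasing_lists)
        (fastforce simp: increasing_lists_def)
    also have "(\<Prod>js\<in>(#) a ` ?S (Suc a) s. [:- (\<mu> * prod_list (map \<gamma> js)), 1:]) =
        (\<Prod>js\<in>?S (Suc a) s. [:- (\<mu> * \<gamma> a * prod_list (map \<gamma> js)), 1:])"
      by (subst prod.reindex) (auto simp: mult.assoc)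
    finally have R: "(\<Prod>js\<in>?S a (Suc s). [:- (\<mu> * prod_list (map \<gamma> js)), 1:]) =
      exterior_poly \<mu> (map \<gamma> [Suc a..<Suc d]) (Suc s) * exterior_poly (\<mu> * \<gamma> a) (map \<gamma> [Suc a..<Suc d]) s"
      by (simp only: step.IH)
    have "map \<gamma> [a..<Suc d] = \<gamma> a # map \<gamma> [Suc a..<Suc d]"
      using step.hyps by (subst upt_conv_Cons) auto
    then show ?thesis unfolding Suc R by (simp del: upt_Suc)
  qed
qed

lemma exterior_poly_eq_Q_e: "exterior_poly 1 (map \<gamma> [1..<Suc d]) r = Q_e d \<gamma> r"
  using exterior_poly_prod[of 1 d 1 \<gamma> r] by (simp add: Q_e_def increasing_lists_def)

lemma Q_e_dvd_Q_h: "Q_e d \<gamma> r dvd Q_h d \<gamma> r"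
  unfolding Q_e_def Q_h_def
  by (intro prod_dvd_prod_subset finite_subset[OF _ finite_lists_length_eq[of "{1..d}" r]])
    (auto elim: sorted_wrt_mono_rel[rotated])

section \<open>Rationality of symmetric functions of the roots\<close>

unbundle no vec_syntax
unbundle fps_syntax
no_notation Matrix.vec_index (infixl "$" 100)

text \<open>To be instantiated with the image of \<open>to_ac\<close>, where membership of the
  coefficients means that a polynomial descends to the ground field.\<close>

locale subfield_set =
  fixes K :: "'a::field_char_0 set"
  assumes one_mem: "1 \<in> K"
    and diff_mem: "x \<in> K \<Longrightarrow> y \<in> K \<Longrightarrow> x - y \<in> K"
    and mult_mem: "x \<in> K \<Longrightarrow> y \<in> K \<Longrightarrow> x * y \<in> K"
    and inverse_mem: "x \<in> K \<Longrightarrow> inverse x \<in> K"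
begin

lemma zero_mem: "0 \<in> K"
  using diff_mem[OF one_mem one_mem] by simp

lemma uminus_mem: "x \<in> K \<Longrightarrow> - x \<in> K"
  using diff_mem[OF zero_mem] by fastforce

lemma add_mem: "x \<in> K \<Longrightarrow> y \<in> K \<Longrightarrow> x + y \<in> K"
  using diff_mem[OF _ uminus_mem] by fastforce

lemma of_nat_mem: "of_nat n \<in> K"
  by (induction n) (simp_all add: zero_mem one_mem add_mem)

lemma sum_mem: "(\<And>i. i \<in> A \<Longrightarrow> f i \<in> K) \<Longrightarrow> sum f A \<in> K"
  by (induction A rule: infinite_finite_induct) (simp_all add: zero_mem add_mem)

lemma power_mem: "x \<in> K \<Longrightarrow> x ^ n \<in> K"
  by (induction n) (simp_all add: one_mem mult_mem)

end

section \<open>Newton's identities and symmetric generating functions\<close>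

abbreviation root_fps :: "'i set \<Rightarrow> ('i \<Rightarrow> 'a::field) \<Rightarrow> 'a fps" where
  "root_fps A x \<equiv> (\<Prod>i\<in>A. 1 - fps_const (x i) * fps_X)"

text \<open>This is the logarithmic derivative of the product of the factors
  \<open>1 - x i X\<close>, multiplied out: each factor contributes the geometric series of
  \<open>- x i / (1 - x i X)\<close>.\<close>

lemma newton_identity_fps:
  fixes x :: "'i \<Rightarrow> 'a::field"
  assumes "finite A"
  shows "fps_deriv (root_fps A x) = - root_fps A x * Abs_fps (\<lambda>j. \<Sum>i\<in>A. x i ^ Suc j)"
  using assms
proof (induction A rule: finite_induct)
  case empty
  have "Abs_fps (\<lambda>j. 0) = (0 :: 'a fps)" by (rule fps_ext) simp
  then show ?case by simp
next
  case (insert a A)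
  let ?l = "1 - fps_const (x a) * fps_X" and ?S = "\<lambda>A. Abs_fps (\<lambda>j. \<Sum>i\<in>A. x i ^ Suc j)"
  have geom: "?l * Abs_fps (\<lambda>j. x a ^ Suc j) = fps_const (x a)"
  proof (rule fps_ext)
    fix n
    show "(?l * Abs_fps (\<lambda>j. x a ^ Suc j)) $ n = fps_const (x a) $ n"
      by (cases n) (simp_all add: left_diff_distrib mult.assoc)
  qed
  have ring: "- (c * P) + l * (- P * S) = - (l * P) * (g + S)" if "l * g = c" for c l g P S :: "'a fps"
    unfolding that[symmetric] by (simp add: algebra_simps)
  have S: "?S (insert a A) = Abs_fps (\<lambda>j. x a ^ Suc j) + ?S A"
    using insert by (intro fps_ext) simp
  have "fps_deriv (root_fps (insert a A) x) = - (fps_const (x a) * root_fps A x) + ?l * fps_deriv (root_fps A x)"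
    using insert by (simp add: algebra_simps)
  also have "\<dots> = - (?l * root_fps A x) * (Abs_fps (\<lambda>j. x a ^ Suc j) + ?S A)"
    unfolding insert.IH by (rule ring[OF geom])
  finally show ?case using insert S by simp
qed

lemma newton_identity:
  fixes x :: "'i \<Rightarrow> 'a::field"
  assumes "finite A"
  shows "of_nat (Suc n) * root_fps A x $ Suc n = - (\<Sum>j\<le>n. (\<Sum>i\<in>A. x i ^ Suc j) * root_fps A x $ (n - j))"
proof -
  have "fps_deriv (root_fps A x) $ n = (Abs_fps (\<lambda>j. \<Sum>i\<in>A. x i ^ Suc j) * - root_fps A x) $ n"
    by (simp only: newton_identity_fps[OF assms] mult.commute[of "- root_fps A x"])
  then show ?thesis
    by (simp add: fps_mult_nth atLeast0AtMost sum_negf del: power_Suc)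
qed

lemma root_fps_nth_0: "root_fps A x $ 0 = 1"
  by (induction A rule: infinite_finite_induct) auto

context subfield_set
begin

text \<open>Newton's recursion can be solved both ways: for the next coefficient after division by a
  positive integer, possible in characteristic zero, and for the next power sum because the constant
  term is 1.\<close>

lemma power_sums_iff_root_fps:
  fixes x :: "'i \<Rightarrow> 'a"
  assumes A: "finite A"
  shows "(\<forall>k\<ge>1. (\<Sum>i\<in>A. x i ^ k) \<in> K) \<longleftrightarrow> (\<forall>n. root_fps A x $ n \<in> K)"
proof
  assume p: "\<forall>k\<ge>1. (\<Sum>i\<in>A. x i ^ k) \<in> K"
  show "\<forall>n. root_fps A x $ n \<in> K"
  proof
    fix n
    show "root_fps A x $ n \<in> K"
    proof (induction n rule: less_induct)
      case (less n)
      show ?case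
      proof (cases n)
        case 0
        then show ?thesis by (simp add: root_fps_nth_0 one_mem)
      next
        case (Suc m)
        have "of_nat (Suc m) * root_fps A x $ Suc m \<in> K"
          unfolding newton_identity[OF A]
        proof (intro uminus_mem sum_mem[of "{..m}"] mult_mem)
          show "(\<Sum>i\<in>A. x i ^ Suc j) \<in> K" for j
            using p[rule_format, of "Suc j"] by (simp del: power_Suc)
        qed (use less Suc in auto)
        then have "inverse (of_nat (Suc m)) * (of_nat (Suc m) * root_fps A x $ Suc m) \<in> K"
          by (rule mult_mem[OF inverse_mem[OF of_nat_mem]])
        moreover have "inverse (of_nat (Suc m)) * (of_nat (Suc m) * root_fps A x $ Suc m) = root_fps A x $ Suc m"
          by (simp del: of_nat_Suc flip: mult.assoc)
        ultimately show ?thesis unfolding Suc by (simp only:)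
      qed
    qed
  qed
next
  assume e: "\<forall>n. root_fps A x $ n \<in> K"
  have "(\<Sum>i\<in>A. x i ^ Suc k) \<in> K" for k
  proof (induction k rule: less_induct)
    case (less k)
    have "of_nat (Suc k) * root_fps A x $ Suc k =
        - ((\<Sum>i\<in>A. x i ^ Suc k) + (\<Sum>j<k. (\<Sum>i\<in>A. x i ^ Suc j) * root_fps A x $ (k - j)))"
      unfolding newton_identity[OF A] lessThan_Suc_atMost[symmetric] by (simp add: root_fps_nth_0 del: power_Suc)
    then have "(\<Sum>i\<in>A. x i ^ Suc k) =
        - (of_nat (Suc k) * root_fps A x $ Suc k) - (\<Sum>j<k. (\<Sum>i\<in>A. x i ^ Suc j) * root_fps A x $ (k - j))"
      by (simp del: power_Suc of_nat_Suc)
    also have "\<dots> \<in> K"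
      using less e by (intro diff_mem uminus_mem mult_mem sum_mem[of "{..<k}"] of_nat_mem) auto
    finally show ?case .
  qed
  then show "\<forall>k\<ge>1. (\<Sum>i\<in>A. x i ^ k) \<in> K" by (metis Suc_le_D One_nat_def)
qed

text \<open>\<open>root_fps A x\<close> is the reflection of the monic polynomial with roots
  \<open>x i\<close>, and reflection only permutes its coefficients up to the degree.\<close>

lemma power_sums_iff_root_poly:
  fixes x :: "'i \<Rightarrow> 'a"
  assumes A: "finite A"
  shows "(\<forall>k\<ge>1. (\<Sum>i\<in>A. x i ^ k) \<in> K) \<longleftrightarrow> (\<forall>n. Polynomial.coeff (\<Prod>i\<in>A. [:- x i, 1:]) n \<in> K)"
proof -
  let ?q = "\<Prod>i\<in>A. [:- x i, 1:]"
  have "fps_of_poly (reflect_poly ?q) = root_fps A x"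
  proof -
    have "fps_of_poly (reflect_poly [:- x i, 1:]) = 1 - fps_const (x i) * fps_X" for i
      by (intro fps_ext) (auto simp: coeff_reflect_poly coeff_pCons fps_X_def split: nat.split)
    then show ?thesis by (simp only: reflect_poly_prod fps_of_poly_prod)
  qed
  then have r: "root_fps A x $ n = Polynomial.coeff (reflect_poly ?q) n" for n
    by (metis fps_of_poly_nth)
  have "(\<forall>n. Polynomial.coeff (reflect_poly ?q) n \<in> K) \<longleftrightarrow> (\<forall>n. Polynomial.coeff ?q n \<in> K)"
  proof
    assume *: "\<forall>n. Polynomial.coeff (reflect_poly ?q) n \<in> K"
    show "\<forall>n. Polynomial.coeff ?q n \<in> K"
    proof
      fix n
      show "Polynomial.coeff ?q n \<in> K"
      proof (cases "n \<le> Polynomial.degree ?q")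
        case True
        then have "Polynomial.coeff (reflect_poly ?q) (Polynomial.degree ?q - n) = Polynomial.coeff ?q n"
          unfolding coeff_reflect_poly by (simp only: diff_diff_cancel) simp
        then show ?thesis using * by metis
      qed (simp add: coeff_eq_0 zero_mem)
    qed
  qed (simp add: coeff_reflect_poly zero_mem)
  then show ?thesis using power_sums_iff_root_fps[OF A] r by simp
qed

lemma root_fps_inverse_mem:
  assumes "\<And>n. P $ n \<in> K" "H * P = 1" "P $ 0 = 1"
  shows "H $ n \<in> K"
proof (induction n rule: less_induct)
  case (less n)
  have "(H * P) $ n = H $ n + (\<Sum>i<n. H $ i * P $ (n - i))"
    unfolding fps_mult_nth atLeast0AtMost lessThan_Suc_atMost[symmetric] using assms(3) by simp
  then have "H $ n = (if n = 0 then 1 else 0) - (\<Sum>i<n. H $ i * P $ (n - i))"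
    using assms(2) by (simp add: eq_diff_eq)
  also have "\<dots> \<in> K"
    using less assms(1) by (intro diff_mem sum_mem mult_mem) (auto simp: one_mem zero_mem)
  finally show ?case .
qed

end

text \<open>The generating function of the elementary symmetric polynomials is the product of the
  factors \<open>1 + y i X\<close>, hence the sign in \<open>- y i\<close>.\<close>

lemma sum_increasing_lists_fps:
  fixes y :: "nat \<Rightarrow> 'a::field"
  assumes "a \<le> Suc d"
  shows "Abs_fps (\<lambda>r. \<Sum>js\<in>increasing_lists a d r. prod_list (map y js)) = root_fps {a..d} (\<lambda>i. - y i)"
  using assms
proof (induction a rule: inc_induct)
  case base
  show ?case by (rule fps_ext) (auto simp: increasing_lists_empty)
next
  case (step a)
  let ?s = "\<lambda>a r. \<Sum>js\<in>increasing_lists a d r. prod_list (map y js)"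
  have rec: "?s a (Suc r) = ?s (Suc a) (Suc r) + y a * ?s (Suc a) r" for r
  proof -
    have "?s a (Suc r) = ?s (Suc a) (Suc r) + (\<Sum>js\<in>(#) a ` increasing_lists (Suc a) d r. prod_list (map y js))"
      using step.hyps unfolding increasing_lists_Suc[of a d r, OF less_Suc_eq_le[THEN iffD1, OF step.hyps(2)]]
      by (intro sum.union_disjoint finite_imageI finite_increasing_lists) (fastforce simp: increasing_lists_def)
    also have "(\<Sum>js\<in>(#) a ` increasing_lists (Suc a) d r. prod_list (map y js)) = y a * ?s (Suc a) r"
      by (subst sum.reindex) (auto simp: sum_distrib_left)
    finally show ?thesis .
  qed
  have "{a..d} = insert a {Suc a..d}" using step.hyps by auto
  then have "root_fps {a..d} (\<lambda>i. - y i) = (1 - fps_const (- y a) * fps_X) * Abs_fps (?s (Suc a))"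
    by (simp add: step.IH)
  also have "\<dots> = Abs_fps (?s a)"
  proof (rule fps_ext)
    fix n
    show "((1 - fps_const (- y a) * fps_X) * Abs_fps (?s (Suc a))) $ n = Abs_fps (?s a) $ n"
      using rec by (cases n) (simp_all add: left_diff_distrib mult.assoc increasing_lists_0)
  qed
  finally show ?case by simp
qed

definition weakly_increasing_lists :: "nat \<Rightarrow> nat \<Rightarrow> nat \<Rightarrow> nat list set" where
  "weakly_increasing_lists a d r = {js. length js = r \<and> set js \<subseteq> {a..d} \<and> sorted_wrt (\<le>) js}"

lemma finite_weakly_increasing_lists: "finite (weakly_increasing_lists a d r)"
  unfolding weakly_increasing_lists_def
  by (rule finite_subset[OF _ finite_lists_length_eq[of "{a..d}" r]]) auto

lemma weakly_increasing_lists_empty: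
  "weakly_increasing_lists (Suc d) d r = (if r = 0 then {[]} else {})"
  unfolding weakly_increasing_lists_def by auto

lemma weakly_increasing_lists_Suc:
  assumes "a \<le> d"
  shows "weakly_increasing_lists a d (Suc s) =
    weakly_increasing_lists (Suc a) d (Suc s) \<union> (#) a ` weakly_increasing_lists a d s"
proof (intro equalityI subsetI)
  fix js assume js: "js \<in> weakly_increasing_lists a d (Suc s)"
  then obtain x xs where x: "js = x # xs" by (cases js) (auto simp: weakly_increasing_lists_def)
  show "js \<in> weakly_increasing_lists (Suc a) d (Suc s) \<union> (#) a ` weakly_increasing_lists a d s"
    using js x by (cases "x = a") (fastforce simp: weakly_increasing_lists_def Suc_le_eq)+
next
  fix js assume "js \<in> weakly_increasing_lists (Suc a) d (Suc s) \<union> (#) a ` weakly_increasing_lists a d s"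
  then show "js \<in> weakly_increasing_lists a d (Suc s)"
    using assms by (fastforce simp: weakly_increasing_lists_def Suc_le_eq)
qed

text \<open>The series of complete symmetric polynomials. A list that begins with \<open>a\<close>
  may continue with \<open>a\<close>, so its tail keeps the lower end \<open>a\<close>, and the
  recursion divides by \<open>1 - y a X\<close> instead of multiplying.\<close>

lemma sum_weakly_increasing_lists_fps:
  fixes y :: "nat \<Rightarrow> 'a::field"
  assumes "a \<le> Suc d"
  shows "Abs_fps (\<lambda>r. \<Sum>js\<in>weakly_increasing_lists a d r. prod_list (map y js)) * root_fps {a..d} y = 1"
  using assms
proof (induction a rule: inc_induct)
  case base
  have "Abs_fps (\<lambda>r. \<Sum>js\<in>weakly_increasing_lists (Suc d) d r. prod_list (map y js)) = 1"
    by (rule fps_ext) (auto simp: weakly_increasing_lists_empty)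
  then show ?case by simp
next
  case (step a)
  let ?s = "\<lambda>a r. \<Sum>js\<in>weakly_increasing_lists a d r. prod_list (map y js)"
  have rec: "?s a (Suc r) = ?s (Suc a) (Suc r) + y a * ?s a r" for r
  proof -
    have "?s a (Suc r) = ?s (Suc a) (Suc r) + (\<Sum>js\<in>(#) a ` weakly_increasing_lists a d r. prod_list (map y js))"
      using step.hyps unfolding weakly_increasing_lists_Suc[of a d r, OF less_Suc_eq_le[THEN iffD1, OF step.hyps(2)]]
      by (intro sum.union_disjoint finite_imageI finite_weakly_increasing_lists)
        (fastforce simp: weakly_increasing_lists_def)
    also have "(\<Sum>js\<in>(#) a ` weakly_increasing_lists a d r. prod_list (map y js)) = y a * ?s a r"
      by (subst sum.reindex) (auto simp: sum_distrib_left)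
    finally show ?thesis .
  qed
  have zero: "?s a 0 = 1" for a
    by (simp add: weakly_increasing_lists_def Collect_conv_if conj_commute cong: conj_cong)
  have *: "Abs_fps (?s a) * (1 - fps_const (y a) * fps_X) = Abs_fps (?s (Suc a))"
  proof (rule fps_ext)
    fix n
    show "(Abs_fps (?s a) * (1 - fps_const (y a) * fps_X)) $ n = Abs_fps (?s (Suc a)) $ n"
      using rec zero by (cases n) (simp_all add: right_diff_distrib mult.assoc mult.left_commute)
  qed
  have "{a..d} = insert a {Suc a..d}" using step.hyps by auto
  then have "Abs_fps (?s a) * root_fps {a..d} y =
      (Abs_fps (?s a) * (1 - fps_const (y a) * fps_X)) * root_fps {Suc a..d} y"
    by (simp add: mult.assoc)
  then show ?case using step.IH * by simp
qed

lemma prod_list_map_power: "prod_list (map y js) ^ k = prod_list (map (\<lambda>i. y i ^ k) js)"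
  for y :: "'i \<Rightarrow> 'a::comm_monoid_mult"
  by (induction js) (auto simp: power_mult_distrib)

context subfield_set
begin

text \<open>
  The power sums of the roots of \<open>Q_e\<close> and \<open>Q_h\<close> are elementary and complete symmetric polynomials
  in powers of the \<open>\<gamma> i\<close>, so Newton's identities, applied back and forth, make the fundamental
  theorem on symmetric polynomials unnecessary.
\<close>

lemma Q_e_Q_h_coeff_mem:
  assumes "\<And>n. Polynomial.coeff (\<Prod>i = 1..d. [:- \<gamma> i, 1:]) n \<in> K"
  shows "Polynomial.coeff (Q_e d \<gamma> r) n \<in> K" "Polynomial.coeff (Q_h d \<gamma> r) n \<in> K"
proof -
  have p: "(\<Sum>i = 1..d. \<gamma> i ^ k) \<in> K" if "k \<ge> 1" for k
    using power_sums_iff_root_poly[of "{1..d}" \<gamma>] assms that by auto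
  have "(\<Sum>js\<in>increasing_lists 1 d r. prod_list (map \<gamma> js) ^ k) \<in> K" if k: "k \<ge> 1" for k
  proof -
    \<comment> \<open>The sign prepares for \<open>sum_increasing_lists_fps\<close>; it changes the
      power sums only by a sign.\<close>
    have "(\<Sum>i = 1..d. (- (\<gamma> i ^ k)) ^ j) \<in> K" if "j \<ge> 1" for j
    proof -
      have "(\<Sum>i = 1..d. (- (\<gamma> i ^ k)) ^ j) = (-1) ^ j * (\<Sum>i = 1..d. \<gamma> i ^ (k * j))"
        unfolding sum_distrib_left by (intro sum.cong refl) (simp add: power_minus[of "_ ^ _"] power_mult)
      then show ?thesis using p[of "k * j"] k that
        by (simp add: mult_mem power_mem uminus_mem one_mem)
    qed
    then have "root_fps {1..d} (\<lambda>i. - (\<gamma> i ^ k)) $ r \<in> K"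
      using power_sums_iff_root_fps[of "{1..d}" "\<lambda>i. - (\<gamma> i ^ k)"] by blast
    then show ?thesis
      using sum_increasing_lists_fps[of 1 d "\<lambda>i. \<gamma> i ^ k"]
      by (simp add: prod_list_map_power fps_eq_iff)
  qed
  then show "Polynomial.coeff (Q_e d \<gamma> r) n \<in> K"
    using power_sums_iff_root_poly[OF finite_increasing_lists[of 1 d r], of "\<lambda>js. prod_list (map \<gamma> js)"]
    unfolding Q_e_def increasing_lists_def by blast
  have "(\<Sum>js\<in>weakly_increasing_lists 1 d r. prod_list (map \<gamma> js) ^ k) \<in> K" if k: "k \<ge> 1" for k
  proof -
    have "(\<Sum>i = 1..d. (\<gamma> i ^ k) ^ j) \<in> K" if "j \<ge> 1" for j
      using p[of "k * j"] k that by (simp add: power_mult)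
    then have "root_fps {1..d} (\<lambda>i. \<gamma> i ^ k) $ n \<in> K" for n
      using power_sums_iff_root_fps[of "{1..d}" "\<lambda>i. \<gamma> i ^ k"] by blast
    from root_fps_inverse_mem[OF this sum_weakly_increasing_lists_fps]
    show ?thesis by (simp add: prod_list_map_power root_fps_nth_0)
  qed
  then show "Polynomial.coeff (Q_h d \<gamma> r) n \<in> K"
    using power_sums_iff_root_poly[OF finite_weakly_increasing_lists[of 1 d r], of "\<lambda>js. prod_list (map \<gamma> js)"]
    unfolding Q_h_def weakly_increasing_lists_def by blast
qed

end

section \<open>Determinants and collections of disjoint cycles\<close>

lemma sign_cycle_of_list:
  assumes "distinct cs" "cs \<noteq> []"
  shows "sign (cycle_of_list cs) = (-1) ^ (length cs - 1)"
  using assms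
proof (induction cs rule: cycle_of_list.induct)
  case (1 i j cs)
  then have "sign (cycle_of_list (i # j # cs)) = sign (Transposition.transpose i j) * sign (cycle_of_list (j # cs))"
    by (simp only: cycle_of_list.simps sign_compose[OF permutation_swap_id permutation_of_cycle])
  also have "\<dots> = - ((-1) ^ length cs)" using 1 by (simp add: sign_swap_id)
  finally show ?case by (simp del: cycle_of_list.simps)
qed auto

lemma (in pre_digraph) cas_iff: "cas x p y \<longleftrightarrow> x # map (head G) p = map (tail G) p @ [y]"
  by (induction x p y rule: cas.induct) auto

text \<open>A form without a start vertex: it transports along injective renamings of the vertices
  and matches the action of a cyclic permutation on a list.\<close>

lemma (in wf_digraph) cycle_iff_rotate1:
  "cycle c \<longleftrightarrow> c \<noteq> [] \<and> set c \<subseteq> arcs G \<and> distinct (map (tail G) c) \<and>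
     map (head G) c = rotate1 (map (tail G) c)"
proof
  assume "cycle c"
  then obtain x where x: "awalk x c x" "distinct (tl (awalk_verts x c))" "c \<noteq> []"
    by (auto simp: cycle_def)
  have "cas x c x" using x(1) by (auto simp: awalk_def)
  then have e: "x # map (head G) c = map (tail G) c @ [x]" by (simp add: cas_iff)
  obtain a c' where c: "c = a # c'" using x(3) by (cases c) auto
  have r: "map (head G) c = rotate1 (map (tail G) c)" using e c by auto
  moreover have "tl (awalk_verts x c) = map (head G) c"
    using awalk_verts_conv'[OF \<open>cas x c x\<close>] x(3) by simp
  ultimately show "c \<noteq> [] \<and> set c \<subseteq> arcs G \<and> distinct (map (tail G) c) \<and> map (head G) c = rotate1 (map (tail G) c)"
    using x by (metis awalk_def distinct1_rotate)
next
  assume c: "c \<noteq> [] \<and> set c \<subseteq> arcs G \<and> distinct (map (tail G) c) \<and> map (head G) c = rotate1 (map (tail G) c)"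
  then obtain a c' where a: "c = a # c'" by (cases c) auto
  have cas: "cas (tail G a) c (tail G a)" unfolding cas_iff using c a by simp
  then have "awalk (tail G a) c (tail G a)" using c a by (auto simp: awalk_def wellformed)
  moreover have "tl (awalk_verts (tail G a) c) = map (head G) c"
    using awalk_verts_conv'[OF cas] c by simp
  ultimately show "cycle c" using c unfolding cycle_def by (metis distinct1_rotate)
qed

section \<open>Disjoint cycles as balanced arc sets\<close>

context fin_digraph
begin

definition scycles :: "'b set set" where
  "scycles = {set c |c. cycle c}"

definition mcycles :: "'b set set set" where
  "mcycles = {Cs. Cs \<subseteq> scycles \<and> finite Cs \<and> pairwise (\<lambda>C D. disjnt (tail G ` C) (tail G ` D)) Cs}"

text \<open>Every vertex that such a set meets has exactly one leaving and one entering arc in it.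
  By \<open>bij_betw_Union_mcycles\<close> these are the unions of collections of disjoint
  cycles.\<close>

definition balanced :: "'b set \<Rightarrow> bool" where
  "balanced F \<longleftrightarrow> F \<subseteq> arcs G \<and> inj_on (tail G) F \<and> inj_on (head G) F \<and> head G ` F = tail G ` F"

definition arc_perm :: "'b set \<Rightarrow> 'a \<Rightarrow> 'a" where
  "arc_perm F x = (if x \<in> tail G ` F then head G (inv_into F (tail G) x) else x)"

lemma arc_perm_tail: "inj_on (tail G) F \<Longrightarrow> e \<in> F \<Longrightarrow> arc_perm F (tail G e) = head G e"
  by (simp add: arc_perm_def)

lemma balanced_finite: "balanced F \<Longrightarrow> finite F"
  unfolding balanced_def using finite_arcs finite_subset by blast

lemma arc_perm_permutes_tails:
  assumes "balanced F"
  shows "arc_perm F permutes tail G ` F"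
proof (rule bij_imp_permutes)
  have "arc_perm F ` tail G ` F = tail G ` F"
    using assms arc_perm_tail unfolding balanced_def image_image by (metis (no_types, lifting) image_cong)
  moreover have "inj_on (arc_perm F) (tail G ` F)"
  proof (rule inj_onI)
    fix x y assume "x \<in> tail G ` F" "y \<in> tail G ` F" "arc_perm F x = arc_perm F y"
    then show "x = y" using assms arc_perm_tail unfolding balanced_def by (auto dest: inj_onD)
  qed
  ultimately show "bij_betw (arc_perm F) (tail G ` F) (tail G ` F)" by (simp add: bij_betw_def)
qed (simp add: arc_perm_def)

lemma balanced_tails_subset: "balanced F \<Longrightarrow> tail G ` F \<subseteq> verts G"
  unfolding balanced_def by auto

text \<open>A cycle with k arcs has sign \<open>(-1) ^ (k - 1)\<close>, and its k arcs enter the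
  determinant with a minus each. Every cycle thus contributes one minus whatever its length, loops
  included: this is the source of the sign by the number of cycles in \<open>Q_poly\<close>.\<close>

lemma balanced_scycle:
  assumes "C \<in> scycles"
  shows "balanced C" "C \<noteq> {}" "sign (arc_perm C) * (-1) ^ card C = (-1 :: int)"
proof -
  obtain c where C: "C = set c" and "cycle c" using assms by (auto simp: scycles_def)
  then have c: "c \<noteq> []" "set c \<subseteq> arcs G" "distinct (map (tail G) c)" "map (head G) c = rotate1 (map (tail G) c)"
    by (auto simp: cycle_iff_rotate1)
  have "distinct (map (head G) c)" unfolding c(4) using c(3) by (simp only: distinct1_rotate)
  moreover have "set (map (head G) c) = set (map (tail G) c)" unfolding c(4) by simp
  ultimately show b: "balanced C" using c(1-3) C by (simp add: balanced_def distinct_map)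
  show "C \<noteq> {}" using C c by simp
  have "arc_perm C = cycle_of_list (map (tail G) c)"
  proof
    fix x
    show "arc_perm C x = cycle_of_list (map (tail G) c) x"
    proof (cases "x \<in> set (map (tail G) c)")
      case True
      then obtain e where e: "e \<in> set c" "x = tail G e" by auto
      have "map (cycle_of_list (map (tail G) c)) (map (tail G) c) = map (head G) c"
        using cyclic_rotation[OF c(3), of 1] c(4) by simp
      then have "cycle_of_list (map (tail G) c) (tail G e) = head G e"
        using e(1) by (simp add: map_eq_conv)
      then show ?thesis using e b C arc_perm_tail by (simp add: balanced_def)
    next
      case False
      then show ?thesis using id_outside_supp[OF False] C by (simp add: arc_perm_def)
    qed
  qed
  then have "sign (arc_perm C) = (-1) ^ (length c - 1)"
    using sign_cycle_of_list[OF c(3)] c(1) by simp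
  moreover have "card C = Suc (length c - 1)"
    using c(1,3) C by (simp add: distinct_map distinct_card)
  ultimately show "sign (arc_perm C) * (-1) ^ card C = (-1 :: int)"
    by (simp add: power_add[symmetric] mult_2[symmetric])
qed

lemma balanced_union:
  assumes "balanced C" "balanced F" "disjnt (tail G ` C) (tail G ` F)"
  shows "balanced (C \<union> F)" "arc_perm (C \<union> F) = arc_perm C \<circ> arc_perm F" "C \<inter> F = {}"
proof -
  show CF: "C \<inter> F = {}" using assms(3) by (auto simp: disjnt_def)
  have h: "disjnt (head G ` C) (head G ` F)" using assms unfolding balanced_def by auto
  show b: "balanced (C \<union> F)"
  proof -
    have "inj_on (tail G) (C \<union> F)" "inj_on (head G) (C \<union> F)"
      unfolding inj_on_Un using assms h unfolding balanced_def disjnt_def by blast+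
    then show ?thesis using assms(1,2) unfolding balanced_def by (simp add: image_Un)
  qed
  show "arc_perm (C \<union> F) = arc_perm C \<circ> arc_perm F"
  proof
    fix x
    consider e where "e \<in> C" "x = tail G e" | e where "e \<in> F" "x = tail G e" | "x \<notin> tail G ` (C \<union> F)" by blast
    then show "arc_perm (C \<union> F) x = (arc_perm C \<circ> arc_perm F) x"
    proof cases
      case 1
      then have "x \<notin> tail G ` F" using assms(3) by (auto simp: disjnt_def)
      then show ?thesis using 1 assms b arc_perm_tail[of _ e] unfolding balanced_def by (simp add: arc_perm_def)
    next
      case 2
      then have "head G e \<in> tail G ` F" using assms(2) unfolding balanced_def by blast
      then have "head G e \<notin> tail G ` C" using assms(3) by (auto simp: disjnt_def)
      then have "arc_perm C (head G e) = head G e" by (simp add: arc_perm_def)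
      then show ?thesis using 2 assms b arc_perm_tail[of _ e] unfolding balanced_def by simp
    next
      case 3
      then show ?thesis by (auto simp: arc_perm_def image_Un)
    qed
  qed
qed

lemma balanced_Union_mcycle:
  assumes "Cs \<in> mcycles"
  shows "balanced (\<Union>Cs)" "sign (arc_perm (\<Union>Cs)) * (-1) ^ card (\<Union>Cs) = ((-1) ^ card Cs :: int)"
proof -
  have "finite Cs" "Cs \<subseteq> scycles" "pairwise (\<lambda>C D. disjnt (tail G ` C) (tail G ` D)) Cs"
    using assms by (auto simp: mcycles_def)
  then have "balanced (\<Union>Cs) \<and> sign (arc_perm (\<Union>Cs)) * (-1) ^ card (\<Union>Cs) = ((-1) ^ card Cs :: int)"
  proof (induction Cs rule: finite_induct)
    case empty
    have "arc_perm {} = id" by (auto simp: arc_perm_def)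
    then show ?case by (simp add: balanced_def sign_id)
  next
    case (insert C Cs)
    then have C: "C \<in> scycles" and IH: "balanced (\<Union>Cs)" "sign (arc_perm (\<Union>Cs)) * (-1) ^ card (\<Union>Cs) = ((-1) ^ card Cs :: int)"
      by (auto simp: pairwise_insert)
    note b = balanced_scycle[OF C]
    have "disjnt (tail G ` C) (tail G ` D)" if "D \<in> Cs" for D
      using insert.hyps(2) insert.prems(2) that by (auto simp: pairwise_insert)
    then have "disjnt (tail G ` C) (tail G ` \<Union>Cs)" by (auto simp: disjnt_def)
    note u = balanced_union[OF b(1) IH(1) this]
    have "sign (arc_perm (C \<union> \<Union>Cs)) = sign (arc_perm C) * sign (arc_perm (\<Union>Cs))"
      unfolding u(2) using b(1) IH(1)
      by (intro sign_compose permutes_imp_permutation[OF finite_imageI[OF balanced_finite] arc_perm_permutes_tails])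
    moreover have "card (C \<union> \<Union>Cs) = card C + card (\<Union>Cs)"
      using u(3) balanced_finite b(1) IH(1) by (intro card_Un_disjoint) auto
    ultimately have "sign (arc_perm (C \<union> \<Union>Cs)) * (-1) ^ card (C \<union> \<Union>Cs) =
        (sign (arc_perm C) * (-1) ^ card C) * (sign (arc_perm (\<Union>Cs)) * (-1) ^ card (\<Union>Cs))"
      by (simp add: power_add)
    also have "\<dots> = (-1) ^ card (insert C Cs)" unfolding b(3) IH(2) using insert.hyps by simp
    finally show ?case using u(1) by simp
  qed
  then show "balanced (\<Union>Cs)" "sign (arc_perm (\<Union>Cs)) * (-1) ^ card (\<Union>Cs) = ((-1) ^ card Cs :: int)" by auto
qed

text \<open>In \<open>F\<close> an arc is determined by its tail, so the successor along
  \<open>D\<close> of an arc in \<open>C\<close> is the successor along \<open>C\<close>. Following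
  \<open>D\<close> once around from \<open>e\<close> never leaves \<open>C\<close>.\<close>

lemma scycle_subset:
  assumes F: "inj_on (tail G) F" and C: "C \<in> scycles" "C \<subseteq> F" and D: "D \<in> scycles" "D \<subseteq> F"
    and e: "e \<in> C" "e \<in> D"
  shows "D \<subseteq> C"
proof
  fix f assume f: "f \<in> D"
  obtain c where Dc: "D = set c" "cycle c" using D by (auto simp: scycles_def)
  then have c: "c \<noteq> []" "map (head G) c = rotate1 (map (tail G) c)"
    by (auto simp: cycle_iff_rotate1)
  let ?n = "length c"
  have step: "c ! (Suc i mod ?n) \<in> C" if "i < ?n" "c ! i \<in> C" for i
  proof -
    have "head G (c ! i) = tail G (c ! (Suc i mod ?n))"
      using arg_cong[OF c(2), of "\<lambda>xs. xs ! i"] that(1) mod_less_divisor[of ?n "Suc i"] c(1)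
      by (simp add: nth_rotate1 del: mod_less_divisor)
    moreover have "head G (c ! i) \<in> tail G ` C"
      using balanced_scycle(1)[OF C(1)] that(2) unfolding balanced_def by blast
    then obtain e' where "e' \<in> C" "head G (c ! i) = tail G e'" by blast
    moreover have "c ! (Suc i mod ?n) \<in> F" using Dc D(2) c(1) by (metis length_greater_0_conv mod_less_divisor nth_mem subsetD)
    ultimately show ?thesis using F C(2) by (metis inj_onD subsetD)
  qed
  obtain i where i: "i < ?n" "c ! i = e" using e(2) Dc by (metis in_set_conv_nth)
  have all: "c ! ((i + k) mod ?n) \<in> C" for k
  proof (induction k)
    case 0
    then show ?case using i e by simp
  next
    case (Suc k)
    then have "c ! (Suc ((i + k) mod ?n) mod ?n) \<in> C" using c(1) by (intro step) auto
    then show ?case by (simp add: mod_Suc_eq)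
  qed
  obtain j where j: "j < ?n" "c ! j = f" using f Dc by (metis in_set_conv_nth)
  have "(i + (?n - i + j)) mod ?n = j" using i(1) j(1) by simp
  then show "f \<in> C" using all[of "?n - i + j"] j(2) by simp
qed

lemma scycle_unique:
  assumes "inj_on (tail G) F" "C \<in> scycles" "C \<subseteq> F" "D \<in> scycles" "D \<subseteq> F" "e \<in> C" "e \<in> D"
  shows "C = D"
  using scycle_subset assms by (meson subset_antisym)

text \<open>The orbit of the tail of \<open>e\<close> under \<open>arc_perm F\<close>, lifted back
  to the arcs of \<open>F\<close> with these tails, is the cycle.\<close>

lemma scycle_through_arc:
  assumes F: "balanced F" and e: "e \<in> F"
  obtains C where "C \<in> scycles" "C \<subseteq> F" "e \<in> C"
proof -
  let ?p = "arc_perm F" and ?x = "tail G e" and ?i = "inv_into F (tail G)"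
  have inj: "inj_on (tail G) F" and hF: "head G ` F = tail G ` F" and FA: "F \<subseteq> arcs G"
    using F by (auto simp: balanced_def)
  have perm: "permutation ?p"
    using arc_perm_permutes_tails[OF F] balanced_finite[OF F] by (auto intro: permutes_imp_permutation)
  define k where "k = least_power ?p ?x"
  have k: "(?p ^^ k) ?x = ?x" "k > 0"
    unfolding k_def by (rule least_power_of_permutation[OF perm])+
  define cs where "cs = map (\<lambda>i. (?p ^^ i) ?x) [0..<k]"
  have dcs: "distinct cs" using cycle_of_permutation[OF perm, of ?x] by (simp add: cs_def k_def)
  have orb: "(?p ^^ i) ?x \<in> tail G ` F" for i
    using permutes_in_image[OF permutes_funpow[OF arc_perm_permutes_tails[OF F]], of i ?x] e by blast
  then have ti: "tail G (?i ((?p ^^ i) ?x)) = (?p ^^ i) ?x" for i by (rule f_inv_into_f)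
  define c where "c = map ?i cs"
  have tc: "map (tail G) c = cs" by (simp add: c_def cs_def ti)
  have "head G (?i ((?p ^^ i) ?x)) = (?p ^^ Suc i) ?x" for i
    using orb[of i] by (simp add: arc_perm_def)
  then have "map (head G) c = map (\<lambda>i. (?p ^^ Suc i) ?x) [0..<k]" by (simp add: c_def cs_def)
  also have "\<dots> = rotate1 cs"
  proof (rule nth_equalityI)
    fix i assume "i < length (map (\<lambda>i. (?p ^^ Suc i) ?x) [0..<k])"
    then have i: "i < k" by simp
    show "map (\<lambda>i. (?p ^^ Suc i) ?x) [0..<k] ! i = rotate1 cs ! i"
    proof (cases "Suc i = k")
      case True
      then show ?thesis using i k by (simp add: nth_rotate1 cs_def del: funpow.simps)
    next
      case False
      then show ?thesis using i by (simp add: nth_rotate1 cs_def del: funpow.simps)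
    qed
  qed (simp add: cs_def)
  finally have "map (head G) c = rotate1 (map (tail G) c)" by (simp add: tc)
  moreover have cF: "set c \<subseteq> F" unfolding c_def cs_def using orb by (auto intro!: inv_into_into)
  moreover have "c \<noteq> []" using k(2) by (simp add: c_def cs_def)
  ultimately have "cycle c" using dcs FA unfolding cycle_iff_rotate1 tc by blast
  moreover have "c ! 0 = e" using k(2) e inj by (simp add: c_def cs_def)
  then have "e \<in> set c" using k(2) by (metis c_def cs_def diff_zero length_map length_upt nth_mem)
  ultimately show thesis using cF by (intro that[of "set c"]) (auto simp: scycles_def)
qed

text \<open>A collection is recovered from its union as the set of all simple cycles contained in
  it, since two such cycles that share an arc coincide.\<close>

lemma bij_betw_Union_mcycles: "bij_betw \<Union> mcycles {F. balanced F}"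
proof -
  have rec: "Cs = {C \<in> scycles. C \<subseteq> \<Union>Cs}" if Cs: "Cs \<in> mcycles" for Cs
  proof (intro equalityI subsetI)
    fix C assume "C \<in> {C \<in> scycles. C \<subseteq> \<Union>Cs}"
    then have C: "C \<in> scycles" "C \<subseteq> \<Union>Cs" by auto
    then obtain e D where e: "e \<in> C" "D \<in> Cs" "e \<in> D" using balanced_scycle(2)[OF C(1)] by blast
    have "C = D" using balanced_Union_mcycle(1)[OF Cs] C e Cs
      by (intro scycle_unique[of "\<Union>Cs" C D e]) (auto simp: balanced_def mcycles_def)
    then show "C \<in> Cs" using e by simp
  qed (use Cs in \<open>auto simp: mcycles_def\<close>)
  have surj: "\<exists>Cs\<in>mcycles. F = \<Union>Cs" if F: "balanced F" for F
  proof (rule bexI[of _ "{C \<in> scycles. C \<subseteq> F}"])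
    show "F = \<Union>{C \<in> scycles. C \<subseteq> F}" using scycle_through_arc[OF F] by blast
    have inj: "inj_on (tail G) F" using F by (simp add: balanced_def)
    have "disjnt (tail G ` C) (tail G ` D)" if "C \<in> scycles" "C \<subseteq> F" "D \<in> scycles" "D \<subseteq> F" "C \<noteq> D" for C D
      using that scycle_unique[OF inj that(1-4)] inj_onD[OF inj] unfolding disjnt_def by blast
    moreover have "finite {C \<in> scycles. C \<subseteq> F}"
      by (rule finite_subset[of _ "Pow F"]) (use balanced_finite[OF F] in auto)
    ultimately show "{C \<in> scycles. C \<subseteq> F} \<in> mcycles" by (auto simp: mcycles_def pairwise_def)
  qed
  have "inj_on \<Union> mcycles" by (rule inj_onI) (metis rec)
  then show ?thesis unfolding bij_betw_def using balanced_Union_mcycle(1) surj by blast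
qed

text \<open>The terms in the expansion of the product belonging to \<open>\<sigma>\<close>.
  \<open>None\<close> picks the diagonal term; it is needed as a value of its own since at a fixed
  point of \<open>\<sigma>\<close> a loop may be picked instead.\<close>

definition arc_choices :: "('a \<Rightarrow> 'a) \<Rightarrow> ('a \<Rightarrow> 'b option) set" where
  "arc_choices \<sigma> = (\<Pi>\<^sub>E x\<in>verts G. (if \<sigma> x = x then {None} else {}) \<union> Some ` {e \<in> arcs G. tail G e = x \<and> head G e = \<sigma> x})"

definition chosen :: "('a \<Rightarrow> 'b option) \<Rightarrow> 'b set" where
  "chosen c = {e. \<exists>x\<in>verts G. c x = Some e}"

definition choice_of :: "'b set \<Rightarrow> 'a \<Rightarrow> 'b option" where
  "choice_of F = (\<lambda>x\<in>verts G. if x \<in> tail G ` F then Some (inv_into F (tail G) x) else None)"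

lemma arc_choices_dest:
  assumes "c \<in> arc_choices \<sigma>" "x \<in> verts G"
  shows "c x = None \<Longrightarrow> \<sigma> x = x" "c x = Some e \<Longrightarrow> e \<in> arcs G \<and> tail G e = x \<and> head G e = \<sigma> x"
  using assms unfolding arc_choices_def by (auto dest!: PiE_mem split: if_splits)

lemma chosen_balanced:
  assumes \<sigma>: "\<sigma> permutes verts G" and c: "c \<in> arc_choices \<sigma>"
  shows "balanced (chosen c)" "arc_perm (chosen c) = \<sigma>" "choice_of (chosen c) = c"
    "tail G ` chosen c = {x \<in> verts G. c x \<noteq> None}"
proof -
  note D = arc_choices_dest[OF c]
  have e: "e \<in> arcs G \<and> c (tail G e) = Some e \<and> head G e = \<sigma> (tail G e) \<and> tail G e \<in> verts G" if "e \<in> chosen c" for e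
    using that D unfolding chosen_def by auto
  show T: "tail G ` chosen c = {x \<in> verts G. c x \<noteq> None}" (is "_ = ?T")
    using D e unfolding chosen_def by (force simp: image_iff)
  have it: "inj_on (tail G) (chosen c)" by (rule inj_onI) (metis e option.inject)
  have ih: "inj_on (head G) (chosen c)"
    by (rule inj_onI) (metis e it inj_onD permutes_inj[OF \<sigma>] injD)
  \<comment> \<open>If \<open>\<sigma> x\<close> had no chosen arc it would be a fixed point of
    \<open>\<sigma>\<close>, so it would equal \<open>x\<close>, which has one.\<close>
  have "\<sigma> ` ?T = ?T"
  proof (rule endo_inj_surj)
    show "\<sigma> ` ?T \<subseteq> ?T"
    proof
      fix y assume "y \<in> \<sigma> ` ?T"
      then obtain x where x: "x \<in> verts G" "c x \<noteq> None" "y = \<sigma> x" by blast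
      have y: "y \<in> verts G" using x permutes_in_image[OF \<sigma>] by simp
      show "y \<in> ?T"
      proof (rule ccontr)
        assume "y \<notin> ?T"
        then have "c y = None" using y by simp
        then have "\<sigma> y = y" using D y by blast
        then have "x = y" using x permutes_inj[OF \<sigma>] by (metis injD)
        then show False using x \<open>c y = None\<close> by simp
      qed
    qed
    show "inj_on \<sigma> ?T" using permutes_inj[OF \<sigma>] by (auto intro: inj_on_subset)
  qed (simp add: finite_verts)
  moreover have "head G ` chosen c = \<sigma> ` tail G ` chosen c"
    using e by (force simp: image_iff)
  ultimately have "head G ` chosen c = tail G ` chosen c" using T by simp
  then show b: "balanced (chosen c)" using it ih e by (auto simp: balanced_def)
  show "arc_perm (chosen c) = \<sigma>"
  proof
    fix x
    show "arc_perm (chosen c) x = \<sigma> x"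
    proof (cases "x \<in> tail G ` chosen c")
      case True
      then obtain f where "f \<in> chosen c" "x = tail G f" by blast
      then show ?thesis using arc_perm_tail[OF it] e by simp
    next
      case False
      then have "\<sigma> x = x" using D(1)[of x] permutes_not_in[OF \<sigma>, of x] T by blast
      then show ?thesis using False by (simp add: arc_perm_def)
    qed
  qed
  show "choice_of (chosen c) = c"
  proof
    fix x
    show "choice_of (chosen c) x = c x"
    proof (cases "x \<in> tail G ` chosen c")
      case True
      then obtain f where "f \<in> chosen c" "x = tail G f" by blast
      then show ?thesis using e it by (simp add: choice_of_def)
    next
      case False
      then have "x \<in> verts G \<longrightarrow> c x = None" using T by auto
      moreover have "x \<notin> verts G \<longrightarrow> c x = undefined" using c by (auto simp: arc_choices_def)
      ultimately show ?thesis using False by (simp add: choice_of_def)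
    qed
  qed
qed

lemma choice_of_balanced:
  assumes F: "balanced F"
  shows "arc_perm F permutes verts G" "choice_of F \<in> arc_choices (arc_perm F)" "chosen (choice_of F) = F"
proof -
  have inj: "inj_on (tail G) F" and sub: "tail G ` F \<subseteq> verts G" "F \<subseteq> arcs G"
    using F balanced_tails_subset by (auto simp: balanced_def)
  show "arc_perm F permutes verts G"
    by (rule permutes_subset[OF arc_perm_permutes_tails[OF F] sub(1)])
  show "choice_of F \<in> arc_choices (arc_perm F)"
    unfolding arc_choices_def choice_of_def
    using inj sub by (auto simp: arc_perm_tail) (auto simp: arc_perm_def)
  show "chosen (choice_of F) = F"
  proof (intro equalityI subsetI)
    fix e assume "e \<in> chosen (choice_of F)"
    then obtain x where "x \<in> verts G" "choice_of F x = Some e" by (auto simp: chosen_def)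
    then show "e \<in> F" by (auto simp: choice_of_def intro: inv_into_into split: if_splits)
  next
    fix e assume e: "e \<in> F"
    then have "tail G e \<in> verts G" "choice_of F (tail G e) = Some e"
      using sub inj by (auto simp: choice_of_def)
    then show "e \<in> chosen (choice_of F)" unfolding chosen_def by blast
  qed
qed

text \<open>The left side is the determinant of z times the identity minus the weighted adjacency
  matrix. Pairs of a permutation and a choice correspond to balanced arc sets \<open>F\<close>, with
  \<open>\<sigma> = arc_perm F\<close>; each vertex without a chosen arc leaves a factor
  \<open>z\<close>.\<close>

theorem det_sum_mcycles:
  fixes \<omega> :: "'b \<Rightarrow> 'c::comm_ring_1" and z :: 'c
  shows "(\<Sum>\<sigma> | \<sigma> permutes verts G. of_int (sign \<sigma>) *
       (\<Prod>x\<in>verts G. (if \<sigma> x = x then z else 0) - (\<Sum>e | e \<in> arcs G \<and> tail G e = x \<and> head G e = \<sigma> x. \<omega> e))) =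
     (\<Sum>Cs\<in>mcycles. (-1) ^ card Cs * (\<Prod>e\<in>\<Union>Cs. \<omega> e) * z ^ (card (verts G) - card (\<Union>Cs)))"
proof -
  let ?V = "verts G"
  define val where "val q = (case q of None \<Rightarrow> z | Some e \<Rightarrow> - \<omega> e)" for q
  have entry: "(if \<sigma> x = x then z else 0) - (\<Sum>e | e \<in> arcs G \<and> tail G e = x \<and> head G e = \<sigma> x. \<omega> e) =
      (\<Sum>q\<in>(if \<sigma> x = x then {None} else {}) \<union> Some ` {e \<in> arcs G. tail G e = x \<and> head G e = \<sigma> x}. val q)" for \<sigma> x
  proof -
    have "(\<Sum>q\<in>(if \<sigma> x = x then {None} else {}) \<union> Some ` {e \<in> arcs G. tail G e = x \<and> head G e = \<sigma> x}. val q) =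
        (\<Sum>q\<in>(if \<sigma> x = x then {None} else {}). val q) + (\<Sum>q\<in>Some ` {e \<in> arcs G. tail G e = x \<and> head G e = \<sigma> x}. val q)"
      by (intro sum.union_disjoint) (auto simp: finite_arcs)
    also have "(\<Sum>q\<in>(if \<sigma> x = x then {None} else {}). val q) = (if \<sigma> x = x then z else 0)"
      by (simp add: val_def)
    also have "(\<Sum>q\<in>Some ` {e \<in> arcs G. tail G e = x \<and> head G e = \<sigma> x}. val q) =
        - (\<Sum>e | e \<in> arcs G \<and> tail G e = x \<and> head G e = \<sigma> x. \<omega> e)"
      by (subst sum.reindex) (auto simp: val_def sum_negf)
    finally show ?thesis by simp
  qed
  have prod: "(\<Prod>x\<in>?V. (if \<sigma> x = x then z else 0) - (\<Sum>e | e \<in> arcs G \<and> tail G e = x \<and> head G e = \<sigma> x. \<omega> e)) =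
      (\<Sum>c\<in>arc_choices \<sigma>. \<Prod>x\<in>?V. val (c x))" for \<sigma>
    unfolding entry arc_choices_def by (rule prod_sum_PiE) (auto simp: finite_arcs finite_verts)
  have fin: "finite (arc_choices \<sigma>)" for \<sigma>
    unfolding arc_choices_def by (intro finite_PiE) (auto simp: finite_arcs finite_verts)
  have val: "(\<Prod>x\<in>?V. val (c x)) = (-1) ^ card F * (\<Prod>e\<in>F. \<omega> e) * z ^ (card ?V - card F)"
    if \<sigma>: "\<sigma> permutes ?V" and c: "c \<in> arc_choices \<sigma>" and F: "F = chosen c" for \<sigma> c F
  proof -
    note b = chosen_balanced[OF \<sigma> c, folded F]
    have inj: "inj_on (tail G) F" using b(1) by (simp add: balanced_def)
    have T: "tail G ` F \<subseteq> ?V" using balanced_tails_subset[OF b(1)] .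
    have "(\<Prod>x\<in>?V. val (c x)) = (\<Prod>x\<in>?V - tail G ` F. val (c x)) * (\<Prod>x\<in>tail G ` F. val (c x))"
      by (rule prod.subset_diff[OF T finite_verts])
    also have "(\<Prod>x\<in>?V - tail G ` F. val (c x)) = (\<Prod>x\<in>?V - tail G ` F. z)"
      using b(4) by (intro prod.cong) (auto simp: val_def)
    also have "\<dots> = z ^ (card ?V - card F)"
      using card_Diff_subset[OF finite_imageI[OF balanced_finite[OF b(1)]] T] card_image[OF inj] by simp
    also have "(\<Prod>x\<in>tail G ` F. val (c x)) = (\<Prod>e\<in>F. - \<omega> e)"
    proof -
      have "c (tail G e) = Some e" if "e \<in> F" for e
        using that arc_choices_dest[OF c] unfolding F chosen_def by auto
      then show ?thesis using inj by (subst prod.reindex) (auto simp: val_def)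
    qed
    also have "\<dots> = (-1) ^ card F * (\<Prod>e\<in>F. \<omega> e)" by (simp add: prod_uminus)
    finally show ?thesis by (simp add: mult_ac)
  qed
  have "(\<Sum>\<sigma> | \<sigma> permutes ?V. of_int (sign \<sigma>) *
       (\<Prod>x\<in>?V. (if \<sigma> x = x then z else 0) - (\<Sum>e | e \<in> arcs G \<and> tail G e = x \<and> head G e = \<sigma> x. \<omega> e))) =
     (\<Sum>(\<sigma>, c)\<in>(SIGMA \<sigma>:{\<sigma>. \<sigma> permutes ?V}. arc_choices \<sigma>). of_int (sign \<sigma>) * (\<Prod>x\<in>?V. val (c x)))"
    unfolding prod sum_distrib_left
    by (rule sum.Sigma) (auto simp: fin finite_permutations finite_verts)
  also have "\<dots> = (\<Sum>F | balanced F. of_int (sign (arc_perm F)) * ((-1) ^ card F * (\<Prod>e\<in>F. \<omega> e) * z ^ (card ?V - card F)))"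
    by (rule sum.reindex_bij_witness[where i = "\<lambda>F. (arc_perm F, choice_of F)" and j = "\<lambda>(\<sigma>, c). chosen c"])
      (auto simp: chosen_balanced choice_of_balanced val)
  also have "\<dots> = (\<Sum>Cs\<in>mcycles. of_int (sign (arc_perm (\<Union>Cs))) *
      ((-1) ^ card (\<Union>Cs) * (\<Prod>e\<in>\<Union>Cs. \<omega> e) * z ^ (card ?V - card (\<Union>Cs))))"
    by (rule sum.reindex_bij_betw[OF bij_betw_Union_mcycles, symmetric])
  also have "\<dots> = (\<Sum>Cs\<in>mcycles. (-1) ^ card Cs * (\<Prod>e\<in>\<Union>Cs. \<omega> e) * z ^ (card ?V - card (\<Union>Cs)))"
  proof (rule sum.cong)
    fix Cs assume Cs: "Cs \<in> mcycles"
    have "of_int (sign (arc_perm (\<Union>Cs))) * (-1) ^ card (\<Union>Cs) = ((-1) ^ card Cs :: 'c)"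
      using arg_cong[OF balanced_Union_mcycle(2)[OF Cs], of "of_int :: int \<Rightarrow> 'c"] by simp
    then show "of_int (sign (arc_perm (\<Union>Cs))) * ((-1) ^ card (\<Union>Cs) * (\<Prod>e\<in>\<Union>Cs. \<omega> e) * z ^ (card ?V - card (\<Union>Cs))) =
        (-1) ^ card Cs * (\<Prod>e\<in>\<Union>Cs. \<omega> e) * z ^ (card ?V - card (\<Union>Cs))"
      by (simp flip: mult.assoc)
  qed simp
  finally show ?thesis .
qed

end

section \<open>Geometry of a cylindrical network\<close>

lemma shift_invariant_int:
  fixes a :: "'a::real_vector"
  assumes "\<And>x. Q (x + a) = Q x"
  shows "Q (x + of_int l *\<^sub>R a) = Q x"
proof (induction l rule: int_induct[of _ 0])
  case (step1 i)
  then show ?case using assms[of "x + of_int i *\<^sub>R a"] by (simp add: scaleR_add_left add.assoc)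
next
  case (step2 i)
  then show ?case using assms[of "x + of_int (i - 1) *\<^sub>R a"] by (simp add: scaleR_diff_left)
qed simp

lemma cover_simps [simp]:
  "verts (cover N) = vertices N" "arcs (cover N) = edges N" "tail (cover N) = fst" "head (cover N) = snd"
  by (simp_all add: cover_def)

lemma projection_simps [simp]:
  "verts (projection g N) = shift_orbit g ` vertices N" "arcs (projection g N) = shift_orbit (g, g) ` edges N"
  "tail (projection g N) = (`) fst" "head (projection g N) = (`) snd"
  by (simp_all add: projection_def fun_eq_iff)

lemma smult_sum_right: "Polynomial.smult c (\<Sum>i\<in>S. f i) = (\<Sum>i\<in>S. Polynomial.smult c (f i))"
  by (induction S rule: infinite_finite_induct) (simp_all add: smult_add_right)

locale cylinder =
  fixes A B m :: real and g :: point and N :: "'k::field_char_0 network"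
  assumes m: "m > 0" and g: "g = (m, 0)" and cyl: "cylindrical_network A B g N"
begin

definition sh :: "int \<Rightarrow> point \<Rightarrow> point" where
  "sh l x = x + of_int l *\<^sub>R g"

definition esh :: "int \<Rightarrow> edge \<Rightarrow> edge" where
  "esh l e = e + of_int l *\<^sub>R (g, g)"

text \<open>The number of the period, a half-open piece of width \<open>m\<close>, that contains the
  point.\<close>

definition lev :: "point \<Rightarrow> int" where
  "lev x = \<lfloor>fst x / m\<rfloor>"

definition base :: "point \<Rightarrow> point" where
  "base x = sh (- lev x) x"

lemma sh_sh [simp]: "sh k (sh l x) = sh (k + l) x"
  by (simp add: sh_def scaleR_add_left algebra_simps)

lemma sh_0 [simp]: "sh 0 x = x"
  by (simp add: sh_def)

lemma esh_esh [simp]: "esh k (esh l e) = esh (k + l) e"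
  by (simp add: esh_def scaleR_add_left algebra_simps)

lemma esh_0 [simp]: "esh 0 e = e"
  by (simp add: esh_def flip: zero_prod_def)

lemma fst_esh [simp]: "fst (esh l e) = sh l (fst e)" and snd_esh [simp]: "snd (esh l e) = sh l (snd e)"
  by (simp_all add: esh_def sh_def)

lemma lev_sh [simp]: "lev (sh l x) = lev x + l"
proof -
  have "fst (sh l x) / m = fst x / m + of_int l"
    using m unfolding sh_def by (simp add: g add_divide_distrib)
  then show ?thesis by (simp add: lev_def)
qed

lemma sh_eq_iff [simp]: "sh k x = sh l x \<longleftrightarrow> k = l"
  using lev_sh by (metis add_left_cancel)

lemma lev_base [simp]: "lev (base x) = 0"
  by (simp add: base_def)

lemma base_sh [simp]: "base (sh l x) = base x"
  by (simp add: base_def)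

lemma sh_lev_base [simp]: "sh (lev x) (base x) = x"
  by (simp add: base_def)

lemma base_id: "lev x = 0 \<Longrightarrow> base x = x"
  by (simp add: base_def)

lemma shift_orbit_point: "shift_orbit g x = range (\<lambda>l. sh l x)"
  by (simp add: shift_orbit_def sh_def)

lemma shift_orbit_edge: "shift_orbit (g, g) e = range (\<lambda>l. esh l e)"
  by (simp add: shift_orbit_def esh_def)

lemma shift_orbit_sh: "shift_orbit g (sh l x) = shift_orbit g x"
  unfolding shift_orbit_point
proof (intro equalityI subsetI)
  fix y assume "y \<in> range (\<lambda>k. sh k x)"
  then obtain k where "y = sh k x" by blast
  then have "y = sh (k - l) (sh l x)" by simp
  then show "y \<in> range (\<lambda>k. sh k (sh l x))" by blast
qed auto

lemma shift_orbit_esh: "shift_orbit (g, g) (esh l e) = shift_orbit (g, g) e"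
  unfolding shift_orbit_edge
proof (intro equalityI subsetI)
  fix f assume "f \<in> range (\<lambda>k. esh k e)"
  then obtain k where "f = esh k e" by blast
  then have "f = esh (k - l) (esh l e)" by simp
  then show "f \<in> range (\<lambda>k. esh k (esh l e))" by blast
qed auto

lemma shift_orbit_eq_iff: "shift_orbit g x = shift_orbit g y \<longleftrightarrow> base x = base y"
proof
  assume "shift_orbit g x = shift_orbit g y"
  then have "x \<in> shift_orbit g y" by (metis shift_orbit_point rangeI sh_0)
  then show "base x = base y" by (auto simp: shift_orbit_point)
next
  assume "base x = base y"
  then show "shift_orbit g x = shift_orbit g y" by (metis base_def shift_orbit_sh)
qed

lemma fst_shift_orbit: "fst ` shift_orbit (g, g) e = shift_orbit g (fst e)"
  and snd_shift_orbit: "snd ` shift_orbit (g, g) e = shift_orbit g (snd e)"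
  by (simp_all add: shift_orbit_edge shift_orbit_point image_image)

lemma vertices_sh [simp]: "sh l x \<in> vertices N \<longleftrightarrow> x \<in> vertices N"
  unfolding sh_def
proof (rule shift_invariant_int)
  fix x
  have im: "(\<lambda>v. v + g) ` vertices N = vertices N" using cyl by (simp add: cylindrical_network_def)
  show "(x + g \<in> vertices N) = (x \<in> vertices N)"
  proof
    assume "x + g \<in> vertices N"
    then have "x + g \<in> (\<lambda>v. v + g) ` vertices N" using im by simp
    then show "x \<in> vertices N" by auto
  qed (use im in blast)
qed

lemma edges_esh [simp]: "esh l e \<in> edges N \<longleftrightarrow> e \<in> edges N"
  unfolding esh_def using cyl by (intro shift_invariant_int) (auto simp: cylindrical_network_def)

lemma wt_esh:
  assumes "e \<in> edges N"
  shows "wt N (esh l e) = wt N e"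
proof -
  \<comment> \<open>Weights are invariant only on edges; the option value packs membership and
    weight into one function that is invariant everywhere.\<close>
  have "(if esh l e \<in> edges N then Some (wt N (esh l e)) else None) = (if e \<in> edges N then Some (wt N e) else None)"
    unfolding esh_def using cyl
    by (intro shift_invariant_int[where Q = "\<lambda>e. if e \<in> edges N then Some (wt N e) else None"])
      (auto simp: cylindrical_network_def)
  then show ?thesis using assms by simp
qed

lemma base_vertices [simp]: "base x \<in> vertices N \<longleftrightarrow> x \<in> vertices N"
  by (simp add: base_def)

lemma edge_ends: "e \<in> edges N \<Longrightarrow> fst e \<in> vertices N \<and> snd e \<in> vertices N"
  using cyl by (auto simp: cylindrical_network_def)

lemma edge_endsD: "(x, y) \<in> edges N \<Longrightarrow> x \<in> vertices N \<and> y \<in> vertices N"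
  using edge_ends by fastforce

lemma finite_out: "x \<in> vertices N \<Longrightarrow> finite {e \<in> edges N. fst e = x}"
  using cyl by (auto simp: cylindrical_network_def out_arcs_def)

sublocale cov: acyclic_digraph "cover N"
proof
  fix x p assume w: "pre_digraph.awalk (cover N) x p x"
  then have "x \<in> vertices N" by (simp add: pre_digraph.awalk_def)
  moreover have "pre_digraph.awalk (cover N) x p (x + of_int 0 *\<^sub>R g)" using w by simp
  ultimately show "p = []" using cyl unfolding cylindrical_network_def by (metis less_irrefl)
qed (simp_all add: edge_ends)

lemma awalk_sh_pos: "cov.awalk x p (sh l x) \<Longrightarrow> p \<noteq> [] \<Longrightarrow> l > 0"
  using cyl unfolding cylindrical_network_def sh_def by (metis cover_simps(1) pre_digraph.awalk_def)

section \<open>Fundamental domain and finite quotient\<close>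

definition domain :: "point set" where
  "domain = {x \<in> vertices N. lev x = 0}"

text \<open>A discrete closed set meets a compact rectangle in finitely many points. The rectangle
  includes the edge at \<open>m\<close>, although the domain does not, to be compact.\<close>

lemma finite_domain: "finite domain"
proof -
  let ?K = "vertices N \<inter> ({0..m} \<times> {A..B})"
  have "compact ?K" using cyl
    by (intro closed_Int_compact compact_Times) (auto simp: cylindrical_network_def)
  moreover have "discrete ?K" using cyl discrete_subset[of "vertices N" ?K] by (auto simp: cylindrical_network_def)
  ultimately have "finite ?K" using discrete_compact_finite_iff by blast
  moreover have "domain \<subseteq> ?K"
  proof
    fix x assume x: "x \<in> domain"
    then have "x \<in> vertices N" "0 \<le> fst x / m" "fst x / m < 1"
      by (auto simp: domain_def lev_def floor_eq_iff)
    moreover have "x \<in> strip A B" using cyl x by (auto simp: cylindrical_network_def domain_def)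
    ultimately show "x \<in> ?K" using m by (cases x) (auto simp: strip_def field_simps)
  qed
  ultimately show ?thesis by (rule rev_finite_subset)
qed

lemma base_domain: "x \<in> vertices N \<Longrightarrow> base x \<in> domain"
  by (simp add: domain_def)

definition n :: nat where
  "n = card domain"

definition \<rho> :: "nat \<Rightarrow> point" where
  "\<rho> = (SOME f. bij_betw f {0..<n} domain)"

definition idx :: "point \<Rightarrow> nat" where
  "idx x = the_inv_into {0..<n} \<rho> (base x)"

lemma bij_rho: "bij_betw \<rho> {0..<n} domain"
  unfolding \<rho>_def n_def by (rule someI_ex[OF ex_bij_betw_nat_finite[OF finite_domain]])

lemma rho_vertices: "i < n \<Longrightarrow> \<rho> i \<in> vertices N" and lev_rho: "i < n \<Longrightarrow> lev (\<rho> i) = 0"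
  using bij_betwE[OF bij_rho] by (auto simp: domain_def)

lemma idx_less: "x \<in> vertices N \<Longrightarrow> idx x < n"
  using bij_rho the_inv_into_into[of \<rho> "{0..<n}" "base x" "{0..<n}"] base_domain
  by (auto simp: idx_def bij_betw_def)

lemma rho_idx: "x \<in> vertices N \<Longrightarrow> \<rho> (idx x) = base x"
  unfolding idx_def using bij_rho base_domain by (intro f_the_inv_into_f) (auto simp: bij_betw_def)

lemma idx_rho: "i < n \<Longrightarrow> idx (\<rho> i) = i"
  unfolding idx_def using bij_rho the_inv_into_f_f[of \<rho> "{0..<n}" i] by (simp add: base_id lev_rho bij_betw_def)

lemma idx_sh [simp]: "idx (sh l x) = idx x"
  by (simp add: idx_def)

lemma idx_eq_iff: "x \<in> vertices N \<Longrightarrow> y \<in> vertices N \<Longrightarrow> idx x = idx y \<longleftrightarrow> base x = base y"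
  by (metis rho_idx idx_def)

abbreviation parcs :: "edge set set" where
  "parcs \<equiv> shift_orbit (g, g) ` edges N"

definition oidx :: "point set \<Rightarrow> nat" where
  "oidx z = the_elem (idx ` z)"

lemma oidx_orbit [simp]: "oidx (shift_orbit g x) = idx x"
  by (simp add: oidx_def shift_orbit_point image_image)

text \<open>The projection with its vertices renumbered, so that they can index a matrix. The arcs
  stay orbits of edges, hence cycles on both sides are the same sets.\<close>

definition quot :: "(nat, edge set) pre_digraph" where
  "quot = \<lparr>verts = {0..<n}, arcs = parcs, tail = (\<lambda>\<epsilon>. oidx (fst ` \<epsilon>)), head = (\<lambda>\<epsilon>. oidx (snd ` \<epsilon>))\<rparr>"

lemma quot_simps [simp]:
  "verts quot = {0..<n}" "arcs quot = parcs"
  "tail quot = (\<lambda>\<epsilon>. oidx (fst ` \<epsilon>))" "head quot = (\<lambda>\<epsilon>. oidx (snd ` \<epsilon>))"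
  by (simp_all add: quot_def)

text \<open>The number of periods an arc advances, measured by the fundamental domain. Its sum over
  a cycle is the winding number, by \<open>wind_eq\<close>.\<close>

definition sft :: "edge set \<Rightarrow> int" where
  "sft \<epsilon> = the_elem ((\<lambda>e. lev (snd e) - lev (fst e)) ` \<epsilon>)"

lemma sft_orbit: "sft (shift_orbit (g, g) e) = lev (snd e) - lev (fst e)"
  by (simp add: sft_def shift_orbit_edge image_image)

lemma proj_wt_orbit: "e \<in> edges N \<Longrightarrow> proj_wt N (shift_orbit (g, g) e) = wt N e"
  by (simp add: proj_wt_def shift_orbit_edge image_image wt_esh)

lemma finite_parcs: "finite parcs"
proof -
  have "parcs \<subseteq> shift_orbit (g, g) ` (\<Union>x\<in>domain. {e \<in> edges N. fst e = x})"
  proof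
    fix \<epsilon> assume "\<epsilon> \<in> parcs"
    then obtain e where e: "e \<in> edges N" "\<epsilon> = shift_orbit (g, g) e" by (elim imageE)
    let ?f = "esh (- lev (fst e)) e"
    have "?f \<in> edges N" "fst ?f \<in> domain" using e edge_ends by (simp_all add: domain_def)
    moreover have "\<epsilon> = shift_orbit (g, g) ?f" using e shift_orbit_esh by simp
    ultimately show "\<epsilon> \<in> shift_orbit (g, g) ` (\<Union>x\<in>domain. {e \<in> edges N. fst e = x})" by blast
  qed
  moreover have "finite (\<Union>x\<in>domain. {e \<in> edges N. fst e = x})"
    using finite_domain finite_out by (auto simp: domain_def)
  ultimately show ?thesis by (meson finite_imageI finite_subset)
qed

sublocale quot: fin_digraph quot
  by unfold_locales (auto simp: fst_shift_orbit snd_shift_orbit finite_parcs intro!: idx_less dest: edge_endsD)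

sublocale proj: wf_digraph "projection g N"
  by unfold_locales (auto simp: fst_shift_orbit snd_shift_orbit dest: edge_endsD)

lemma inj_on_oidx: "inj_on oidx (shift_orbit g ` vertices N)"
  by (rule inj_onI) (elim imageE, simp add: idx_eq_iff shift_orbit_eq_iff)

lemma parcs_ends:
  assumes "\<epsilon> \<in> parcs"
  shows "fst ` \<epsilon> \<in> shift_orbit g ` vertices N" "snd ` \<epsilon> \<in> shift_orbit g ` vertices N"
  using assms edge_ends by (auto simp: fst_shift_orbit snd_shift_orbit)

lemma cycle_projection_iff: "pre_digraph.cycle (projection g N) c \<longleftrightarrow> quot.cycle c"
proof (cases "set c \<subseteq> parcs")
  case True
  let ?t = "map ((`) fst) c" and ?h = "map ((`) snd) c"
  have sub: "set ?t \<subseteq> shift_orbit g ` vertices N" "set ?h \<subseteq> shift_orbit g ` vertices N"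
    using True parcs_ends by auto
  have q: "map (tail quot) c = map oidx ?t" "map (head quot) c = map oidx ?h" by simp_all
  have "distinct (map oidx ?t) \<longleftrightarrow> distinct ?t"
    unfolding distinct_map[of oidx] using inj_on_subset[OF inj_on_oidx sub(1)] by simp
  moreover have "map oidx ?h = rotate1 (map oidx ?t) \<longleftrightarrow> ?h = rotate1 ?t"
  proof -
    have "inj_on oidx (set ?h \<union> set (rotate1 ?t))" using sub inj_on_subset[OF inj_on_oidx] by simp
    from inj_on_map_eq_map[OF this] show ?thesis by (simp only: rotate1_map)
  qed
  ultimately show ?thesis unfolding proj.cycle_iff_rotate1 quot.cycle_iff_rotate1 q using True by simp
next
  case False
  then show ?thesis unfolding proj.cycle_iff_rotate1 quot.cycle_iff_rotate1 by simp
qed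

lemma simple_cycles_eq: "simple_cycles g N = quot.scycles"
  by (simp add: simple_cycles_def quot.scycles_def cycle_projection_iff)

lemma multicycles_eq: "multicycles g N r = {Cs \<in> quot.mcycles. card Cs = r}"
proof -
  have dis: "disjnt (cycle_verts g N C) (cycle_verts g N D) \<longleftrightarrow> disjnt (tail quot ` C) (tail quot ` D)"
    if "C \<in> quot.scycles" "D \<in> quot.scycles" for C D
  proof -
    have "C \<subseteq> parcs" "D \<subseteq> parcs" using that quot.balanced_scycle(1) by (auto simp: quot.balanced_def)
    then have "cycle_verts g N C \<union> cycle_verts g N D \<subseteq> shift_orbit g ` vertices N"
      using parcs_ends by (auto simp: cycle_verts_def)
    then have "oidx ` (cycle_verts g N C \<inter> cycle_verts g N D) = oidx ` cycle_verts g N C \<inter> oidx ` cycle_verts g N D"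
      by (intro inj_on_image_Int[OF inj_on_oidx]) auto
    moreover have "tail quot ` E = oidx ` cycle_verts g N E" for E by (simp add: cycle_verts_def image_image)
    ultimately show ?thesis unfolding disjnt_def by (metis image_is_empty)
  qed
  have "pairwise (\<lambda>C D. disjnt (cycle_verts g N C) (cycle_verts g N D)) Cs \<longleftrightarrow>
      pairwise (\<lambda>C D. disjnt (tail quot ` C) (tail quot ` D)) Cs" if "Cs \<subseteq> quot.scycles" for Cs
    using dis that unfolding pairwise_def by (meson subsetD)
  then show ?thesis
    unfolding multicycles_def quot.mcycles_def simple_cycles_eq by blast
qed

section \<open>Lifts of cycles and winding numbers\<close>

lemma lev_walk: "cov.awalk x p y \<Longrightarrow> lev y - lev x = (\<Sum>e\<leftarrow>p. lev (snd e) - lev (fst e))"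
proof (induction p arbitrary: x)
  case (Cons e p)
  then have "fst e = x" "cov.awalk (snd e) p y" by (auto simp: cov.awalk_Cons_iff)
  then show ?case using Cons.IH[of "snd e"] by simp
qed (simp add: cov.awalk_Nil_iff)

lemma lift_walk:
  assumes "pre_digraph.cas (projection g N) (shift_orbit g x) c z" "set c \<subseteq> parcs" "x \<in> vertices N"
  shows "\<exists>p y. cov.awalk x p y \<and> map (shift_orbit (g, g)) p = c"
  using assms
proof (induction c arbitrary: x)
  case Nil
  then show ?case by (intro exI[of _ "[]"] exI[of _ x]) (simp add: cov.awalk_Nil_iff)
next
  case (Cons \<epsilon> c)
  then obtain e where e: "e \<in> edges N" "\<epsilon> = shift_orbit (g, g) e" by auto
  have "shift_orbit g (fst e) = shift_orbit g x" using Cons.prems(1) by (simp add: e fst_shift_orbit)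
  then have b: "base (fst e) = base x" by (simp add: shift_orbit_eq_iff)
  \<comment> \<open>The translate of \<open>e\<close> that starts at \<open>x\<close>: both tails
    have the same base and differ only in level.\<close>
  define f where "f = esh (lev x - lev (fst e)) e"
  have "fst f = sh (lev x) (base (fst e))" by (simp add: f_def base_def)
  then have "fst f = x" using b by simp
  moreover have f: "f \<in> edges N" "\<epsilon> = shift_orbit (g, g) f" using e by (simp_all add: f_def shift_orbit_esh)
  moreover have "pre_digraph.cas (projection g N) (shift_orbit g (snd f)) c z"
    using Cons.prems(1) by (simp add: f(2) snd_shift_orbit)
  then obtain p y where "cov.awalk (snd f) p y" "map (shift_orbit (g, g)) p = c"
    using Cons.IH[of "snd f"] Cons.prems(2) edge_ends[OF f(1)] by auto
  ultimately have "cov.awalk x (f # p) y \<and> map (shift_orbit (g, g)) (f # p) = \<epsilon> # c"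
    by (simp add: cov.awalk_Cons_iff)
  then show ?case by (intro exI)
qed

lemma project_walk:
  "cov.awalk x p y \<Longrightarrow> pre_digraph.cas (projection g N) (shift_orbit g x) (map (shift_orbit (g, g)) p) (shift_orbit g y)"
proof (induction p arbitrary: x)
  case (Cons e p)
  then show ?case by (auto simp: cov.awalk_Cons_iff fst_shift_orbit snd_shift_orbit)
qed (simp add: cov.awalk_Nil_iff)

text \<open>The levels telescope along the lift, and the arcs of a cycle are distinct, so the sum
  along the walk is a sum over the set \<open>C\<close>.\<close>

lemma lift_end:
  assumes "is_lift g N C x p y"
  shows "y = sh (\<Sum>\<epsilon>\<in>C. sft \<epsilon>) x" "p \<noteq> []"
proof -
  let ?c = "map (shift_orbit (g, g)) p"
  have p: "cov.awalk x p y" and c: "pre_digraph.cycle (projection g N) ?c" and C: "set ?c = C"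
    using assms by (auto simp: is_lift_def)
  from c obtain z where z: "pre_digraph.cas (projection g N) z ?c z" and ne: "?c \<noteq> []"
    by (auto simp: pre_digraph.cycle_def pre_digraph.awalk_def)
  show "p \<noteq> []" using ne by simp
  have "shift_orbit g x = shift_orbit g y"
    using proj.cas_ends[OF project_walk[OF p] z] ne by auto
  then have b: "base y = base x" by (simp add: shift_orbit_eq_iff)
  have "distinct (map (tail (projection g N)) ?c)" using c unfolding proj.cycle_iff_rotate1 by blast
  then have "distinct ?c" unfolding distinct_map[of _ ?c] by blast
  then have "(\<Sum>\<epsilon>\<in>C. sft \<epsilon>) = (\<Sum>\<epsilon>\<leftarrow>?c. sft \<epsilon>)"
    using C by (simp add: sum_list_distinct_conv_sum_set del: map_map)
  also have "\<dots> = lev y - lev x" unfolding lev_walk[OF p] by (simp add: sft_orbit o_def)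
  finally have "sh (\<Sum>\<epsilon>\<in>C. sft \<epsilon>) x = sh (lev y) (base x)" by (simp add: base_def)
  then show "y = sh (\<Sum>\<epsilon>\<in>C. sft \<epsilon>) x" using b by (metis sh_lev_base)
qed

lemma lift_exists:
  assumes "C \<in> quot.scycles"
  shows "\<exists>x p y. is_lift g N C x p y"
proof -
  obtain c where C: "C = set c" and c: "pre_digraph.cycle (projection g N) c"
    using assms by (auto simp: quot.scycles_def cycle_projection_iff)
  then obtain z where z: "proj.awalk z c z" by (auto simp: pre_digraph.cycle_def)
  then obtain x where x: "x \<in> vertices N" "z = shift_orbit g x" by (auto simp: proj.awalk_def)
  have "\<exists>p y. cov.awalk x p y \<and> map (shift_orbit (g, g)) p = c"
    using z x by (intro lift_walk[of x c z]) (auto simp: proj.awalk_def)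
  then show ?thesis using C c unfolding is_lift_def by metis
qed

text \<open>Existence of a lift pins down the value in the definition of \<open>wind\<close>.
  Positivity is the condition on paths of a cylindrical network, applied to a lift.\<close>

lemma wind_eq:
  assumes C: "C \<in> quot.scycles"
  shows "wind g N C = (\<Sum>\<epsilon>\<in>C. sft \<epsilon>)" "wind g N C > 0"
proof -
  obtain x p y where l: "is_lift g N C x p y" using lift_exists[OF C] by blast
  show w: "wind g N C = (\<Sum>\<epsilon>\<in>C. sft \<epsilon>)"
    unfolding wind_def
  proof (rule the_equality)
    show "\<forall>x p y. is_lift g N C x p y \<longrightarrow> y = x + of_int (\<Sum>\<epsilon>\<in>C. sft \<epsilon>) *\<^sub>R g"
      using lift_end(1) by (simp only: sh_def) blast
  next
    fix k assume "\<forall>x p y. is_lift g N C x p y \<longrightarrow> y = x + of_int k *\<^sub>R g"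
    then have "y = sh k x" using l unfolding sh_def by blast
    then show "k = (\<Sum>\<epsilon>\<in>C. sft \<epsilon>)" using lift_end(1)[OF l] by (metis sh_eq_iff)
  qed
  show "wind g N C > 0"
    using l lift_end[OF l] w awalk_sh_pos[of x p] by (auto simp: is_lift_def)
qed

lemma finite_mcycles: "finite quot.mcycles"
proof (rule finite_subset)
  have "C \<subseteq> parcs" if "C \<in> quot.scycles" for C
    using quot.balanced_scycle(1)[OF that] by (simp add: quot.balanced_def)
  then show "quot.mcycles \<subseteq> Pow (Pow parcs)" unfolding quot.mcycles_def by blast
qed (simp add: finite_parcs)

context
  fixes Cs assumes Cs: "Cs \<in> quot.mcycles"
begin

lemma mcycle_disjoint: "C \<in> Cs \<Longrightarrow> D \<in> Cs \<Longrightarrow> C \<noteq> D \<Longrightarrow> C \<inter> D = {}"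
  using Cs unfolding quot.mcycles_def pairwise_def disjnt_def by blast

lemma mcycle_finite: "finite Cs" "C \<in> Cs \<Longrightarrow> C \<in> quot.scycles" "C \<in> Cs \<Longrightarrow> finite C"
  using Cs quot.balanced_finite[OF quot.balanced_scycle(1)] by (auto simp: quot.mcycles_def)

lemma multicycle_wind_eq: "multicycle_wind g N Cs = (\<Sum>\<epsilon>\<in>\<Union>Cs. sft \<epsilon>)"
  unfolding multicycle_wind_def using mcycle_finite mcycle_disjoint
  by (subst sum.Union_disjoint) (auto simp: wind_eq(1))

lemma multicycle_wt_eq: "multicycle_wt N Cs = (\<Prod>\<epsilon>\<in>\<Union>Cs. proj_wt N \<epsilon>)"
  unfolding multicycle_wt_def cycle_wt_def using mcycle_finite mcycle_disjoint
  by (subst prod.Union_disjoint) auto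

lemma card_le_multicycle_wind: "int (card Cs) \<le> multicycle_wind g N Cs"
proof -
  have "(\<Sum>C\<in>Cs. 1) \<le> (\<Sum>C\<in>Cs. wind g N C)"
    using wind_eq(2) mcycle_finite(2) by (intro sum_mono) fastforce
  then show ?thesis by (simp add: multicycle_wind_def)
qed

lemma multicycle_wind_le_max_wind: "multicycle_wind g N Cs \<le> int (max_wind g N)"
proof -
  have "(\<Union>r. multicycles g N r) = quot.mcycles" by (auto simp: multicycles_eq)
  then have "multicycle_wind g N Cs \<le> Max (multicycle_wind g N ` (\<Union>r. multicycles g N r))"
    using Cs finite_mcycles by (intro Max_ge) auto
  then show ?thesis unfolding max_wind_def by simp
qed

end

text \<open>Each cycle winds at least once, so a collection has at most \<open>max_wind g N\<close>
  members and the bounded sum in \<open>Q_poly\<close> misses none. The global sign is split off to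
  match the determinant.\<close>

lemma Q_poly_eq:
  "Q_poly g N = Polynomial.smult ((-1) ^ max_wind g N) (\<Sum>Cs\<in>quot.mcycles.
     Polynomial.smult ((-1) ^ card Cs)
       (Polynomial.monom (multicycle_wt N Cs) (nat (int (max_wind g N) - multicycle_wind g N Cs))))"
proof -
  let ?d = "max_wind g N"
  let ?f = "\<lambda>Cs. Polynomial.monom (multicycle_wt N Cs) (nat (int ?d - multicycle_wind g N Cs))"
  have card: "card Cs \<le> ?d" if "Cs \<in> quot.mcycles" for Cs
    using card_le_multicycle_wind[OF that] multicycle_wind_le_max_wind[OF that] by simp
  have "Q_poly g N = (\<Sum>r\<le>?d. \<Sum>Cs | Cs \<in> quot.mcycles \<and> card Cs = r. Polynomial.smult ((-1) ^ (?d - card Cs)) (?f Cs))"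
    unfolding Q_poly_def Let_def multicycles_eq smult_sum_right by simp
  also have "\<dots> = (\<Sum>Cs\<in>quot.mcycles. Polynomial.smult ((-1) ^ (?d - card Cs)) (?f Cs))"
    using card by (intro sum.group) (auto simp: finite_mcycles)
  also have "\<dots> = (\<Sum>Cs\<in>quot.mcycles. Polynomial.smult ((-1) ^ ?d) (Polynomial.smult ((-1) ^ card Cs) (?f Cs)))"
  proof (rule sum.cong)
    fix Cs assume "Cs \<in> quot.mcycles"
    from card[OF this] have "(-1 :: 'k) ^ (?d - card Cs) = (-1) ^ ?d * (-1) ^ card Cs"
      by (metis minus_one_power_iff even_diff_nat mult_minus1 mult_minus_left mult_1 not_less even_add power_add le_antisym)
    then show "Polynomial.smult ((-1) ^ (?d - card Cs)) (?f Cs) = Polynomial.smult ((-1) ^ ?d) (Polynomial.smult ((-1) ^ card Cs) (?f Cs))"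
      by simp
  qed simp
  finally show ?thesis by (simp add: smult_sum_right)
qed

section \<open>The transfer matrix and its determinant\<close>

definition s0 :: nat where
  "s0 = nat (Max (insert 0 ((\<lambda>\<epsilon>. \<bar>sft \<epsilon>\<bar>) ` parcs)))"

lemma sft_bound: "\<epsilon> \<in> parcs \<Longrightarrow> \<bar>sft \<epsilon>\<bar> \<le> int s0"
proof -
  assume "\<epsilon> \<in> parcs"
  then have "\<bar>sft \<epsilon>\<bar> \<le> Max (insert 0 ((\<lambda>\<epsilon>. \<bar>sft \<epsilon>\<bar>) ` parcs))"
    using finite_parcs by (intro Max_ge) auto
  then show ?thesis using abs_ge_zero[of "sft \<epsilon>"] unfolding s0_def by linarith
qed

text \<open>
  If \<open>A(t)\<close> is the weighted adjacency matrix of the projection in which \<open>t\<close> records the shift of an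
  arc, this is \<open>t ^ s0 (1 - A(1/t))\<close>; \<open>s0\<close> clears the denominators.
\<close>

definition transfer_mat :: "'k poly mat" where
  "transfer_mat = mat n n (\<lambda>(a, b). (if b = a then Polynomial.monom 1 s0 else 0) -
     (\<Sum>\<epsilon> | \<epsilon> \<in> arcs quot \<and> tail quot \<epsilon> = a \<and> head quot \<epsilon> = b.
        Polynomial.monom (proj_wt N \<epsilon>) (nat (int s0 - sft \<epsilon>))))"

lemma prod_monom: "finite S \<Longrightarrow> (\<Prod>i\<in>S. Polynomial.monom (f i) (k i)) = Polynomial.monom (\<Prod>i\<in>S. f i) (\<Sum>i\<in>S. k i)"
  for f :: "'i \<Rightarrow> 'c::comm_ring_1"
  by (induction S rule: finite_induct) (auto simp: mult_monom)

lemma monom_power_s0: "Polynomial.monom (1::'k) s0 ^ k = Polynomial.monom 1 (s0 * k)"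
  by (induction k) (auto simp: mult_monom)

text \<open>Each of the \<open>n\<close> vertices contributes the exponent \<open>s0\<close>, by its
  diagonal term or by a chosen arc, and each chosen arc subtracts its shift. A collection of cycles
  thus appears with exponent \<open>n * s0\<close> minus its winding number.\<close>

lemma det_transfer_mat:
  "\<exists>j. Determinant.det transfer_mat =
     Polynomial.monom 1 j * Polynomial.smult ((-1) ^ max_wind g N) (Q_poly g N)"
proof -
  let ?d = "max_wind g N"
  let ?w = "multicycle_wind g N"
  have exp: "s0 * (n - card (\<Union>Cs)) + (\<Sum>\<epsilon>\<in>\<Union>Cs. nat (int s0 - sft \<epsilon>)) = nat (int (n * s0) - ?w Cs)"
    and le: "?w Cs \<le> int (n * s0)"
    if Cs: "Cs \<in> quot.mcycles" for Cs
  proof -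
    have b: "quot.balanced (\<Union>Cs)" by (rule quot.balanced_Union_mcycle(1)[OF Cs])
    have sub: "\<Union>Cs \<subseteq> parcs" using b by (simp add: quot.balanced_def)
    have "card (\<Union>Cs) = card (tail quot ` \<Union>Cs)" using b by (simp add: quot.balanced_def card_image)
    also have "\<dots> \<le> card {0..<n}"
      using quot.balanced_tails_subset[OF b] by (intro card_mono) auto
    finally have c: "card (\<Union>Cs) \<le> n" by simp
    have nn: "0 \<le> int s0 - sft \<epsilon>" if "\<epsilon> \<in> \<Union>Cs" for \<epsilon> using sft_bound[of \<epsilon>] that sub by auto
    have "int (\<Sum>\<epsilon>\<in>\<Union>Cs. nat (int s0 - sft \<epsilon>)) = (\<Sum>\<epsilon>\<in>\<Union>Cs. int s0 - sft \<epsilon>)"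
      using nn by (simp add: of_nat_sum)
    also have "\<dots> = int (card (\<Union>Cs)) * int s0 - ?w Cs"
      by (simp add: sum_subtractf multicycle_wind_eq[OF Cs])
    finally have s: "int (\<Sum>\<epsilon>\<in>\<Union>Cs. nat (int s0 - sft \<epsilon>)) = int (card (\<Union>Cs)) * int s0 - ?w Cs" .
    have t: "int (s0 * (n - card (\<Union>Cs)) + (\<Sum>\<epsilon>\<in>\<Union>Cs. nat (int s0 - sft \<epsilon>))) = int (n * s0) - ?w Cs"
      unfolding of_nat_add s using c by (simp add: of_nat_diff algebra_simps)
    then show "s0 * (n - card (\<Union>Cs)) + (\<Sum>\<epsilon>\<in>\<Union>Cs. nat (int s0 - sft \<epsilon>)) = nat (int (n * s0) - ?w Cs)"
      using arg_cong[OF t, of nat] by (simp only: nat_int)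
    show "?w Cs \<le> int (n * s0)" using t by linarith
  qed
  \<comment> \<open>The maximal winding number is attained, as the empty collection exists, so the
    bound \<open>le\<close> applies to it and \<open>n * s0 - ?d\<close> is not truncated.\<close>
  have dn: "int ?d \<le> int (n * s0)"
  proof -
    have U: "(\<Union>r. multicycles g N r) = quot.mcycles" by (auto simp: multicycles_eq)
    have "{} \<in> quot.mcycles" by (simp add: quot.mcycles_def)
    then have "Max (?w ` quot.mcycles) \<in> ?w ` quot.mcycles" using finite_mcycles by (intro Max_in) auto
    then show ?thesis using le unfolding max_wind_def U by auto
  qed
  have M: "transfer_mat \<in> carrier_mat n n" by (simp add: transfer_mat_def)
  have "Determinant.det transfer_mat = (\<Sum>\<sigma> | \<sigma> permutes verts quot. of_int (sign \<sigma>) *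
       (\<Prod>x\<in>verts quot. (if \<sigma> x = x then Polynomial.monom 1 s0 else 0) -
         (\<Sum>\<epsilon> | \<epsilon> \<in> arcs quot \<and> tail quot \<epsilon> = x \<and> head quot \<epsilon> = \<sigma> x.
            Polynomial.monom (proj_wt N \<epsilon>) (nat (int s0 - sft \<epsilon>)))))"
    unfolding det_def'[OF M]
  proof (rule sum.cong)
    fix \<sigma> assume "\<sigma> \<in> {\<sigma>. \<sigma> permutes verts quot}"
    then have p: "\<sigma> permutes {0..<n}" by simp
    have "(\<Prod>i = 0..<n. transfer_mat $$ (i, \<sigma> i)) =
       (\<Prod>x\<in>{0..<n}. (if \<sigma> x = x then Polynomial.monom 1 s0 else 0) -
         (\<Sum>\<epsilon> | \<epsilon> \<in> arcs quot \<and> tail quot \<epsilon> = x \<and> head quot \<epsilon> = \<sigma> x.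
            Polynomial.monom (proj_wt N \<epsilon>) (nat (int s0 - sft \<epsilon>))))"
      using permutes_in_image[OF p] by (intro prod.cong) (auto simp: transfer_mat_def)
    then show "signof \<sigma> * (\<Prod>i = 0..<n. transfer_mat $$ (i, \<sigma> i)) = of_int (sign \<sigma>) *
       (\<Prod>x\<in>verts quot. (if \<sigma> x = x then Polynomial.monom 1 s0 else 0) -
         (\<Sum>\<epsilon> | \<epsilon> \<in> arcs quot \<and> tail quot \<epsilon> = x \<and> head quot \<epsilon> = \<sigma> x.
            Polynomial.monom (proj_wt N \<epsilon>) (nat (int s0 - sft \<epsilon>))))"
      by simp
  qed simp
  also have "\<dots> = (\<Sum>Cs\<in>quot.mcycles. (-1) ^ card Cs *
      (\<Prod>\<epsilon>\<in>\<Union>Cs. Polynomial.monom (proj_wt N \<epsilon>) (nat (int s0 - sft \<epsilon>))) *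
      Polynomial.monom 1 s0 ^ (card (verts quot) - card (\<Union>Cs)))"
    by (rule quot.det_sum_mcycles)
  also have "\<dots> = (\<Sum>Cs\<in>quot.mcycles. Polynomial.monom 1 (n * s0 - ?d) *
      Polynomial.smult ((-1) ^ card Cs) (Polynomial.monom (multicycle_wt N Cs) (nat (int ?d - ?w Cs))))"
  proof (rule sum.cong)
    fix Cs assume Cs: "Cs \<in> quot.mcycles"
    have fin: "finite (\<Union>Cs)" by (rule quot.balanced_finite[OF quot.balanced_Union_mcycle(1)[OF Cs]])
    have "(-1) ^ card Cs * P = Polynomial.smult ((-1) ^ card Cs) P" for P :: "'k poly"
      by (cases "even (card Cs)") auto
    moreover have "nat (int (n * s0) - ?w Cs) = n * s0 - ?d + nat (int ?d - ?w Cs)"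
      using dn multicycle_wind_le_max_wind[OF Cs] by linarith
    ultimately show "(-1) ^ card Cs * (\<Prod>\<epsilon>\<in>\<Union>Cs. Polynomial.monom (proj_wt N \<epsilon>) (nat (int s0 - sft \<epsilon>))) *
        Polynomial.monom 1 s0 ^ (card (verts quot) - card (\<Union>Cs)) =
        Polynomial.monom 1 (n * s0 - ?d) *
        Polynomial.smult ((-1) ^ card Cs) (Polynomial.monom (multicycle_wt N Cs) (nat (int ?d - ?w Cs)))"
      using exp[OF Cs]
      by (simp add: prod_monom[OF fin] monom_power_s0 mult_monom multicycle_wt_eq[OF Cs] add.commute)
  qed simp
  also have "\<dots> = Polynomial.monom 1 (n * s0 - ?d) * Polynomial.smult ((-1) ^ ?d) (Q_poly g N)"
    unfolding Q_poly_eq sum_distrib_left[symmetric] by (simp flip: power_add mult_2)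
  finally show ?thesis by blast
qed

end

section \<open>Path generating functions\<close>

lemma act_monom_coeff: "act (Polynomial.monom c k) f n = c * f (n + k)"
  using act_smult[of c "Polynomial.monom 1 k" f n] act_monom[of k f n] by (simp add: smult_monom)

lemma act_diff: "act (P - Q) f n = act P f n - act Q f n"
  using act_add[of "P - Q" Q f n] by simp

lemma act_map_to_ac: "act (map_poly to_ac P) (\<lambda>n. to_ac (f n)) n = to_ac (act P f n)"
  by (subst act_eq[OF map_poly_degree_leq]) (simp_all add: act_def coeff_map_poly to_ac_sum)

interpretation map_to_ac: comm_ring_hom "map_poly (to_ac :: 'a::field \<Rightarrow> 'a alg_closure)"
  by unfold_locales (auto intro!: poly_eqI simp: coeff_map_poly coeff_mult to_ac_sum map_poly_1)

lemma prod_list_map_concat: "prod_list (map w (concat ps)) = (\<Prod>i<length ps. prod_list (map w (ps ! i)))"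
  for w :: "'a \<Rightarrow> 'b::comm_monoid_mult"
proof (induction ps)
  case (Cons p ps)
  show ?case by (simp add: Cons.IH prod.lessThan_Suc_shift del: prod.lessThan_Suc)
qed simp

lemma finite_walks_bounded:
  assumes "\<And>x. x \<in> verts G \<Longrightarrow> finite (out_arcs G x)" and "wf_digraph G"
  shows "finite {p. (\<exists>y. pre_digraph.awalk G x p y) \<and> length p \<le> L}"
proof (induction L arbitrary: x)
  case 0
  show ?case by (rule finite_subset[of _ "{[]}"]) auto
next
  case (Suc L)
  interpret wf_digraph G by fact
  show ?case
  proof (cases "x \<in> verts G")
    case True
    have "{p. (\<exists>y. awalk x p y) \<and> length p \<le> Suc L} \<subseteq>
        insert [] (\<Union>e\<in>out_arcs G x. (#) e ` {p. (\<exists>y. awalk (head G e) p y) \<and> length p \<le> L})"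
    proof
      fix p assume "p \<in> {p. (\<exists>y. awalk x p y) \<and> length p \<le> Suc L}"
      then obtain y where p: "awalk x p y" "length p \<le> Suc L" by blast
      then show "p \<in> insert [] (\<Union>e\<in>out_arcs G x. (#) e ` {p. (\<exists>y. awalk (head G e) p y) \<and> length p \<le> L})"
      proof (cases p)
        case (Cons e q)
        then have "e \<in> out_arcs G x" "q \<in> {p. (\<exists>y. awalk (head G e) p y) \<and> length p \<le> L}"
          using p by (auto simp: awalk_Cons_iff)
        then show ?thesis unfolding Cons by blast
      qed simp
    qed
    moreover have "finite (insert [] (\<Union>e\<in>out_arcs G x. (#) e ` {p. (\<exists>y. awalk (head G e) p y) \<and> length p \<le> L}))"
      using assms(1)[OF True] Suc.IH by blast
    ultimately show ?thesis by (rule finite_subset)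
  next
    case False
    then have "{p. (\<exists>y. awalk x p y) \<and> length p \<le> Suc L} = {}" by (auto simp: awalk_def)
    then show ?thesis by (simp only: finite.emptyI)
  qed
qed

context cylinder
begin

section \<open>Finiteness of the walks between two vertices\<close>

lemma awalk_esh: "cov.awalk x p y \<Longrightarrow> cov.awalk (sh l x) (map (esh l) p) (sh l y)"
  by (induction p arbitrary: x) (auto simp: cov.awalk_Nil_iff cov.awalk_Cons_iff)

lemma walk_shift_lower_bound:
  assumes "cov.awalk x p y"
  shows "lev y - lev x \<ge> - (int s0 * int (length p))"
  using assms
proof (induction p arbitrary: x)
  case Nil
  then show ?case by (simp add: cov.awalk_Nil_iff)
next
  case (Cons e p)
  then have e: "e \<in> edges N" "fst e = x" "cov.awalk (snd e) p y" by (auto simp: cov.awalk_Cons_iff)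
  have "\<bar>lev (snd e) - lev x\<bar> \<le> int s0"
    using sft_bound[of "shift_orbit (g, g) e"] e by (simp add: sft_orbit)
  then show ?case using Cons.IH[OF e(3)] by (simp add: algebra_simps)
qed

text \<open>
  A walk that meets an orbit twice contains a piece projecting to a closed walk, which has positive
  shift; cutting it out and shifting the rest back makes the walk shorter.
\<close>

lemma walk_length_bound:
  assumes "cov.awalk x p y"
  shows "int (length p) \<le> int n * (lev y - lev x) + int (n + n * n * s0)"
  using assms
proof (induction "length p" arbitrary: p y rule: less_induct)
  case less
  show ?case
  proof (cases "length p < n")
    case True
    \<comment> \<open>A short walk may lead backwards, but by at most \<open>s0\<close> periods per
      step; the constant \<open>n * n * s0\<close> in the bound absorbs this.\<close>
    have "int n * - (int s0 * int n) \<le> int n * (lev y - lev x)"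
    proof (rule mult_left_mono)
      have "int s0 * int (length p) \<le> int s0 * int n" using True by (intro mult_left_mono) auto
      then show "- (int s0 * int n) \<le> lev y - lev x" using walk_shift_lower_bound[OF less.prems] by linarith
    qed simp
    then show ?thesis using True by (simp add: algebra_simps)
  next
    case False
    define z where "z k = cov.awlast x (take k p)" for k
    have split: "cov.awalk x (take k p) (z k)" "cov.awalk (z k) (drop k p) y" for k
      using less.prems append_take_drop_id[of k p] unfolding z_def by (metis cov.awalk_append_iff)+
    have dom: "(\<lambda>k. base (z k)) ` {0..n} \<subseteq> domain"
    proof (rule image_subsetI)
      fix k
      have "z k \<in> vertices N" using cov.awalk_last_in_verts[OF split(1)[of k]] by simp
      then show "base (z k) \<in> domain" by (rule base_domain)
    qed
    \<comment> \<open>The first \<open>n + 1\<close> positions visit at most \<open>n\<close>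
      orbits.\<close>
    have "\<not> inj_on (\<lambda>k. base (z k)) {0..n}"
    proof
      assume "inj_on (\<lambda>k. base (z k)) {0..n}"
      from card_inj_on_le[OF this dom finite_domain] show False by (simp add: n_def)
    qed
    then obtain i j where ij: "i < j" "j \<le> n" "base (z i) = base (z j)"
      unfolding inj_on_def by (metis atLeastAtMost_iff linorder_neqE_nat)
    define q where "q = take (j - i) (drop i p)"
    have tj: "take j p = take i p @ q" using ij(1) take_add[of i "j - i" p] by (simp add: q_def)
    have len_q: "length q = j - i" using ij False by (simp add: q_def)
    have "cov.awlast x (take i p) = z i" by (simp add: z_def)
    then have q: "cov.awalk (z i) q (z j)"
      using split(1)[of j] unfolding tj z_def by simp
    define l where "l = lev (z j) - lev (z i)"
    have zj: "z j = sh l (z i)"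
      using ij(3) by (metis l_def sh_lev_base sh_sh diff_add_cancel)
    have "q \<noteq> []" using len_q ij(1) by auto
    then have l: "l > 0" using awalk_sh_pos[of "z i" q l] q zj by simp
    have "cov.awalk (z i) (map (esh (- l)) (drop j p)) (sh (- l) y)"
      using awalk_esh[OF split(2)[of j], of "- l"] zj by simp
    from cov.awalk_appendI[OF split(1)[of i] this]
    have w: "cov.awalk x (take i p @ map (esh (- l)) (drop j p)) (sh (- l) y)" .
    have len: "length (take i p @ map (esh (- l)) (drop j p)) = length p - (j - i)"
      using ij False by simp
    have "int (length p - (j - i)) \<le> int n * (lev (sh (- l) y) - lev x) + int (n + n * n * s0)"
    proof -
      have "length p - (j - i) < length p" using ij False by linarith
      from less.hyps[OF _ w, unfolded len, OF this] show ?thesis .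
    qed
    \<comment> \<open>The cut removes at most \<open>n\<close> steps and at least one period, which
      is why the slope \<open>n\<close> suffices.\<close>
    moreover have "int n * 1 \<le> int n * l" using l by (intro mult_left_mono) auto
    moreover have "int (length p - (j - i)) = int (length p) - (int j - int i)"
      using ij False by (simp add: of_nat_diff)
    moreover have "int n * (lev (sh (- l) y) - lev x) = int n * (lev y - lev x) - int n * l"
      by (simp add: algebra_simps)
    ultimately show ?thesis using ij(1,2) by linarith
  qed
qed

lemma finite_walks: "finite {p. cov.awalk x p y}"
proof (rule finite_subset)
  let ?L = "nat (int n * (lev y - lev x) + int (n + n * n * s0))"
  show "{p. cov.awalk x p y} \<subseteq> {p. (\<exists>y. cov.awalk x p y) \<and> length p \<le> ?L}"
  proof
    fix p assume "p \<in> {p. cov.awalk x p y}"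
    then have p: "cov.awalk x p y" by simp
    then have "length p \<le> ?L" using walk_length_bound[OF p] by linarith
    then show "p \<in> {p. (\<exists>y. cov.awalk x p y) \<and> length p \<le> ?L}" using p by blast
  qed
  show "finite {p. (\<exists>y. cov.awalk x p y) \<and> length p \<le> ?L}"
    by (rule finite_walks_bounded[OF _ cov.wf_digraph]) (simp add: out_arcs_def finite_out)
qed

section \<open>The recurrence of the path generating functions\<close>

definition gf :: "point \<Rightarrow> point \<Rightarrow> 'k" where
  "gf = cov.path_gf (wt N)"

lemma gf_sh: "gf (sh l x) (sh l y) = gf x y"
proof -
  have "prod_list (map (wt N) (map (esh l) p)) = prod_list (map (wt N) p)" if "cov.awalk x p y" for p
  proof -
    have "map (wt N) (map (esh l) p) = map (wt N) p"
      using that by (auto simp: wt_esh cov.awalk_def)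
    then show ?thesis by (simp only:)
  qed
  then have "(\<Sum>p | cov.awalk x p y. prod_list (map (wt N) p)) =
      (\<Sum>p | cov.awalk (sh l x) p (sh l y). prod_list (map (wt N) p))"
    using awalk_esh[of x _ y l] awalk_esh[of "sh l x" _ "sh l y" "- l"]
    by (intro sum.reindex_bij_witness[where i = "map (esh (- l))" and j = "map (esh l)"]) (auto simp: o_def)
  then show ?thesis by (simp add: gf_def cov.path_gf_def)
qed

lemma gf_first_step:
  assumes x: "x \<in> vertices N"
  shows "gf x y = (if x = y then 1 else 0) + (\<Sum>e | e \<in> edges N \<and> fst e = x. wt N e * gf (snd e) y)"
proof -
  let ?out = "{e \<in> edges N. fst e = x}" and ?W = "\<lambda>x. {p. cov.awalk x p y}"
  let ?f = "\<lambda>p. prod_list (map (wt N) p)"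
  have W: "?W x = (if x = y then {[]} else {}) \<union> (\<Union>e\<in>?out. (#) e ` ?W (snd e))" (is "_ = ?N \<union> ?U")
  proof (intro equalityI subsetI)
    fix p assume "p \<in> ?W x"
    then have p: "cov.awalk x p y" by simp
    show "p \<in> ?N \<union> ?U"
    proof (cases p)
      case (Cons e q)
      then have "e \<in> ?out" "q \<in> ?W (snd e)" using p by (simp_all add: cov.awalk_Cons_iff)
      then show ?thesis unfolding Cons by blast
    qed (use p in \<open>simp add: cov.awalk_Nil_iff\<close>)
  next
    fix p assume "p \<in> ?N \<union> ?U"
    then show "p \<in> ?W x"
      using x by (auto simp: cov.awalk_Nil_iff cov.awalk_Cons_iff split: if_splits)
  qed
  have "gf x y = sum ?f ?N + sum ?f ?U"
    unfolding gf_def cov.path_gf_def W using finite_out[OF x] finite_walks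
    by (intro sum.union_disjoint) auto
  also have "sum ?f ?U = (\<Sum>e\<in>?out. sum ?f ((#) e ` ?W (snd e)))"
    using finite_out[OF x] finite_walks by (intro sum.UNION_disjoint) auto
  also have "\<dots> = (\<Sum>e\<in>?out. wt N e * gf (snd e) y)"
    by (intro sum.cong refl) (simp add: sum.reindex gf_def cov.path_gf_def sum_distrib_left)
  finally show ?thesis by simp
qed

text \<open>After the first edge the rest of the walk is translated back so that it starts in the
  fundamental domain; this moves the end point by minus the shift of the arc.\<close>

lemma gf_recurrence:
  assumes a: "a < n"
  shows "gf (\<rho> a) y = (if \<rho> a = y then 1 else 0) +
    (\<Sum>\<epsilon> | \<epsilon> \<in> parcs \<and> tail quot \<epsilon> = a. proj_wt N \<epsilon> * gf (\<rho> (head quot \<epsilon>)) (sh (- sft \<epsilon>) y))"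
proof -
  have bij: "bij_betw (shift_orbit (g, g)) {e \<in> edges N. fst e = \<rho> a} {\<epsilon> \<in> parcs. tail quot \<epsilon> = a}"
    unfolding bij_betw_def
  proof (intro conjI inj_onI equalityI subsetI)
    fix e f assume e: "e \<in> {e \<in> edges N. fst e = \<rho> a}" and f: "f \<in> {e \<in> edges N. fst e = \<rho> a}"
      and eq: "shift_orbit (g, g) e = shift_orbit (g, g) f"
    have "e \<in> shift_orbit (g, g) e"
      using rangeI[of "\<lambda>l. esh l e" 0] by (simp add: shift_orbit_edge)
    then have "e \<in> shift_orbit (g, g) f" by (simp only: eq)
    then obtain l where l: "e = esh l f" by (auto simp: shift_orbit_edge)
    then have "sh l (\<rho> a) = sh 0 (\<rho> a)" using e f by simp
    then show "e = f" using l unfolding sh_eq_iff by simp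
  next
    fix \<epsilon> assume "\<epsilon> \<in> shift_orbit (g, g) ` {e \<in> edges N. fst e = \<rho> a}"
    then show "\<epsilon> \<in> {\<epsilon> \<in> parcs. tail quot \<epsilon> = a}" using idx_rho[OF a] by (auto simp: fst_shift_orbit)
  next
    fix \<epsilon> assume "\<epsilon> \<in> {\<epsilon> \<in> parcs. tail quot \<epsilon> = a}"
    then obtain e where e: "e \<in> edges N" "\<epsilon> = shift_orbit (g, g) e" and "idx (fst e) = a"
      by (auto simp: fst_shift_orbit)
    then have "base (fst e) = \<rho> a" using rho_idx edge_ends by metis
    then have "esh (- lev (fst e)) e \<in> {e \<in> edges N. fst e = \<rho> a}" using e by (simp add: base_def)
    moreover have "\<epsilon> = shift_orbit (g, g) (esh (- lev (fst e)) e)" using e by (simp add: shift_orbit_esh)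
    ultimately show "\<epsilon> \<in> shift_orbit (g, g) ` {e \<in> edges N. fst e = \<rho> a}" by blast
  qed
  have "wt N e * gf (snd e) y = proj_wt N (shift_orbit (g, g) e) *
      gf (\<rho> (head quot (shift_orbit (g, g) e))) (sh (- sft (shift_orbit (g, g) e)) y)"
    if e: "e \<in> edges N" "fst e = \<rho> a" for e
  proof -
    have "gf (snd e) y = gf (sh (lev (snd e)) (base (snd e))) (sh (lev (snd e)) (sh (- lev (snd e)) y))" by simp
    also have "\<dots> = gf (base (snd e)) (sh (- lev (snd e)) y)" by (rule gf_sh)
    finally show ?thesis
      using e lev_rho[OF a] rho_idx[of "snd e"] edge_ends[OF e(1)]
      by (simp add: proj_wt_orbit snd_shift_orbit sft_orbit)
  qed
  then have "(\<Sum>e | e \<in> edges N \<and> fst e = \<rho> a. wt N e * gf (snd e) y) =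
      (\<Sum>e\<in>{e \<in> edges N. fst e = \<rho> a}. proj_wt N (shift_orbit (g, g) e) *
        gf (\<rho> (head quot (shift_orbit (g, g) e))) (sh (- sft (shift_orbit (g, g) e)) y))"
    by (intro sum.cong) auto
  also have "\<dots> = (\<Sum>\<epsilon>\<in>{\<epsilon> \<in> parcs. tail quot \<epsilon> = a}.
      proj_wt N \<epsilon> * gf (\<rho> (head quot \<epsilon>)) (sh (- sft \<epsilon>) y))"
    by (rule sum.reindex_bij_betw[OF bij])
  finally show ?thesis unfolding gf_first_step[OF rho_vertices[OF a]] by simp
qed

text \<open>The first-step recurrence, read at time \<open>t + s0\<close>. The bound on
  \<open>T\<close> keeps the end point at a positive level, so it is never the start vertex
  \<open>\<rho> a\<close> and the inhomogeneous term from the empty walk is zero.\<close>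

lemma transfer_mat_annihilates:
  assumes a: "a < n" and T: "lev y + T + int s0 > 0"
  shows "(\<Sum>b<n. act (transfer_mat $$ (a, b)) (\<lambda>t. gf (\<rho> b) (sh (int t + T) y)) t) = 0"
proof -
  let ?Y = "\<lambda>b t. gf (\<rho> b) (sh (int t + T) y)"
  let ?S = "\<lambda>b. {\<epsilon> \<in> parcs. tail quot \<epsilon> = a \<and> head quot \<epsilon> = b}"
  have entry: "act (transfer_mat $$ (a, b)) (?Y b) t =
      (if b = a then ?Y a (t + s0) else 0) - (\<Sum>\<epsilon>\<in>?S b. proj_wt N \<epsilon> * gf (\<rho> (head quot \<epsilon>)) (sh (- sft \<epsilon>) (sh (int (t + s0) + T) y)))"
    if b: "b < n" for b
  proof -
    have "act (Polynomial.monom (proj_wt N \<epsilon>) (nat (int s0 - sft \<epsilon>))) (?Y b) t =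
        proj_wt N \<epsilon> * gf (\<rho> (head quot \<epsilon>)) (sh (- sft \<epsilon>) (sh (int (t + s0) + T) y))"
      if "\<epsilon> \<in> ?S b" for \<epsilon>
    proof -
      have "0 \<le> int s0 - sft \<epsilon>" using sft_bound[of \<epsilon>] that by auto
      then have eq: "int (t + nat (int s0 - sft \<epsilon>)) + T = - sft \<epsilon> + (int (t + s0) + T)" by simp
      show ?thesis using that unfolding act_monom_coeff sh_sh eq by simp
    qed
    then have "act (\<Sum>\<epsilon>\<in>?S b. Polynomial.monom (proj_wt N \<epsilon>) (nat (int s0 - sft \<epsilon>))) (?Y b) t =
        (\<Sum>\<epsilon>\<in>?S b. proj_wt N \<epsilon> * gf (\<rho> (head quot \<epsilon>)) (sh (- sft \<epsilon>) (sh (int (t + s0) + T) y)))"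
      unfolding act_sum by (intro sum.cong) auto
    then show ?thesis
      using a b by (simp add: transfer_mat_def act_diff act_monom_coeff)
  qed
  have "(\<Sum>b<n. act (transfer_mat $$ (a, b)) (?Y b) t) =
      (\<Sum>b<n. if b = a then ?Y a (t + s0) else 0) -
      (\<Sum>b<n. \<Sum>\<epsilon>\<in>?S b. proj_wt N \<epsilon> * gf (\<rho> (head quot \<epsilon>)) (sh (- sft \<epsilon>) (sh (int (t + s0) + T) y)))"
    unfolding sum_subtractf[symmetric] using entry by (intro sum.cong) auto
  also have "(\<Sum>b<n. if b = a then ?Y a (t + s0) else 0) = ?Y a (t + s0)" using a by simp
  also have "(\<Sum>b<n. \<Sum>\<epsilon>\<in>?S b. proj_wt N \<epsilon> * gf (\<rho> (head quot \<epsilon>)) (sh (- sft \<epsilon>) (sh (int (t + s0) + T) y))) =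
      (\<Sum>\<epsilon>\<in>{\<epsilon> \<in> parcs. tail quot \<epsilon> = a}. proj_wt N \<epsilon> * gf (\<rho> (head quot \<epsilon>)) (sh (- sft \<epsilon>) (sh (int (t + s0) + T) y)))"
  proof -
    have S: "?S b = {\<epsilon> \<in> {\<epsilon> \<in> parcs. tail quot \<epsilon> = a}. head quot \<epsilon> = b}" for b by auto
    show ?thesis unfolding S
    proof (rule sum.group)
      show "head quot ` {\<epsilon> \<in> parcs. tail quot \<epsilon> = a} \<subseteq> {..<n}"
        using quot.head_in_verts by (auto simp del: quot.head_in_verts)
    qed (use finite_parcs in auto)
  qed
  also have "?Y a (t + s0) - \<dots> = (if \<rho> a = sh (int (t + s0) + T) y then 1 else 0)"
    using gf_recurrence[OF a, of "sh (int (t + s0) + T) y"] by simp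
  also have "\<dots> = 0"
  proof -
    have "lev (sh (int (t + s0) + T) y) \<noteq> 0" using T by simp
    then show ?thesis using lev_rho[OF a] by metis
  qed
  finally show ?thesis .
qed

abbreviation ac_mat :: "'k alg_closure poly mat" where
  "ac_mat \<equiv> map_mat (map_poly to_ac) transfer_mat"

text \<open>One column of the path matrix: the end point is fixed and moves with the time, the
  coordinates are the start vertices in the fundamental domain. \<open>T\<close> moves the origin of
  time past the inhomogeneous terms.\<close>

definition gf_seq :: "int \<Rightarrow> point \<Rightarrow> 'k alg_closure vseq" where
  "gf_seq T y = (\<lambda>b t. if b < n then to_ac (gf (\<rho> b) (sh (int t + T) y)) else 0)"

lemma gf_seq_solution:
  assumes "lev y + T + int s0 > 0"
  shows "gf_seq T y \<in> solutions n ac_mat"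
proof -
  have "(\<Sum>b<n. act (ac_mat $$ (a, b)) (gf_seq T y b) t) = 0" if a: "a < n" for a t
  proof -
    have "(\<Sum>b<n. act (ac_mat $$ (a, b)) (gf_seq T y b) t) =
        to_ac (\<Sum>b<n. act (transfer_mat $$ (a, b)) (\<lambda>t. gf (\<rho> b) (sh (int t + T) y)) t)"
      unfolding to_ac_sum act_map_to_ac[symmetric]
      using a by (intro sum.cong) (auto simp: gf_seq_def transfer_mat_def)
    then show ?thesis using transfer_mat_annihilates[OF a assms] by simp
  qed
  then show ?thesis by (simp add: solutions_def gf_seq_def)
qed

section \<open>The signed path sum as a determinant\<close>

lemma path_sum_eq:
  assumes \<sigma>: "\<sigma> permutes {..<r}" and u: "length u = r" and v: "length v = r"
  shows "path_sum N u (permute_list \<sigma> v) =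
    (\<Sum>P | P \<in> path_tuples.tuples (cover N) r ((!) u) ((!) v) \<sigma> \<and>
           path_tuples.disjoint_tuple (cover N) r ((!) u) P. \<Prod>i<r. prod_list (map (wt N) (P i)))"
proof -
  interpret pt: path_tuples "cover N" r "(!) u" "(!) v" ..
  have nth: "permute_list \<sigma> v ! i = v ! \<sigma> i" if "i < r" for i
    using that v \<sigma> by (intro permute_list_nth) auto
  show ?thesis
    unfolding path_sum_def
  proof (rule sum.reindex_bij_witness[where i = "\<lambda>P. map P [0..<r]" and j = "\<lambda>ps. \<lambda>i\<in>{..<r}. ps ! i"])
    fix ps assume ps: "ps \<in> r_paths N u (permute_list \<sigma> v)"
    then show "map (\<lambda>i\<in>{..<r}. ps ! i) [0..<r] = ps"
      using u by (intro nth_equalityI) (auto simp: r_paths_def)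
    show "(\<lambda>i\<in>{..<r}. ps ! i) \<in> {P. P \<in> pt.tuples \<sigma> \<and> pt.disjoint_tuple P}"
      using ps u nth by (auto simp: r_paths_def pt.tuples_def pt.disjoint_tuple_def pt.vs_def disjnt_def)
    show "(\<Prod>i<r. prod_list (map (wt N) ((\<lambda>i\<in>{..<r}. ps ! i) i))) = prod_list (map (wt N) (concat ps))"
      using ps u by (auto simp: prod_list_map_concat r_paths_def)
  next
    fix P assume P: "P \<in> {P. P \<in> pt.tuples \<sigma> \<and> pt.disjoint_tuple P}"
    then show "(\<lambda>i\<in>{..<r}. map P [0..<r] ! i) = P"
      by (auto simp: pt.tuples_def PiE_def extensional_def fun_eq_iff)
    show "map P [0..<r] \<in> r_paths N u (permute_list \<sigma> v)"
      using P u nth by (auto simp: r_paths_def pt.tuples_def pt.disjoint_tuple_def pt.vs_def disjnt_def PiE_def Pi_def)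
  qed
qed

lemma signed_path_sum_eq_det:
  assumes u: "length u = r" and v: "length v = r"
  shows "signed_path_sum g N r u v l =
    (\<Sum>\<sigma> | \<sigma> permutes {..<r}. of_int (sign \<sigma>) * (\<Prod>i<r. gf (u ! i) (sh (int l) (v ! \<sigma> i))))"
proof -
  let ?v = "map (\<lambda>x. x + of_nat l *\<^sub>R g) v"
  interpret pt: path_tuples "cover N" r "(!) u" "(!) ?v" ..
  have "signed_path_sum g N r u v l = (\<Sum>\<sigma> | \<sigma> permutes {..<r}. of_int (sign \<sigma>) *
      (\<Sum>P | P \<in> pt.tuples \<sigma> \<and> pt.disjoint_tuple P. \<Prod>i<r. prod_list (map (wt N) (P i))))"
    unfolding signed_path_sum_def using path_sum_eq[OF _ u, of _ ?v] v by (intro sum.cong) auto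
  also have "\<dots> = (\<Sum>\<sigma> | \<sigma> permutes {..<r}. of_int (sign \<sigma>) * (\<Prod>i<r. gf (u ! i) (?v ! \<sigma> i)))"
    unfolding gf_def by (rule pt.lindstroem_gessel_viennot) (rule finite_walks)
  also have "\<dots> = (\<Sum>\<sigma> | \<sigma> permutes {..<r}. of_int (sign \<sigma>) * (\<Prod>i<r. gf (u ! i) (sh (int l) (v ! \<sigma> i))))"
  proof (intro sum.cong refl arg_cong2[where f = "(*)"] prod.cong)
    fix \<sigma> i assume "\<sigma> \<in> {\<sigma>. \<sigma> permutes {..<r}}" "i \<in> {..<r}"
    then have "\<sigma> i < length v" using v permutes_in_image[of \<sigma> "{..<r}" i] by auto
    then show "gf (u ! i) (?v ! \<sigma> i) = gf (u ! i) (sh (int l) (v ! \<sigma> i))" by (simp add: sh_def)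
  qed
  finally show ?thesis .
qed

lemma signed_path_sum_annihilated:
  assumes u: "length u = r" "set u \<subseteq> vertices N" and v: "length v = r"
    and \<gamma>: "Q_roots g N \<gamma>"
  shows "\<exists>t0. \<forall>t\<ge>t0. act (Q_e (max_wind g N) \<gamma> r) (\<lambda>l. to_ac (signed_path_sum g N r u v l)) t = 0"
proof -
  let ?d = "max_wind g N"
  let ?f = "\<lambda>l. to_ac (signed_path_sum g N r u v l)"
  \<comment> \<open>Large enough that every end point, moved by \<open>T\<close> periods, has
    positive level.\<close>
  define T where "T = (\<Sum>y\<leftarrow>v. \<bar>lev y\<bar>) + 1"
  have T: "lev y + T + int s0 > 0" if "y \<in> set v" for y
  proof -
    have "\<bar>lev y\<bar> \<le> (\<Sum>y\<leftarrow>v. \<bar>lev y\<bar>)" using that by (intro member_le_sum_list) auto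
    then show ?thesis by (simp add: T_def)
  qed
  \<comment> \<open>Large enough that the time offsets \<open>s i\<close> below are not truncated at
    zero.\<close>
  define l0 where "l0 = nat ((\<Sum>x\<leftarrow>u. \<bar>lev x\<bar>) + T)"
  have l0: "0 \<le> int l0 - lev (u ! i) - T" if "i < r" for i
  proof -
    have "\<bar>lev (u ! i)\<bar> \<le> (\<Sum>x\<leftarrow>u. \<bar>lev x\<bar>)" using that u by (intro member_le_sum_list) auto
    moreover have "0 \<le> (\<Sum>y\<leftarrow>v. \<bar>lev y\<bar>)" by (intro sum_list_nonneg) auto
    ultimately show ?thesis unfolding l0_def T_def by linarith
  qed
  \<comment> \<open>Translating the start vertex \<open>u ! i\<close> into the fundamental domain
    turns its level into a time offset of row \<open>i\<close>; this is the form required by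
    \<open>alternating_family_det\<close>.\<close>
  define a where "a i = idx (u ! i)" for i
  define s where "s i = nat (int l0 - lev (u ! i) - T)" for i
  define xs where "xs = map (gf_seq T) v"
  let ?F = "\<lambda>xs t. \<Sum>\<sigma> | \<sigma> permutes {..<r}. of_int (sign \<sigma>) * (\<Prod>i<r. (xs ! \<sigma> i) (a i) (s i + t)) :: 'k alg_closure"
  have F: "?F xs t = ?f (t + l0)" for t
  proof -
    have "(xs ! \<sigma> i) (a i) (s i + t) = to_ac (gf (u ! i) (sh (int (t + l0)) (v ! \<sigma> i)))"
      if "\<sigma> permutes {..<r}" "i < r" for \<sigma> i
    proof -
      have j: "\<sigma> i < length v" using that v permutes_in_image[of \<sigma> "{..<r}" i] by auto
      have ui: "u ! i \<in> vertices N" using that u by auto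
      have "gf (u ! i) (sh (int (t + l0)) (v ! \<sigma> i)) =
          gf (sh (lev (u ! i)) (base (u ! i))) (sh (lev (u ! i)) (sh (int (t + l0) - lev (u ! i)) (v ! \<sigma> i)))"
        by simp
      also have "\<dots> = gf (base (u ! i)) (sh (int (t + l0) - lev (u ! i)) (v ! \<sigma> i))" by (rule gf_sh)
      also have "int (t + l0) - lev (u ! i) = int (s i + t) + T"
        using l0[OF that(2)] by (simp add: s_def)
      finally show ?thesis using j ui by (simp add: xs_def gf_seq_def a_def idx_less rho_idx)
    qed
    then show ?thesis
      unfolding signed_path_sum_eq_det[OF u(1) v] by (simp add: to_ac_sum to_ac_prod)
  qed
  obtain j where j: "Determinant.det transfer_mat = Polynomial.monom 1 j * Polynomial.smult ((-1) ^ ?d) (Q_poly g N)"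
    using det_transfer_mat by blast
  \<comment> \<open>The power of t in the determinant supplies \<open>j\<close> zero
    eigenvalues.\<close>
  let ?ls = "replicate j 0 @ map \<gamma> [1..<Suc ?d]"
  have M: "ac_mat \<in> carrier_mat n n" by (simp add: transfer_mat_def)
  have "Determinant.det ac_mat = map_poly to_ac (Determinant.det transfer_mat)" by simp
  also have "\<dots> = Polynomial.monom 1 j * Polynomial.smult ((-1) ^ ?d) (map_poly to_ac (Q_poly g N))"
    unfolding j by (simp add: map_to_ac.hom_mult map_poly_monom map_poly_smult)
  also have "\<dots> = Polynomial.monom 1 j * (\<Prod>i = 1..?d. [:- \<gamma> i, 1:])"
    using \<gamma> unfolding Q_roots_def by (simp flip: power_mult_distrib)
  also have "\<dots> = Polynomial.smult 1 (\<Prod>l\<leftarrow>?ls. [:- l, 1:])"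
  proof -
    have "(\<Prod>i = 1..?d. [:- \<gamma> i, 1:]) = (\<Prod>i\<leftarrow>[1..<Suc ?d]. [:- \<gamma> i, 1:])"
      using prod.distinct_set_conv_list[of "[1..<Suc ?d]" "\<lambda>i. [:- \<gamma> i, 1:]"]
      by (simp only: set_upt distinct_upt atLeastLessThanSuc_atLeastAtMost)
    moreover have "Polynomial.monom 1 j = [:0, 1 :: 'k alg_closure:] ^ j" by (simp add: monom_altdef)
    ultimately show ?thesis by (simp add: o_def del: upt_Suc)
  qed
  finally have "shift_flag (solutions n ac_mat) ?ls" by (rule shift_flag_solutions[OF M]) simp
  then have "act (exterior_poly 1 ?ls r) (?F xs) = (\<lambda>t. 0)"
    using T v by (intro exterior_poly_annihilates alternating_family_det) (auto simp: xs_def gf_seq_solution)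
  moreover obtain k where "exterior_poly 1 ?ls r = Polynomial.monom 1 k * Q_e ?d \<gamma> r"
    using exterior_poly_zeros[of 1 j "map \<gamma> [1..<Suc ?d]" r] unfolding exterior_poly_eq_Q_e by blast
  moreover have "?F xs = (\<lambda>t. ?f (t + l0))" by (rule ext) (rule F)
  ultimately have "act (Polynomial.monom 1 k * Q_e ?d \<gamma> r) (\<lambda>t. ?f (t + l0)) = (\<lambda>t. 0)" by (simp only:)
  \<comment> \<open>The monomial acts as a shift by \<open>k\<close>, so it only raises the
    threshold of the recurrence.\<close>
  then have *: "act (Q_e ?d \<gamma> r) (\<lambda>t. ?f (t + l0)) (t + k) = 0" for t
    unfolding act_mult by (metis act_monom)
  have "act (Q_e ?d \<gamma> r) ?f t = 0" if "t \<ge> k + l0" for t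
  proof -
    obtain t' where "t = t' + k + l0" using \<open>t \<ge> k + l0\<close> by (metis add.assoc add.commute le_Suc_ex)
    then show ?thesis using *[of t'] by (simp add: act_def add_ac)
  qed
  then show ?thesis by blast
qed

end

text \<open>The cofactor acts on a sequence that is zero from \<open>t0\<close> on and looks only
  forward, so the threshold survives multiplication.\<close>

lemma linear_recurrence_of_dvd:
  fixes f :: "nat \<Rightarrow> 'k::field"
  assumes t0: "\<And>t. t \<ge> t0 \<Longrightarrow> act E (\<lambda>l. to_ac (f l)) t = 0"
    and P: "E dvd P" "Polynomial.lead_coeff P = 1" "\<And>i. Polynomial.coeff P i \<in> range to_ac"
  shows "\<exists>Q. map_poly to_ac Q = P \<and> linear_recurrence f Q"
proof (intro exI conjI)
  let ?Q = "map_poly of_ac P"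
  \<comment> \<open>Needed for \<open>map_poly\<close> to act coefficientwise, also beyond the
    degree.\<close>
  have "of_ac 0 = (0 :: 'k)" by (rule of_ac_eqI) simp
  then have co: "to_ac (Polynomial.coeff ?Q i) = Polynomial.coeff P i" for i
    using P(3)[of i] by (simp add: coeff_map_poly to_ac_of_ac)
  then show Q: "map_poly to_ac ?Q = P" by (intro poly_eqI) (simp add: coeff_map_poly)
  have "Polynomial.degree (map_poly to_ac ?Q) = Polynomial.degree ?Q" by (rule degree_map_poly) simp
  then have "Polynomial.degree P = Polynomial.degree ?Q" by (simp only: Q)
  then have "to_ac (Polynomial.lead_coeff ?Q) = 1" using co P(2) by metis
  moreover have "{n. act ?Q f n \<noteq> 0} \<subseteq> {..<t0}"
  proof
    fix t assume "t \<in> {n. act ?Q f n \<noteq> 0}"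
    then have "act P (\<lambda>l. to_ac (f l)) t \<noteq> 0" using act_map_to_ac[of ?Q f t] by (simp add: Q)
    moreover obtain R where "P = R * E" using P(1) by (metis dvdE mult.commute)
    then have "act P (\<lambda>l. to_ac (f l)) t = act R (act E (\<lambda>l. to_ac (f l))) t" by (simp add: act_mult)
    moreover have "act R (act E (\<lambda>l. to_ac (f l))) t = 0" if "t \<ge> t0"
      using that t0 by (simp add: act_def[of R])
    ultimately show "t \<in> {..<t0}" by (metis lessThan_iff not_le)
  qed
  ultimately show "linear_recurrence f ?Q"
    unfolding linear_recurrence_def act_def[symmetric] by (simp add: finite_subset)
qed

theorem theorem2p3:
  fixes A B m :: real and g :: point
    and N :: "'k::field_char_0 network"
    and r :: nat and u v :: "point list"
    and \<gamma> :: "nat \<Rightarrow> 'k alg_closure"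
  assumes "A < B" and "m > 0" and "g = (m, 0)"
    and "cylindrical_network A B g N"
    and "r \<ge> 1" and "r_vertex N r u" and "r_vertex N r v"
    and "Q_roots g N \<gamma>"
  shows "(\<exists>Q :: 'k poly. map_poly to_ac Q = Q_h (max_wind g N) \<gamma> r \<and>
            linear_recurrence (signed_path_sum g N r u v) Q) \<and>
         (planar_network A B g N \<longrightarrow>
            (\<exists>Q :: 'k poly. map_poly to_ac Q = Q_e (max_wind g N) \<gamma> r \<and>
               linear_recurrence (signed_path_sum g N r u v) Q))"
proof -
  let ?d = "max_wind g N"
  interpret cylinder A B m g N using assms by unfold_locales auto
  interpret subfield_set "range (to_ac :: 'k \<Rightarrow> 'k alg_closure)"
    by unfold_locales (auto simp flip: to_ac_1 to_ac_diff to_ac_mult to_ac_inverse)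
  obtain t0 where t0: "\<And>t. t \<ge> t0 \<Longrightarrow> act (Q_e ?d \<gamma> r) (\<lambda>l. to_ac (signed_path_sum g N r u v l)) t = 0"
    using signed_path_sum_annihilated[of u r v \<gamma>] assms unfolding r_vertex_def by blast
  \<comment> \<open>The sign in \<open>Q_roots\<close> is its own inverse; so the monic product has
    coefficients in the ground field too, as the rationality lemma requires.\<close>
  have "(\<Prod>i = 1..?d. [:- \<gamma> i, 1:]) = Polynomial.smult ((-1) ^ ?d) (map_poly to_ac (Q_poly g N))"
    using assms(8) unfolding Q_roots_def by (simp flip: power_mult_distrib)
  then have "Polynomial.coeff (\<Prod>i = 1..?d. [:- \<gamma> i, 1:]) k = to_ac ((-1) ^ ?d * Polynomial.coeff (Q_poly g N) k)" for k
    by (simp add: coeff_map_poly)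
  then have "Polynomial.coeff (\<Prod>i = 1..?d. [:- \<gamma> i, 1:]) k \<in> range to_ac" for k by (metis rangeI)
  note co = Q_e_Q_h_coeff_mem[OF this, where r = r]
  have "Polynomial.lead_coeff (Q_h ?d \<gamma> r) = 1" "Polynomial.lead_coeff (Q_e ?d \<gamma> r) = 1"
    unfolding Q_h_def Q_e_def by (simp_all add: lead_coeff_prod)
  then show ?thesis
    using linear_recurrence_of_dvd[OF t0 Q_e_dvd_Q_h _ co(2)] linear_recurrence_of_dvd[OF t0 dvd_refl _ co(1)] by blast
qed

end
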